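(* Let $(M,\mathsf D)$ be a closed Dirac manifold. Then the distribution $\mathsf{G_0}$ is completely integrable in the sense of Stefan and Sussmann, and each of its leaves inherits the trivial presymplectic structure; that is, for each leaf $N$ of $\mathsf{G_0}$ the two-form $\omega_N$ induced by $\mathsf D$ on $N$ is zero.
   Context: Sections may be locally defined (on open subsets); $\Gamma(\cdot)$ denotes local smooth sections. A Dirac structure on $M$ is a subbundle $\mathsf D\subseteq TM\oplus T^*M$ equal to its own orthogonal for the pairing $\langle(u,\alpha),(v,\beta)\rangle=\beta(u)+\alpha(v)$. It is closed if $\Gamma(\mathsf D)$ is closed under the bracket $[(X,\alpha),(Y,\beta)]=([X,Y],\pounds_X\beta-\mathbf i_Y\mathbf d\alpha)$. The distribution $\mathsf{G_0}\subseteq TM$ is defined by $\mathsf{G_0}(m)=\{X(m)\mid X\text{ a local vector field around } m\text{ with }(X,0)\in\Gamma(\mathsf D)\}$; its rank need not be constant. A distribution $\Delta\subseteq TM$ is completely integrable if through every point of $M$ there passes an injectively immersed connected submanifold $L$ with $T_xL=\Delta(x)$ for all $x\in L$; leaves are the maximal such submanifolds. The two-form induced by $\mathsf D$ on a leaf $N$ with inclusion $\iota_N$ is $\omega_N(n)(\tilde X(n),\tilde Y(n))=\alpha_n(Y(n))=-\beta_n(X(n))$ for vector fields $\tilde X,\tilde Y$ on $N$, where $(X,\alpha),(Y,\beta)\in\Gamma(\mathsf D)$ are such that $X,Y$ are $\iota_N$-related to $\tilde X,\tilde Y$ respectively. *)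

theory Defs
  imports "HOL-Analysis.Analysis"
begin

section \<open>Smooth maps between subsets of Euclidean spaces\<close>

text \<open>\<open>Ck_on k f S\<close> is only meant for open \<open>S\<close>.  In finite dimension a map is of class
  \<open>C\<^sup>k\<^sup>+\<^sup>1\<close> iff it is differentiable and all its directional derivatives are of class \<open>C\<^sup>k\<close>.\<close>

primrec Ck_on ::
  "nat \<Rightarrow> ('e::euclidean_space \<Rightarrow> 'f::real_normed_vector) \<Rightarrow> 'e set \<Rightarrow> bool" where
  "Ck_on 0 f S \<longleftrightarrow> continuous_on S f"
| "Ck_on (Suc k) f S \<longleftrightarrow>
     (\<forall>x\<in>S. f differentiable (at x)) \<and>
     (\<forall>v. Ck_on k (\<lambda>x. frechet_derivative f (at x) v) S)"

text \<open>Smoothness on an arbitrary subset, in the usual sense of local smooth extensibility.  It is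
  used below for relatively open subsets of a linear subspace, where it agrees with
  smoothness in the sense of that subspace.\<close>

definition smooth_on_set ::
  "'e::euclidean_space set \<Rightarrow> ('e \<Rightarrow> 'f::real_normed_vector) \<Rightarrow> bool" where
  "smooth_on_set S f \<longleftrightarrow>
     (\<forall>x\<in>S. \<exists>W g. open W \<and> x \<in> W \<and> (\<forall>k. Ck_on k g W) \<and> (\<forall>y\<in>W \<inter> S. g y = f y))"


section \<open>Smooth manifolds\<close>

text \<open>A manifold lives on a subset \<open>topspace (mtop M)\<close> of a type.  Its charts take values in a linear
  subspace \<open>model M\<close> of a Euclidean space, so that \<open>dim (model M)\<close> is the dimension of the
  manifold.  Since the topology and the dimension are values rather than types, a manifold and its
  immersed submanifolds (of any dimension, with a topology possibly finer than the induced one)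
  have the same type, and submanifolds are literally subsets.\<close>

record ('a, 'e) mfd =
  mtop :: "'a topology"
  atlas :: "('a set \<times> ('a \<Rightarrow> 'e)) set"
  model :: "'e set"

definition smooth_manifold :: "('a, 'e::euclidean_space) mfd \<Rightarrow> bool" where
  "smooth_manifold M \<longleftrightarrow>
     Hausdorff_space (mtop M) \<and> second_countable (mtop M) \<and>
     subspace (model M) \<and>
     (\<Union>(U, \<phi>)\<in>atlas M. U) = topspace (mtop M) \<and>
     (\<forall>(U, \<phi>)\<in>atlas M.
        openin (mtop M) U \<and>
        openin (top_of_set (model M)) (\<phi> ` U) \<and>
        homeomorphic_map (subtopology (mtop M) U) (top_of_set (\<phi> ` U)) \<phi>) \<and>
     (\<forall>(U, \<phi>)\<in>atlas M. \<forall>(V, \<psi>)\<in>atlas M.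
        smooth_on_set (\<phi> ` (U \<inter> V)) (\<lambda>z. \<psi> (inv_into U \<phi> z)))"

definition smooth_map ::
  "('a, 'e::euclidean_space) mfd \<Rightarrow> ('b, 'f::euclidean_space) mfd \<Rightarrow> ('a \<Rightarrow> 'b) \<Rightarrow> bool" where
  "smooth_map M N F \<longleftrightarrow>
     continuous_map (mtop M) (mtop N) F \<and>
     (\<forall>(U, \<phi>)\<in>atlas M. \<forall>(V, \<psi>)\<in>atlas N.
        smooth_on_set (\<phi> ` {x \<in> U. F x \<in> V}) (\<lambda>z. \<psi> (F (inv_into U \<phi> z))))"

definition smooth_fun ::
  "('a, 'e::euclidean_space) mfd \<Rightarrow> 'a set \<Rightarrow> ('a \<Rightarrow> real) \<Rightarrow> bool" where
  "smooth_fun M W f \<longleftrightarrow>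
     (\<forall>(U, \<phi>)\<in>atlas M. smooth_on_set (\<phi> ` (U \<inter> W)) (\<lambda>z. f (inv_into U \<phi> z)))"

definition smooth_near ::
  "('a, 'e::euclidean_space) mfd \<Rightarrow> 'a \<Rightarrow> ('a \<Rightarrow> real) \<Rightarrow> bool" where
  "smooth_near M p f \<longleftrightarrow> (\<exists>W. openin (mtop M) W \<and> p \<in> W \<and> smooth_fun M W f)"


section \<open>Tangent vectors and covectors\<close>

text \<open>Tangent vectors at \<open>p\<close> are derivations of the algebra of germs at \<open>p\<close> of smooth functions.
  The value on functions that are not smooth near \<open>p\<close> (and likewise, for covectors, on
  non-tangent vectors) is fixed to be \<open>0\<close>, so that equality of vectors and covectors is equality of
  functions.\<close>

type_synonym 'a vec = "('a \<Rightarrow> real) \<Rightarrow> real"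
type_synonym 'a covec = "'a vec \<Rightarrow> real"

definition tangent_space :: "('a, 'e::euclidean_space) mfd \<Rightarrow> 'a \<Rightarrow> 'a vec set" where
  "tangent_space M p = {v.
     (\<forall>f g. smooth_near M p f \<longrightarrow> smooth_near M p g \<longrightarrow>
        v (\<lambda>x. f x + g x) = v f + v g \<and>
        v (\<lambda>x. f x * g x) = f p * v g + g p * v f) \<and>
     (\<forall>c f. smooth_near M p f \<longrightarrow> v (\<lambda>x. c * f x) = c * v f) \<and>
     (\<forall>f g W. smooth_near M p f \<longrightarrow> openin (mtop M) W \<longrightarrow> p \<in> W \<longrightarrow> (\<forall>x\<in>W. f x = g x) \<longrightarrow>
        v f = v g) \<and>
     (\<forall>f. \<not> smooth_near M p f \<longrightarrow> v f = 0)}"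

definition cotangent_space :: "('a, 'e::euclidean_space) mfd \<Rightarrow> 'a \<Rightarrow> 'a covec set" where
  "cotangent_space M p = {\<alpha>.
     (\<forall>u\<in>tangent_space M p. \<forall>v\<in>tangent_space M p. \<alpha> (\<lambda>f. u f + v f) = \<alpha> u + \<alpha> v) \<and>
     (\<forall>c. \<forall>v\<in>tangent_space M p. \<alpha> (\<lambda>f. c * v f) = c * \<alpha> v) \<and>
     (\<forall>v. v \<notin> tangent_space M p \<longrightarrow> \<alpha> v = 0)}"

definition tangent_map ::
  "('b, 'f::euclidean_space) mfd \<Rightarrow> ('a \<Rightarrow> 'b) \<Rightarrow> 'a \<Rightarrow> 'a vec \<Rightarrow> 'b vec" where
  "tangent_map N F p v = (\<lambda>f. if smooth_near N (F p) f then v (\<lambda>x. f (F x)) else 0)"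


section \<open>Local vector fields and one-forms\<close>

text \<open>Local objects on an open set \<open>U\<close> are total functions whose values outside \<open>U\<close> are
  irrelevant.  All operations below depend only on germs.\<close>

definition vector_field ::
  "('a, 'e::euclidean_space) mfd \<Rightarrow> 'a set \<Rightarrow> ('a \<Rightarrow> 'a vec) \<Rightarrow> bool" where
  "vector_field M U X \<longleftrightarrow>
     (\<forall>p\<in>U. X p \<in> tangent_space M p) \<and>
     (\<forall>W f. openin (mtop M) W \<longrightarrow> W \<subseteq> U \<longrightarrow> smooth_fun M W f \<longrightarrow> smooth_fun M W (\<lambda>p. X p f))"

definition one_form ::
  "('a, 'e::euclidean_space) mfd \<Rightarrow> 'a set \<Rightarrow> ('a \<Rightarrow> 'a covec) \<Rightarrow> bool" where
  "one_form M U \<alpha> \<longleftrightarrow>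
     (\<forall>p\<in>U. \<alpha> p \<in> cotangent_space M p) \<and>
     (\<forall>W X. openin (mtop M) W \<longrightarrow> W \<subseteq> U \<longrightarrow> vector_field M W X \<longrightarrow>
        smooth_fun M W (\<lambda>p. \<alpha> p (X p)))"

definition lie_bracket ::
  "('a, 'e::euclidean_space) mfd \<Rightarrow> ('a \<Rightarrow> 'a vec) \<Rightarrow> ('a \<Rightarrow> 'a vec) \<Rightarrow> 'a \<Rightarrow> 'a vec" where
  "lie_bracket M X Y p =
     (\<lambda>f. if smooth_near M p f then X p (\<lambda>q. Y q f) - Y p (\<lambda>q. X q f) else 0)"

text \<open>In the next two definitions the described value does not depend on the local
  vector fields used to extend the given tangent vectors.\<close>

text \<open>\<open>(Lie\<^sub>X \<beta>)(Z) = X(\<beta>(Z)) - \<beta>([X, Z])\<close>\<close>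

definition lie_derivative ::
  "('a, 'e::euclidean_space) mfd \<Rightarrow> ('a \<Rightarrow> 'a vec) \<Rightarrow> ('a \<Rightarrow> 'a covec) \<Rightarrow> 'a \<Rightarrow> 'a covec" where
  "lie_derivative M X \<beta> p v =
     (if v \<in> tangent_space M p then
        THE r. \<exists>W Z. openin (mtop M) W \<and> p \<in> W \<and> vector_field M W Z \<and> Z p = v \<and>
          r = X p (\<lambda>q. \<beta> q (Z q)) - \<beta> p (lie_bracket M X Z p)
      else 0)"

text \<open>\<open>d\<alpha>(Y, Z) = Y(\<alpha>(Z)) - Z(\<alpha>(Y)) - \<alpha>([Y, Z])\<close>\<close>

definition exterior_derivative ::
  "('a, 'e::euclidean_space) mfd \<Rightarrow> ('a \<Rightarrow> 'a covec) \<Rightarrow> 'a \<Rightarrow> 'a vec \<Rightarrow> 'a vec \<Rightarrow> real" where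
  "exterior_derivative M \<alpha> p u v =
     (if u \<in> tangent_space M p \<and> v \<in> tangent_space M p then
        THE r. \<exists>W Y Z. openin (mtop M) W \<and> p \<in> W \<and> vector_field M W Y \<and> vector_field M W Z \<and>
          Y p = u \<and> Z p = v \<and>
          r = Y p (\<lambda>q. \<alpha> q (Z q)) - Z p (\<lambda>q. \<alpha> q (Y q)) - \<alpha> p (lie_bracket M Y Z p)
      else 0)"


section \<open>Dirac structures\<close>

type_synonym 'a pontryagin_family = "'a \<Rightarrow> ('a vec \<times> 'a covec) set"

definition bundle_section ::
  "('a, 'e::euclidean_space) mfd \<Rightarrow> 'a pontryagin_family \<Rightarrow> 'a set \<Rightarrow> ('a \<Rightarrow> 'a vec) \<Rightarrow> ('a \<Rightarrow> 'a covec) \<Rightarrow> bool"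
  where
  "bundle_section M D U X \<alpha> \<longleftrightarrow>
     openin (mtop M) U \<and> vector_field M U X \<and> one_form M U \<alpha> \<and> (\<forall>p\<in>U. (X p, \<alpha> p) \<in> D p)"

text \<open>A subbundle of \<open>TM \<oplus> T\<^sup>*M\<close> is a family of subspaces of the fibres that has a smooth
  frame around every point.\<close>

definition subbundle :: "('a, 'e::euclidean_space) mfd \<Rightarrow> 'a pontryagin_family \<Rightarrow> bool" where
  "subbundle M D \<longleftrightarrow>
     (\<forall>p\<in>topspace (mtop M). \<exists>U (r::nat) X \<alpha>.
        p \<in> U \<and> (\<forall>i<r. bundle_section M D U (X i) (\<alpha> i)) \<and> openin (mtop M) U \<and>
        (\<forall>q\<in>U.
           D q = {(\<lambda>f. \<Sum>i<r. c i * X i q f, \<lambda>v. \<Sum>i<r. c i * \<alpha> i q v) | c :: nat \<Rightarrow> real. True} \<and>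
           (\<forall>c :: nat \<Rightarrow> real.
              (\<lambda>f. \<Sum>i<r. c i * X i q f) = (\<lambda>f. 0) \<and>
              (\<lambda>v. \<Sum>i<r. c i * \<alpha> i q v) = (\<lambda>v. 0) \<longrightarrow> (\<forall>i<r. c i = 0))))"

definition orthogonal_fibre ::
  "('a, 'e::euclidean_space) mfd \<Rightarrow> 'a \<Rightarrow> ('a vec \<times> 'a covec) set \<Rightarrow> ('a vec \<times> 'a covec) set" where
  "orthogonal_fibre M p S =
     {(u, \<alpha>). u \<in> tangent_space M p \<and> \<alpha> \<in> cotangent_space M p \<and> (\<forall>(v, \<beta>)\<in>S. \<beta> u + \<alpha> v = 0)}"

definition dirac_structure :: "('a, 'e::euclidean_space) mfd \<Rightarrow> 'a pontryagin_family \<Rightarrow> bool" where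
  "dirac_structure M D \<longleftrightarrow>
     subbundle M D \<and> (\<forall>p\<in>topspace (mtop M). D p = orthogonal_fibre M p (D p))"

definition closed_dirac :: "('a, 'e::euclidean_space) mfd \<Rightarrow> 'a pontryagin_family \<Rightarrow> bool" where
  "closed_dirac M D \<longleftrightarrow>
     dirac_structure M D \<and>
     (\<forall>U X \<alpha> Y \<beta>. bundle_section M D U X \<alpha> \<longrightarrow> bundle_section M D U Y \<beta> \<longrightarrow>
        bundle_section M D U (lie_bracket M X Y)
          (\<lambda>p v. lie_derivative M X \<beta> p v - exterior_derivative M \<alpha> p (Y p) v))"

definition G0 :: "('a, 'e::euclidean_space) mfd \<Rightarrow> 'a pontryagin_family \<Rightarrow> 'a \<Rightarrow> 'a vec set" where
  "G0 M D p = {X p | U X. p \<in> U \<and> bundle_section M D U X (\<lambda>q v. 0)}"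


section \<open>Integral manifolds and leaves\<close>

definition immersed_submanifold ::
  "('a, 'e::euclidean_space) mfd \<Rightarrow> ('a, 'e) mfd \<Rightarrow> bool" where
  "immersed_submanifold M L \<longleftrightarrow>
     smooth_manifold L \<and> topspace (mtop L) \<subseteq> topspace (mtop M) \<and>
     smooth_map L M (\<lambda>x. x) \<and>
     (\<forall>x\<in>topspace (mtop L). inj_on (tangent_map M (\<lambda>x. x) x) (tangent_space L x))"

definition integral_manifold ::
  "('a, 'e::euclidean_space) mfd \<Rightarrow> ('a \<Rightarrow> 'a vec set) \<Rightarrow> ('a, 'e) mfd \<Rightarrow> bool" where
  "integral_manifold M \<Delta> L \<longleftrightarrow>
     immersed_submanifold M L \<and> connected_space (mtop L) \<and>
     (\<forall>x\<in>topspace (mtop L). tangent_map M (\<lambda>x. x) x ` tangent_space L x = \<Delta> x)"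

definition completely_integrable ::
  "('a, 'e::euclidean_space) mfd \<Rightarrow> ('a \<Rightarrow> 'a vec set) \<Rightarrow> bool" where
  "completely_integrable M \<Delta> \<longleftrightarrow>
     (\<forall>p\<in>topspace (mtop M). \<exists>L. integral_manifold M \<Delta> L \<and> p \<in> topspace (mtop L))"

definition leaf ::
  "('a, 'e::euclidean_space) mfd \<Rightarrow> ('a \<Rightarrow> 'a vec set) \<Rightarrow> ('a, 'e) mfd \<Rightarrow> bool" where
  "leaf M \<Delta> N \<longleftrightarrow>
     integral_manifold M \<Delta> N \<and>
     (\<forall>L. integral_manifold M \<Delta> L \<longrightarrow> topspace (mtop N) \<subseteq> topspace (mtop L) \<longrightarrow>
        topspace (mtop L) = topspace (mtop N))"

definition related_by_inclusion ::
  "('a, 'e::euclidean_space) mfd \<Rightarrow> 'a set \<Rightarrow> ('a \<Rightarrow> 'a vec) \<Rightarrow> ('a \<Rightarrow> 'a vec) \<Rightarrow> bool" where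
  "related_by_inclusion M V X' X \<longleftrightarrow> (\<forall>x\<in>V. tangent_map M (\<lambda>x. x) x (X' x) = X x)"

text \<open>The two-form induced by \<open>D\<close> on a leaf \<open>N\<close>, at \<open>n\<close>, on tangent vectors \<open>v\<close>, \<open>w\<close> of \<open>N\<close>.  The
  description operator yields a meaningful value only if vector fields \<open>X'\<close>, \<open>Y'\<close> on \<open>N\<close> through
  \<open>v\<close>, \<open>w\<close> and sections of \<open>D\<close> as required exist and the value does not depend on them.\<close>

definition induced_two_form ::
  "('a, 'e::euclidean_space) mfd \<Rightarrow> 'a pontryagin_family \<Rightarrow> ('a, 'e) mfd \<Rightarrow> 'a \<Rightarrow> 'a vec \<Rightarrow> 'a vec \<Rightarrow> real" where
  "induced_two_form M D N n v w =
     (THE r. \<exists>V X' Y' U X \<alpha> Y \<beta>.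
        openin (mtop N) V \<and> n \<in> V \<and> vector_field N V X' \<and> vector_field N V Y' \<and>
        X' n = v \<and> Y' n = w \<and>
        V \<subseteq> U \<and> bundle_section M D U X \<alpha> \<and> bundle_section M D U Y \<beta> \<and>
        related_by_inclusion M V X' X \<and> related_by_inclusion M V Y' Y \<and>
        r = \<alpha> n (Y n) \<and> r = - \<beta> n (X n))"

end

theory Submission
  imports Defs
begin

text \<open>If \<open>(X, 0)\<close> is a section of the closed Dirac structure \<open>D\<close>, then the bracket with \<open>(X, 0)\<close>
  is the Lie derivative along \<open>X\<close>, so \<open>\<Gamma>(D)\<close> is stable under it.  In coordinates in which \<open>X\<close> is
  constant this Lie derivative is componentwise, and uniqueness for a linear ODE, applied to the
  pairings of a fixed element of \<open>D\<close> with a frame, shows together with \<open>D = D\<^sup>\<bottom>\<close> that \<open>D\<close> is invariant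
  under translation along \<open>X\<close>.  Hence sections \<open>(X, 0)\<close> can be straightened one after the other: freeze
  the next one in the directions already straightened, project it to their orthogonal complement
  and use a flow box.  When this process stops at \<open>p\<close>, the constant fields obtained span \<open>G\<^sub>0(p)\<close>, and by
  translation invariance they span \<open>G\<^sub>0\<close> along the coordinate slice through \<open>p\<close>, which is therefore an
  integral manifold, although the rank of \<open>G\<^sub>0\<close> may be larger off the slice.  The induced two-form
  vanishes because \<open>(X, 0)\<close> is orthogonal to \<open>D\<close>.\<close>

section \<open>Functions of class \<open>C\<^sup>k\<close> and fixed points depending on parameters\<close>

text \<open>The rank of \<open>G0\<close> may jump, so there need not be a frame of
  \<open>G0\<close> around a point and the constant-rank theorem of Frobenius does not apply. What
  is smooth and of locally constant rank is \<open>D\<close>, and its invariance under translation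
  takes the place of a frame of \<open>G0\<close>. The analysis rests on one bootstrap: a solution
  of a fixed-point equation that is linear and contractive in the unknown inherits the smoothness of
  the coefficients. The derivative of a flow in time and initial value, the derivative of an inverse
  map and the components of a field restricted to an immersed submanifold are all such solutions.
  Dimensions are values and not types, so charts take values in a linear subspace of a Euclidean
  space; composing with the orthogonal projection onto it reduces the calculus to open sets. Tangent
  vectors are derivations, and Hadamard's lemma identifies them with coordinate vectors. The induced
  two-form is given by a description operator, so its vanishing also requires smooth fields on the
  leaf through given tangent vectors.\<close>

lemma Ck_on_cong:
  assumes "open S" "\<And>x. x \<in> S \<Longrightarrow> f x = g x" "Ck_on k f S"
  shows "Ck_on k g S"
  using assms
proof (induction k arbitrary: f g)
  case 0
  then show ?case by (metis Ck_on.simps(1) continuous_on_cong)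
next
  case (Suc k)
  have d: "(g has_derivative frechet_derivative f (at x)) (at x)" if "x \<in> S" for x
  proof (rule has_derivative_transform_within_open)
    show "(f has_derivative frechet_derivative f (at x)) (at x)"
      using Suc.prems that by (simp add: frechet_derivative_works)
  qed (use Suc.prems that in auto)
  then have eq: "frechet_derivative f (at x) = frechet_derivative g (at x)" if "x \<in> S" for x
    using frechet_derivative_at that by blast
  have "Ck_on k (\<lambda>x. frechet_derivative g (at x) v) S" for v
    by (rule Suc.IH[of "\<lambda>x. frechet_derivative f (at x) v"]) (use Suc.prems eq in auto)
  then show ?case using d by (auto simp: differentiable_def)
qed

text \<open>\<open>frechet_derivative\<close> is a choice operator; this rule lets a derivative be
  given by an explicit formula, which is how the closure properties below are proved by induction on
  \<open>k\<close>.\<close>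

lemma Ck_on_SucI:
  assumes "open S" and "\<And>x. x \<in> S \<Longrightarrow> (f has_derivative f' x) (at x)"
    and "\<And>v. Ck_on k (\<lambda>x. f' x v) S"
  shows "Ck_on (Suc k) f S"
proof -
  have eq: "frechet_derivative f (at x) = f' x" if "x \<in> S" for x
    using assms(2)[OF that] by (metis frechet_derivative_at)
  have "Ck_on k (\<lambda>x. frechet_derivative f (at x) v) S" for v
    by (rule Ck_on_cong[OF assms(1) _ assms(3)[of v]]) (simp add: eq)
  then show ?thesis
    using assms(2) by (auto simp: differentiable_def)
qed

lemma Ck_on_has_derivative:
  "Ck_on (Suc k) f S \<Longrightarrow> x \<in> S \<Longrightarrow> (f has_derivative frechet_derivative f (at x)) (at x)"
  by (simp add: frechet_derivative_works)

lemma Ck_on_continuous: "Ck_on k f S \<Longrightarrow> continuous_on S f"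
  by (cases k) (auto intro: differentiable_imp_continuous_on
      simp: differentiable_on_def differentiable_at_withinI)

lemma Ck_on_SucD: "Ck_on (Suc k) f S \<Longrightarrow> Ck_on k f S"
proof (induction k arbitrary: f)
  case 0
  then show ?case using Ck_on_continuous[OF 0] by simp
next
  case (Suc k)
  then show ?case by (metis Ck_on.simps(2))
qed

lemma Ck_on_subset: "Ck_on k f S \<Longrightarrow> T \<subseteq> S \<Longrightarrow> Ck_on k f T"
  by (induction k arbitrary: f) (auto intro: continuous_on_subset)

lemma Ck_on_local:
  assumes "\<And>x. x \<in> S \<Longrightarrow> \<exists>W. open W \<and> x \<in> W \<and> Ck_on k f W"
  shows "Ck_on k f S"
  using assms
proof (induction k arbitrary: f)
  case 0
  show ?case
    unfolding Ck_on.simps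
  proof (rule continuous_at_imp_continuous_on, rule ballI)
    fix x assume "x \<in> S"
    from 0[OF this] show "isCont f x"
      by (auto simp: continuous_on_eq_continuous_at)
  qed
next
  case (Suc k)
  show ?case
    unfolding Ck_on.simps
  proof (intro conjI ballI allI)
    fix x assume "x \<in> S"
    from Suc.prems[OF this] show "f differentiable (at x)"
      by auto
  next
    fix v
    show "Ck_on k (\<lambda>x. frechet_derivative f (at x) v) S"
      by (rule Suc.IH) (use Suc.prems in \<open>auto, blast\<close>)
  qed
qed

lemma Ck_on_const: "open S \<Longrightarrow> Ck_on k (\<lambda>x. c) S"
proof (induction k arbitrary: c)
  case (Suc k)
  show ?case
    by (rule Ck_on_SucI[where f' = "\<lambda>x v. 0"]) (use Suc in auto)
qed auto

lemma Ck_on_bounded_linear: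
  assumes "open S" "bounded_linear f"
  shows "Ck_on k f S"
proof (cases k)
  case 0
  then show ?thesis using assms
    by (simp add: linear_continuous_on)
next
  case (Suc k)
  show ?thesis unfolding Suc
    by (rule Ck_on_SucI[where f' = "\<lambda>x. f"])
      (use assms in \<open>auto intro: bounded_linear_imp_has_derivative Ck_on_const\<close>)
qed

lemma Ck_on_linear_compose:
  assumes "open S" "bounded_linear L" "Ck_on k f S"
  shows "Ck_on k (\<lambda>x. L (f x)) S"
  using assms(3)
proof (induction k arbitrary: f)
  case 0
  then show ?case using assms
    by (auto intro: bounded_linear.continuous_on)
next
  case (Suc k)
  show ?case
    by (rule Ck_on_SucI[where f' = "\<lambda>x v. L (frechet_derivative f (at x) v)"])
      (use assms Suc in \<open>auto intro: bounded_linear.has_derivative simp: frechet_derivative_works\<close>)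
qed

lemma Ck_on_add:
  assumes "open S" "Ck_on k f S" "Ck_on k g S"
  shows "Ck_on k (\<lambda>x. f x + g x) S"
  using assms(2,3)
proof (induction k arbitrary: f g)
  case 0
  then show ?case by (auto intro: continuous_intros)
next
  case (Suc k)
  show ?case
    by (rule Ck_on_SucI[where f' = "\<lambda>x v. frechet_derivative f (at x) v + frechet_derivative g (at x) v"])
      (use assms Suc in \<open>auto intro!: derivative_eq_intros simp: frechet_derivative_works\<close>)
qed

lemma Ck_on_sum:
  assumes "open S" "\<And>i. i \<in> I \<Longrightarrow> Ck_on k (f i) S"
  shows "Ck_on k (\<lambda>x. \<Sum>i\<in>I. f i x) S"
  using assms(2)
  by (induction I rule: infinite_finite_induct) (auto intro: Ck_on_const Ck_on_add assms(1))

lemma Ck_on_bilinear: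
  assumes "open S" "bounded_bilinear B" "Ck_on k f S" "Ck_on k g S"
  shows "Ck_on k (\<lambda>x. B (f x) (g x)) S"
  using assms(3,4)
proof (induction k arbitrary: f g)
  case 0
  then show ?case using assms
    by (auto intro: bounded_bilinear.continuous_on)
next
  case (Suc k)
  show ?case
    by (rule Ck_on_SucI[where f' = "\<lambda>x v. B (f x) (frechet_derivative g (at x) v) + B (frechet_derivative f (at x) v) (g x)"])
      (use assms(1) Suc.prems Suc.IH Ck_on_SucD[OF Suc.prems(1)] Ck_on_SucD[OF Suc.prems(2)] in
        \<open>auto intro!: bounded_bilinear.FDERIV[OF assms(2)] Ck_on_add simp: frechet_derivative_works\<close>)
qed

text \<open>Turns a derivative in a direction that may itself vary into a sum of products with
  partial derivatives, to which the closure properties for fixed directions apply.\<close>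

lemma frechet_derivative_basis:
  fixes f :: "'e::euclidean_space \<Rightarrow> 'f::real_normed_vector"
  assumes "f differentiable (at x)"
  shows "frechet_derivative f (at x) v = (\<Sum>b\<in>Basis. (v \<bullet> b) *\<^sub>R frechet_derivative f (at x) b)"
  using linear_frechet_derivative[OF assms]
  by (subst (1) euclidean_representation[of v, symmetric])
    (simp only: linear_sum linear_cmul)

lemma Ck_on_compose:
  fixes f :: "'f::euclidean_space \<Rightarrow> 'g::real_normed_vector"
  assumes "open S" "open T" "Ck_on k f T" "Ck_on k g S" "\<And>x. x \<in> S \<Longrightarrow> g x \<in> T"
  shows "Ck_on k (\<lambda>x. f (g x)) S"
  using assms(3,4)
proof (induction k arbitrary: f)
  case 0
  then show ?case using assms(5)
    by (auto intro: continuous_on_compose2)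
next
  case (Suc k)
  \<comment> \<open>The chain rule differentiates \<open>f\<close> in the moving direction given by
    the derivative of \<open>g\<close>. Expanded over \<open>Basis\<close>, it only contains partial
    derivatives of \<open>f\<close> composed with the unchanged \<open>g\<close>, so the induction
    generalises \<open>f\<close> alone.\<close>
  let ?f' = "\<lambda>x v. \<Sum>b\<in>Basis. (frechet_derivative g (at x) v \<bullet> b) *\<^sub>R frechet_derivative f (at (g x)) b"
  show ?case
  proof (rule Ck_on_SucI[where f' = ?f'])
    fix x assume x: "x \<in> S"
    have d: "f differentiable (at (g x))" "g differentiable (at x)"
      using Suc.prems x assms(5) by auto
    have "((\<lambda>x. f (g x)) has_derivative (\<lambda>v. frechet_derivative f (at (g x)) (frechet_derivative g (at x) v))) (at x)"
      using d by (auto intro!: has_derivative_compose[of g _ x UNIV f] simp: frechet_derivative_works)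
    then show "((\<lambda>x. f (g x)) has_derivative ?f' x) (at x)"
      by (subst (asm) frechet_derivative_basis[OF d(1)])
  next
    fix v
    show "Ck_on k (\<lambda>x. ?f' x v) S"
    proof (intro Ck_on_sum Ck_on_bilinear[OF _ bounded_bilinear_scaleR])
      fix b :: 'f
      show "Ck_on k (\<lambda>x. frechet_derivative g (at x) v \<bullet> b) S"
        using Suc.prems by (auto intro: Ck_on_linear_compose assms bounded_linear_inner_left)
      show "Ck_on k (\<lambda>x. frechet_derivative f (at (g x)) b) S"
        using Suc.prems Ck_on_SucD by (intro Suc.IH) auto
    qed (use assms in auto)
  qed (use assms in auto)
qed

section \<open>Derivatives of fixed points of contractions depending on parameters\<close>

lemma has_derivative_eventually_lipschitz:
  assumes "(f has_derivative f') (at x)"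
  shows "\<exists>C d. C \<ge> 0 \<and> d > 0 \<and> (\<forall>y. norm (y - x) < d \<longrightarrow> norm (f y - f x) \<le> C * norm (y - x))"
proof -
  have bl: "bounded_linear f'" and
    "\<forall>e>0. \<exists>d>0. \<forall>y. norm (y - x) < d \<longrightarrow> norm (f y - f x - f' (y - x)) \<le> e * norm (y - x)"
    using assms by (auto simp: has_derivative_at_alt)
  then obtain d where d: "d > 0" "\<And>y. norm (y - x) < d \<Longrightarrow> norm (f y - f x - f' (y - x)) \<le> 1 * norm (y - x)"
    by (metis zero_less_one)
  obtain K where K: "K \<ge> 0" "\<And>v. norm (f' v) \<le> norm v * K"
    using bounded_linear.nonneg_bounded[OF bl] by blast
  have "norm (f y - f x) \<le> (K + 1) * norm (y - x)" if "norm (y - x) < d" for y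
    using d(2)[OF that] K(2)[of "y - x"] norm_triangle_ineq2[of "f y - f x" "f' (y - x)"]
    by (simp add: algebra_simps)
  then show ?thesis using d K by (intro exI[of _ "K+1"] exI[of _ d]) auto
qed

text \<open>Implicit function theorem for fixed points. The derivative has to solve the linearised
  equation \<open>w v = T' (v, w v)\<close>, which Banach's theorem solves for each
  \<open>v\<close>. Contraction in the second argument first makes \<open>u\<close> Lipschitz at
  \<open>y0\<close>, so the remainder of \<open>T\<close> is small relative to
  \<open>y - y0\<close>; a second use of contraction absorbs the part of the error that involves
  \<open>u\<close> itself.\<close>

lemma fixpoint_has_derivative:
  fixes u :: "'p::real_normed_vector \<Rightarrow> 'x::banach"
  assumes T: "((\<lambda>z. T (fst z) (snd z)) has_derivative T') (at (y0, u y0))"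
    and contr: "\<And>w. norm (T' (0, w)) \<le> norm w / 2"
    and "d0 > 0"
    and fix_u: "\<And>y. norm (y - y0) < d0 \<Longrightarrow> u y = T y (u y)"
    and contr_T: "\<And>y. norm (y - y0) < d0 \<Longrightarrow> norm (T y (u y) - T y (u y0)) \<le> norm (u y - u y0) / 2"
  shows "\<exists>w. (u has_derivative w) (at y0) \<and> (\<forall>v. w v = T' (v, w v))"
proof -
  have blT: "bounded_linear T'" and
    Talt: "\<forall>e>0. \<exists>d>0. \<forall>z. norm (z - (y0, u y0)) < d \<longrightarrow>
      norm (T (fst z) (snd z) - T y0 (u y0) - T' (z - (y0, u y0))) \<le> e * norm (z - (y0, u y0))"
    using T by (auto simp: has_derivative_at_alt)
  interpret T': bounded_linear T' by fact
  have T'_split: "T' (v, w) = T' (v, 0) + T' (0, w)" for v w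
    using T'.add[of "(v, 0)" "(0, w)"] by simp
  have T'_diff: "T' (v, w) - T' (v, w') = T' (0, w - w')" for v w w'
    using T'.diff[of "(v, w)" "(v, w')"] by simp
  have "\<exists>!w\<in>UNIV. T' (v, w) = w" for v
  proof (rule Banach_fix[of UNIV "1/2"])
    show "\<And>x y. x \<in> UNIV \<Longrightarrow> y \<in> UNIV \<Longrightarrow> dist (T' (v, x)) (T' (v, y)) \<le> 1/2 * dist x y"
      using contr by (simp add: dist_norm T'_diff)
  qed auto
  then have "\<forall>v. \<exists>w. T' (v, w) = w"
    by blast
  then obtain w where w: "\<And>v. T' (v, w v) = w v" by metis
  have half0: "z = 0" if "norm z \<le> norm z / 2" for z :: 'x
    using that by simp
  have uniq: "z = w v" if "T' (v, z) = z" for v z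
    using half0[of "z - w v"] contr[of "z - w v"] T'_diff[of v z "w v"] that w[of v] by simp
  obtain K where K: "K \<ge> 0" "\<And>z. norm (T' z) \<le> norm z * K"
    using T'.nonneg_bounded by blast
  have wbd: "norm (w v) \<le> norm v * (2 * K)" for v
  proof -
    have "norm (w v) \<le> norm (T' (v, 0)) + norm (T' (0, w v))"
      using T'_split[of v "w v"] w[of v] norm_triangle_ineq by metis
    then show ?thesis using contr[of "w v"] K(2)[of "(v, 0)"] by (simp add: norm_Pair)
  qed
  have blw: "bounded_linear w"
  proof (rule bounded_linear_intro[OF _ _ wbd])
    fix a b and r :: real
    show "w (a + b) = w a + w b"
      using T'.add[of "(a, w a)" "(b, w b)"] w by (intro uniq[symmetric]) simp
    show "w (r *\<^sub>R a) = r *\<^sub>R w a"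
      using T'.scaleR[of r "(a, w a)"] w by (intro uniq[symmetric]) simp
  qed
  obtain C d1 where C: "C \<ge> 0" "d1 > 0"
    "\<And>y. norm (y - y0) < d1 \<Longrightarrow> norm (T y (u y0) - T y0 (u y0)) \<le> C * norm (y - y0)"
  proof -
    have "((\<lambda>y. (y, u y0)) has_derivative (\<lambda>h. (h, 0))) (at y0)"
      by (auto intro!: derivative_eq_intros)
    from has_derivative_compose[OF this T] have
      "((\<lambda>y. T y (u y0)) has_derivative (\<lambda>h. T' (h, 0))) (at y0)" by simp
    from has_derivative_eventually_lipschitz[OF this] show ?thesis using that by blast
  qed
  \<comment> \<open>The change of \<open>u\<close> is at most half of itself plus the change of
    \<open>T\<close> in the parameter alone; absorbing the half produces the factor 2.\<close>
  have lip: "norm (u y - u y0) \<le> 2 * C * norm (y - y0)" if "norm (y - y0) < d0" "norm (y - y0) < d1" for y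
  proof -
    have "u y - u y0 = (T y (u y) - T y (u y0)) + (T y (u y0) - T y0 (u y0))"
      using fix_u[OF that(1)] fix_u[of y0] \<open>d0 > 0\<close> by simp
    then have "norm (u y - u y0) \<le> norm (T y (u y) - T y (u y0)) + norm (T y (u y0) - T y0 (u y0))"
      by (metis norm_triangle_ineq)
    then show ?thesis using contr_T[OF that(1)] C(3)[OF that(2)] by simp
  qed
  have "(u has_derivative w) (at y0)"
    unfolding has_derivative_at_alt
  proof (intro conjI allI impI blw)
    fix e :: real assume "e > 0"
    \<comment> \<open>\<open>1 + 2 * C\<close> bounds the length of
      \<open>(y, u y) - (y0, u y0)\<close> relative to \<open>y - y0\<close>, and the 2 pays for
      absorbing the term \<open>T' (0, ?\<delta>)\<close> below.\<close>
    define e' where "e' = e / (2 * (1 + 2 * C))"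
    have "e' > 0" using \<open>e > 0\<close> C by (simp add: e'_def)
    then obtain d where d: "d > 0" "\<And>z. norm (z - (y0, u y0)) < d \<Longrightarrow>
      norm (T (fst z) (snd z) - T y0 (u y0) - T' (z - (y0, u y0))) \<le> e' * norm (z - (y0, u y0))"
      using Talt by blast
    define dd where "dd = min (min d0 d1) (d / (1 + 2 * C))"
    show "\<exists>d>0. \<forall>y. norm (y - y0) < d \<longrightarrow> norm (u y - u y0 - w (y - y0)) \<le> e * norm (y - y0)"
    proof (intro exI[of _ dd] conjI allI impI)
      show "dd > 0" using d C \<open>d0 > 0\<close> by (simp add: dd_def)
      fix y assume y: "norm (y - y0) < dd"
      then have y01: "norm (y - y0) < d0" "norm (y - y0) < d1" and yd: "norm (y - y0) < d / (1 + 2 * C)"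
        by (auto simp: dd_def)
      have "norm ((y, u y) - (y0, u y0)) \<le> norm (y - y0) + norm (u y - u y0)"
        by (simp add: norm_Pair_le)
      also have "\<dots> \<le> (1 + 2 * C) * norm (y - y0)"
        using lip[OF y01] by (simp add: algebra_simps)
      finally have n: "norm ((y, u y) - (y0, u y0)) \<le> (1 + 2 * C) * norm (y - y0)" .
      also have "\<dots> < d" using yd C(1) by (simp add: field_simps)
      finally have rem: "norm (T y (u y) - T y0 (u y0) - T' ((y, u y) - (y0, u y0))) \<le> e' * norm ((y, u y) - (y0, u y0))"
        using d(2) by fastforce
      let ?\<delta> = "u y - u y0 - w (y - y0)"
      have e1: "T' ((y, u y) - (y0, u y0)) = w (y - y0) + T' (0, ?\<delta>)"
        using T'_diff[of "y - y0" "u y - u y0" "w (y - y0)"] w[of "y - y0"] by (simp add: diff_eq_eq)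
      have e2: "u y - u y0 = T y (u y) - T y0 (u y0)"
        using fix_u[OF y01(1)] fix_u[of y0] \<open>d0 > 0\<close> by simp
      have alg: "p - q = (t - (q + z)) + z" if "p = t" for p q t z :: 'x
        using that by simp
      \<comment> \<open>The error is the remainder of \<open>T\<close> plus
        \<open>T' (0, ?\<delta>)\<close>, and the latter is at most half as long as the
        error.\<close>
      have "?\<delta> = (T y (u y) - T y0 (u y0) - T' ((y, u y) - (y0, u y0))) + T' (0, ?\<delta>)"
        unfolding e1 by (rule alg[OF e2])
      then have "norm ?\<delta> \<le> norm (T y (u y) - T y0 (u y0) - T' ((y, u y) - (y0, u y0))) + norm (T' (0, ?\<delta>))"
        by (metis norm_triangle_ineq)
      then have "norm ?\<delta> \<le> 2 * (e' * norm ((y, u y) - (y0, u y0)))"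
        using rem contr[of ?\<delta>] by simp
      also have "\<dots> \<le> 2 * (e' * ((1 + 2 * C) * norm (y - y0)))"
        using n \<open>e' > 0\<close> by (intro mult_left_mono) auto
      also have "\<dots> = e * norm (y - y0)"
        using C by (simp add: e'_def field_simps)
      finally show "norm ?\<delta> \<le> e * norm (y - y0)" .
    qed
  qed
  then show ?thesis using w by metis
qed

text \<open>The bootstrap for flows, inverses and lifted fields. Differentiating the equation for
  \<open>u\<close> gives the same linear equation for the derivative, with the same contractive part
  and an inhomogeneous term in which \<open>u\<close> occurs undifferentiated; so one order is
  gained per step. Writing the linear operator as a sum of bilinear terms avoids smooth maps with
  values in a space of operators.\<close>

lemma linear_fixpoint_Ck_on:
  fixes u :: "'p::euclidean_space \<Rightarrow> 'x::banach" and a :: "'i \<Rightarrow> 'p \<Rightarrow> 'c::real_normed_vector"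
  assumes "open P" and bil: "\<And>i. i \<in> I \<Longrightarrow> bounded_bilinear (B i)"
    and a: "\<And>i. i \<in> I \<Longrightarrow> Ck_on k (a i) P" and b: "Ck_on k b P"
    and fix_u: "\<And>y. y \<in> P \<Longrightarrow> u y = b y + (\<Sum>i\<in>I. B i (a i y) (u y))"
    and contr: "\<And>y w. y \<in> P \<Longrightarrow> norm (\<Sum>i\<in>I. B i (a i y) w) \<le> norm w / 2"
  shows "Ck_on k u P"
  using a b fix_u
proof (induction k arbitrary: b u)
  have lin: "(\<Sum>i\<in>I. B i (a i y) (v - w)) = (\<Sum>i\<in>I. B i (a i y) v) - (\<Sum>i\<in>I. B i (a i y) w)" for y v w
    by (simp add: bounded_bilinear.diff_right[OF bil] sum_subtractf)
  {
    case 0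
    show ?case
      unfolding Ck_on.simps continuous_on_eq_continuous_at[OF \<open>open P\<close>]
    proof
      fix y0 assume y0: "y0 \<in> P"
      let ?T = "\<lambda>y. b y + (\<Sum>i\<in>I. B i (a i y) (u y0))"
      have "continuous_on P ?T"
        using 0 by (auto intro!: continuous_intros bounded_bilinear.continuous_on[OF bil])
      then have "isCont ?T y0" using y0 \<open>open P\<close> by (simp add: continuous_on_eq_continuous_at)
      then have "((\<lambda>y. ?T y - ?T y0) \<longlongrightarrow> 0) (at y0)"
        unfolding isCont_def using LIM_zero by blast
      from tendsto_mult_right_zero[OF tendsto_norm_zero[OF this]]
      have lim: "((\<lambda>y. 2 * norm (?T y - ?T y0)) \<longlongrightarrow> 0) (at y0)" .
      \<comment> \<open>The difference of two values of \<open>u\<close> is the change of the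
        right-hand side at fixed \<open>u y0\<close> plus a term of at most half its length, which
        is absorbed.\<close>
      have ev: "\<forall>\<^sub>F y in at y0. norm (u y - u y0) \<le> 2 * norm (?T y - ?T y0)"
        using eventually_at_in_open[OF \<open>open P\<close> y0]
      proof eventually_elim
        case (elim y)
        then have "u y - u y0 = (?T y - ?T y0) + (\<Sum>i\<in>I. B i (a i y) (u y - u y0))"
          using 0(3)[of y] 0(3)[of y0] y0 by (simp add: lin)
        then have "norm (u y - u y0) \<le> norm (?T y - ?T y0) + norm (\<Sum>i\<in>I. B i (a i y) (u y - u y0))"
          by (metis norm_triangle_ineq)
        then show ?case using contr[of y "u y - u y0"] elim by simp
      qed
      then have "((\<lambda>y. u y - u y0) \<longlongrightarrow> 0) (at y0)"
        by (rule Lim_null_comparison[OF _ lim])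
      then show "isCont u y0" unfolding isCont_def using LIM_zero_iff by blast
    qed
  next
    case (Suc k)
    let ?b' = "\<lambda>y v. frechet_derivative b (at y) v + (\<Sum>i\<in>I. B i (frechet_derivative (a i) (at y) v) (u y))"
    have "\<exists>w. (u has_derivative w) (at y) \<and> (\<forall>v. w v = ?b' y v + (\<Sum>i\<in>I. B i (a i y) (w v)))"
      if y: "y \<in> P" for y
    proof -
      let ?T = "\<lambda>y u. b y + (\<Sum>i\<in>I. B i (a i y) u)"
      let ?T' = "\<lambda>z. frechet_derivative b (at y) (fst z) + (\<Sum>i\<in>I. B i (a i y) (snd z) + B i (frechet_derivative (a i) (at y) (fst z)) (u y))"
      obtain d0 where d0: "d0 > 0" "ball y d0 \<subseteq> P" using y \<open>open P\<close> open_contains_ball by blast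
      have inP: "z \<in> P" if "norm (z - y) < d0" for z
        using that d0 by (auto simp: subset_iff dist_norm norm_minus_commute)
      have fst': "(fst has_derivative fst) (at z)" "(snd has_derivative snd) (at z)" for z :: "'p \<times> 'x"
        by (auto intro: bounded_linear_imp_has_derivative bounded_linear_fst bounded_linear_snd)
      have comp: "((\<lambda>z. f (fst z)) has_derivative (\<lambda>z. frechet_derivative f (at y) (fst z))) (at (y, u y))"
        if "f differentiable (at y)" for f :: "'p \<Rightarrow> 'z::real_normed_vector"
        using has_derivative_compose[OF fst'(1), of f "frechet_derivative f (at y)" "(y, u y)"] that
        by (simp add: frechet_derivative_works)
      have dT: "((\<lambda>z. ?T (fst z) (snd z)) has_derivative ?T') (at (y, u y))"
      proof (intro has_derivative_add has_derivative_sum comp)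
        fix i assume "i \<in> I"
        show "((\<lambda>x. B i (a i (fst x)) (snd x)) has_derivative
          (\<lambda>x. B i (a i y) (snd x) + B i (frechet_derivative (a i) (at y) (fst x)) (u y))) (at (y, u y))"
          using bounded_bilinear.FDERIV[OF bil[OF \<open>i \<in> I\<close>] comp[of "a i"] fst'(2)[of "(y, u y)"]]
            Suc.prems(1)[OF \<open>i \<in> I\<close>] y by simp
      qed (use Suc.prems y in auto)
      have "\<exists>w. (u has_derivative w) (at y) \<and> (\<forall>v. w v = ?T' (v, w v))"
      proof -
        have [simp]: "frechet_derivative b (at y) 0 = 0"
          using Suc.prems(2) y by (auto intro!: linear_0 linear_frechet_derivative)
        have [simp]: "frechet_derivative (a i) (at y) 0 = 0" if "i \<in> I" for i
          using Suc.prems(1)[OF that] y by (auto intro!: linear_0 linear_frechet_derivative)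
        have [simp]: "B i 0 w = 0" if "i \<in> I" for i w
          using bounded_bilinear.zero_left[OF bil[OF that]] by simp
        have "(\<Sum>i\<in>I. B i (a i y) (snd (0::'p, w)) + B i (frechet_derivative (a i) (at y) (fst (0::'p, w))) (u y))
           = (\<Sum>i\<in>I. B i (a i y) w)" for w
          by (rule sum.cong) auto
        then have "norm (?T' (0, w)) \<le> norm w / 2" for w
          using contr[OF y, of w] by simp
        moreover have "norm (?T z (u z) - ?T z (u y)) \<le> norm (u z - u y) / 2" if "norm (z - y) < d0" for z
          using contr[OF inP[OF that], of "u z - u y"] by (simp add: lin)
        ultimately show ?thesis
          by (intro fixpoint_has_derivative[where T = ?T and T' = ?T' and u = u and ?y0.0 = y and ?d0.0 = d0, OF dT _ \<open>d0 > 0\<close>] Suc.prems(3) inP)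
      qed
      then obtain w where w: "(u has_derivative w) (at y)" "\<And>v. w v = ?T' (v, w v)"
        by blast
      have "w v = ?b' y v + (\<Sum>i\<in>I. B i (a i y) (w v))" for v
      proof (rule trans[OF w(2)])
        show "?T' (v, w v) = ?b' y v + (\<Sum>i\<in>I. B i (a i y) (w v))"
          by (simp only: fst_conv snd_conv sum.distrib ac_simps)
      qed
      with w(1) show ?thesis by (intro exI[of _ w] conjI allI)
    qed
    then have "\<exists>w. \<forall>y\<in>P. (u has_derivative w y) (at y) \<and> (\<forall>v. w y v = ?b' y v + (\<Sum>i\<in>I. B i (a i y) (w y v)))"
      by (intro bchoice ballI)
    then obtain w where w: "\<And>y. y \<in> P \<Longrightarrow> (u has_derivative w y) (at y)"
      "\<And>y v. y \<in> P \<Longrightarrow> w y v = ?b' y v + (\<Sum>i\<in>I. B i (a i y) (w y v))" by blast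
    have ak: "Ck_on k (a i) P" if "i \<in> I" for i using Suc.prems(1)[OF that] by (rule Ck_on_SucD)
    \<comment> \<open>The induction hypothesis serves twice: here for \<open>u\<close> itself, which
      makes the new inhomogeneous term of class \<open>k\<close>, and then for the
      derivative.\<close>
    have uk: "Ck_on k u P"
      by (rule Suc.IH[where b = b, OF ak Ck_on_SucD[OF Suc.prems(2)] Suc.prems(3)])
    show ?case
    proof (rule Ck_on_SucI[OF \<open>open P\<close> w(1)])
      fix v
      show "Ck_on k (\<lambda>y. w y v) P"
      proof (rule Suc.IH[where b = "\<lambda>y. ?b' y v", OF ak _ w(2)])
        show "Ck_on k (\<lambda>y. ?b' y v) P"
          using Suc.prems(1,2) uk by (auto intro!: Ck_on_add Ck_on_sum \<open>open P\<close> Ck_on_bilinear[OF _ bil])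
      qed
    qed (use \<open>open P\<close> in auto)
  }
qed

section \<open>Bounded continuous functions and superposition operators\<close>

text \<open>Curves on the unit interval are represented by bounded continuous functions on the whole
  real line, a type that is a Banach space; this retraction extends them constantly beyond the
  interval.\<close>

definition unit_clamp :: "real \<Rightarrow> real" where
  "unit_clamp s = max 0 (min 1 s)"

lemma unit_clamp: "unit_clamp s \<in> {0..1}" "s \<in> {0..1} \<Longrightarrow> unit_clamp s = s"
  by (auto simp: unit_clamp_def)

lemma continuous_unit_clamp [continuous_intros]: "continuous_on A unit_clamp"
  unfolding unit_clamp_def by (intro continuous_intros)

text \<open>The indefinite integral from 0, cut off at time 1 so that its operator norm is at most
  1; the length of the actual time interval enters later as a separate factor.\<close>

definition volterra :: "(real \<Rightarrow>\<^sub>C 'a::banach) \<Rightarrow> (real \<Rightarrow>\<^sub>C 'a)" where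
  "volterra u = Bcontfun (\<lambda>s. integral {0..unit_clamp s} u)"

lemma volterra_apply: "volterra u s = integral {0..unit_clamp s} u"
proof -
  have cont: "continuous_on A u" for A
    by simp
  obtain C where C: "\<And>s. norm (u s) \<le> C"
    using norm_bounded by blast
  have "(\<lambda>s. integral {0..unit_clamp s} u) \<in> bcontfun"
  proof (rule bcontfun_normI)
    have "continuous_on {0..1} (\<lambda>x. integral {0..x} u)"
      by (intro indefinite_integral_continuous_1 integrable_continuous_real cont)
    then show "continuous_on UNIV (\<lambda>s. integral {0..unit_clamp s} u)"
      by (rule continuous_on_compose2[OF _ continuous_unit_clamp]) (use unit_clamp in auto)
    fix s
    have "norm (integral {0..unit_clamp s} u) \<le> C * (unit_clamp s - 0)"
      using unit_clamp(1)[of s] by (intro integral_bound cont C) auto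
    also have "\<dots> \<le> C"
      using unit_clamp(1)[of s] order_trans[OF norm_ge_zero C[of 0]] by (auto intro: mult_left_le)
    finally show "norm (integral {0..unit_clamp s} u) \<le> C" .
  qed
  then show ?thesis by (simp add: volterra_def Bcontfun_inverse)
qed

lemma norm_volterra: "norm (volterra u) \<le> norm u"
proof (rule norm_bound)
  fix s
  have "norm (integral {0..unit_clamp s} u) \<le> norm u * (unit_clamp s - 0)"
    using unit_clamp(1)[of s] by (intro integral_bound norm_bounded) auto
  also have "\<dots> \<le> norm u"
    using unit_clamp(1)[of s] by (auto intro: mult_left_le)
  finally show "norm (volterra u s) \<le> norm u" by (simp add: volterra_apply)
qed

lemma bounded_linear_volterra: "bounded_linear volterra"
proof (rule bounded_linear_intro[where K = 1])
  show "volterra (u + v) = volterra u + volterra v" for u v :: "real \<Rightarrow>\<^sub>C 'a"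
    by (rule bcontfun_eqI)
      (auto simp: volterra_apply plus_bcontfun.rep_eq
        intro!: integral_add integrable_continuous_real)
  show "volterra (r *\<^sub>R u) = r *\<^sub>R volterra u" for r and u :: "real \<Rightarrow>\<^sub>C 'a"
    by (rule bcontfun_eqI) (simp add: volterra_apply scaleR_bcontfun.rep_eq)
qed (simp add: norm_volterra)

text \<open>Together with \<open>bcf_inner\<close> this writes the derivative of a superposition
  operator as a sum over \<open>Basis\<close> of bounded bilinear expressions.\<close>

definition bcf_scale :: "('b::topological_space \<Rightarrow>\<^sub>C real) \<Rightarrow> ('b \<Rightarrow>\<^sub>C 'a) \<Rightarrow> ('b \<Rightarrow>\<^sub>C 'a::real_normed_vector)" where
  "bcf_scale g u = Bcontfun (\<lambda>s. g s *\<^sub>R u s)"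

lemma bcf_scale_apply: "bcf_scale g u s = g s *\<^sub>R u s"
proof -
  have "(\<lambda>s. g s *\<^sub>R u s) \<in> bcontfun"
  proof (rule bcontfun_normI)
    show "norm (g s *\<^sub>R u s) \<le> norm g * norm u" for s
      using norm_bounded[of g s] norm_bounded[of u s] by (auto intro: mult_mono)
  qed (auto intro!: continuous_intros)
  then show ?thesis by (simp add: bcf_scale_def Bcontfun_inverse)
qed

lemma bounded_bilinear_bcf_scale: "bounded_bilinear (bcf_scale :: ('b::topological_space \<Rightarrow>\<^sub>C real) \<Rightarrow> _)"
proof
  show "\<exists>K. \<forall>(a :: 'b \<Rightarrow>\<^sub>C real) (b :: 'b \<Rightarrow>\<^sub>C 'a). norm (bcf_scale a b) \<le> norm a * norm b * K"
  proof (intro exI[of _ 1] allI)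
    fix a :: "'b \<Rightarrow>\<^sub>C real" and b :: "'b \<Rightarrow>\<^sub>C 'a"
    have "norm (bcf_scale a b) \<le> norm a * norm b"
      using norm_bounded[of a] norm_bounded[of b]
      by (intro norm_bound) (auto simp: bcf_scale_apply intro!: mult_mono)
    then show "norm (bcf_scale a b) \<le> norm a * norm b * 1" by simp
  qed
qed (auto intro!: bcontfun_eqI simp: bcf_scale_apply plus_bcontfun.rep_eq scaleR_bcontfun.rep_eq algebra_simps)

definition bcf_inner :: "('b::topological_space \<Rightarrow>\<^sub>C 'a) \<Rightarrow> 'a::real_inner \<Rightarrow> ('b \<Rightarrow>\<^sub>C real)" where
  "bcf_inner u b = Bcontfun (\<lambda>s. u s \<bullet> b)"

lemma bcf_inner_apply: "bcf_inner u b s = u s \<bullet> b"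
proof -
  have "(\<lambda>s. u s \<bullet> b) \<in> bcontfun"
  proof (rule bcontfun_normI)
    show "norm (u s \<bullet> b) \<le> norm u * norm b" for s
      unfolding real_norm_def
      by (rule order_trans[OF Cauchy_Schwarz_ineq2 mult_right_mono[OF norm_bounded norm_ge_zero]])
  qed (auto intro!: continuous_intros)
  then show ?thesis by (simp add: bcf_inner_def Bcontfun_inverse)
qed

lemma bounded_linear_bcf_inner: "bounded_linear (\<lambda>u. bcf_inner u b)"
proof (rule bounded_linear_intro[where K = "norm b"])
  fix u :: "'a \<Rightarrow>\<^sub>C 'b"
  show "norm (bcf_inner u b) \<le> norm u * norm b"
    by (rule norm_bound, unfold bcf_inner_apply real_norm_def)
      (rule order_trans[OF Cauchy_Schwarz_ineq2 mult_right_mono[OF norm_bounded norm_ge_zero]])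
qed (auto intro!: bcontfun_eqI simp: bcf_inner_apply plus_bcontfun.rep_eq scaleR_bcontfun.rep_eq algebra_simps)

lemma apply_bcontfun_sum: "apply_bcontfun (sum f A) s = (\<Sum>a\<in>A. apply_bcontfun (f a) s)"
  by (induction A rule: infinite_finite_induct) (auto simp: plus_bcontfun.rep_eq zero_bcontfun.rep_eq)

lemma bounded_linear_apply_bcontfun: "bounded_linear (\<lambda>u. apply_bcontfun u s)"
  by (rule bounded_linear_intro[where K = 1])
    (auto simp: plus_bcontfun.rep_eq scaleR_bcontfun.rep_eq norm_bounded)

lemma bounded_linear_const_bcontfun: "bounded_linear const_bcontfun"
  by (rule bounded_linear_intro[where K = 1])
    (auto intro!: bcontfun_eqI norm_bound simp: const_bcontfun.rep_eq plus_bcontfun.rep_eq scaleR_bcontfun.rep_eq)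

text \<open>Composing with the projection onto \<open>K\<close> makes the superposition operator total.\<close>

definition superpose :: "'a::euclidean_space set \<Rightarrow> ('a \<Rightarrow> 'b::real_normed_vector) \<Rightarrow> ('c::topological_space \<Rightarrow>\<^sub>C 'a) \<Rightarrow> ('c \<Rightarrow>\<^sub>C 'b)" where
  "superpose K f u = Bcontfun (\<lambda>s. f (closest_point K (u s)))"

lemma superpose_apply:
  assumes "compact K" "convex K" "K \<noteq> {}" "continuous_on K f"
  shows "superpose K f u s = f (closest_point K (u s))"
proof -
  have cl: "closed K" using assms compact_imp_closed by blast
  have "(\<lambda>s. f (closest_point K (u s))) \<in> bcontfun"
    unfolding bcontfun_def
  proof (intro CollectI conjI)
    have "continuous_on UNIV (\<lambda>s. closest_point K (u s))"
      by (rule continuous_on_compose2[OF continuous_on_closest_point[OF assms(2) cl assms(3), of UNIV]]) auto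
    then show "continuous_on UNIV (\<lambda>s. f (closest_point K (u s)))"
      by (rule continuous_on_compose2[OF assms(4)]) (use closest_point_in_set[OF cl assms(3)] in auto)
    have "bounded (f ` K)"
      using assms compact_continuous_image compact_imp_bounded by blast
    then show "bounded (range (\<lambda>s. f (closest_point K (u s))))"
      by (rule bounded_subset) (use closest_point_in_set[OF cl assms(3)] in auto)
  qed
  then show ?thesis unfolding superpose_def by (simp add: Bcontfun_inverse)
qed

section \<open>Superposition operators on bounded continuous functions\<close>

lemma norm_directional_le:
  fixes g :: "'a::euclidean_space \<Rightarrow> 'b::real_normed_vector"
  shows "norm (\<Sum>b\<in>Basis. (v \<bullet> b) *\<^sub>R g b) \<le> norm v * (\<Sum>b\<in>Basis. norm (g b))"
  unfolding sum_distrib_left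
  by (intro order_trans[OF norm_sum] sum_mono) (auto intro!: mult_right_mono Basis_le_norm)

text \<open>Differentiability in the supremum norm needs the first-order remainder of
  \<open>f\<close> to be small uniformly in the argument \<open>s\<close>; this comes from uniform
  continuity of the partial derivatives on the compact ball. The gap between \<open>R'\<close> and
  \<open>R\<close> leaves a neighbourhood of \<open>u\<close> on which the projection onto the ball
  acts trivially.\<close>

lemma superpose_has_derivative:
  fixes f :: "'a::euclidean_space \<Rightarrow> 'b::real_normed_vector" and u :: "'c::topological_space \<Rightarrow>\<^sub>C 'a"
  assumes f: "Ck_on (Suc 0) f S" and K: "cball x0 R \<subseteq> S" and "R' < R"
    and u: "\<And>s. u s \<in> cball x0 R'"
  shows "(superpose (cball x0 R) f has_derivative
    (\<lambda>h. \<Sum>b\<in>Basis. bcf_scale (bcf_inner h b) (superpose (cball x0 R) (\<lambda>x. frechet_derivative f (at x) b) u))) (at u)"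
    (is "(?N has_derivative ?N') _")
proof -
  let ?K = "cball x0 R"
  let ?f' = "\<lambda>b x. frechet_derivative f (at x) b"
  have "0 \<le> R'" using order_trans[OF zero_le_dist[of x0 "u undefined"]] u[of undefined] by simp
  then have "R > 0" using \<open>R' < R\<close> by simp
  then have ne: "?K \<noteq> {}" by auto
  have cf: "continuous_on ?K f" using Ck_on_continuous[OF f] K continuous_on_subset by blast
  have cf': "continuous_on ?K (?f' b)" for b using f K by (auto intro: continuous_on_subset)
  have uK: "u s \<in> ?K" for s using u[of s] \<open>R' < R\<close> by auto
  have N: "?N w s = f (w s)" if "w s \<in> ?K" for w :: "'c \<Rightarrow>\<^sub>C 'a" and s
    using superpose_apply[OF _ _ ne cf, of w s] that closest_point_self[of "w s" ?K] by simp
  have Nb: "superpose ?K (?f' b) u s = ?f' b (u s)" for b s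
    using superpose_apply[OF _ _ ne cf', of b u s] uK closest_point_self[of "u s" ?K] by simp
  have dif: "f differentiable (at x)" if "x \<in> ?K" for x using f K that by auto
  show ?thesis
    unfolding has_derivative_at_alt
  proof (intro conjI allI impI)
    show "bounded_linear ?N'"
      by (intro bounded_linear_sum bounded_linear_compose[OF bounded_bilinear.bounded_linear_left[OF bounded_bilinear_bcf_scale]]
          bounded_linear_bcf_inner)
    fix e :: real assume "e > 0"
    \<comment> \<open>\<open>G\<close> sums the oscillations of the partial derivatives and vanishes
      on the diagonal, so uniform continuity bounds it by \<open>e\<close> at all pairs in the ball
      closer than \<open>d\<close>.\<close>
    define G where "G = (\<lambda>(x, y). \<Sum>b\<in>Basis. norm (?f' b x - ?f' b y))"
    have "continuous_on (?K \<times> ?K) G"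
      unfolding split_beta G_def
      by (intro continuous_intros continuous_on_compose2[OF cf' continuous_on_fst[OF continuous_on_id]]
          continuous_on_compose2[OF cf' continuous_on_snd[OF continuous_on_id]]) auto
    then have "uniformly_continuous_on (?K \<times> ?K) G"
      by (rule compact_uniformly_continuous) (auto intro: compact_Times)
    then obtain d where d: "d > 0" "\<And>z z'. z \<in> ?K \<times> ?K \<Longrightarrow> z' \<in> ?K \<times> ?K \<Longrightarrow> dist z' z < d \<Longrightarrow> dist (G z') (G z) < e"
      using \<open>e > 0\<close> by (rule uniformly_continuous_onE) blast
    have G: "G (x, y) < e" if "x \<in> ?K" "y \<in> ?K" "dist x y < d" for x y
      using d(2)[of "(y, y)" "(x, y)"] that by (simp add: dist_Pair_Pair sum_nonneg G_def)
    show "\<exists>d>0. \<forall>y. norm (y - u) < d \<longrightarrow> norm (?N y - ?N u - ?N' (y - u)) \<le> e * norm (y - u)"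
    proof (intro exI[of _ "min d (R - R')"] conjI allI impI)
      show "min d (R - R') > 0" using d \<open>R' < R\<close> by simp
      fix w :: "'c \<Rightarrow>\<^sub>C 'a" assume w: "norm (w - u) < min d (R - R')"
      show "norm (?N w - ?N u - ?N' (w - u)) \<le> e * norm (w - u)"
      proof (rule norm_bound)
        fix s
        have ws: "norm (w s - u s) \<le> norm (w - u)"
          using norm_bounded[of "w - u" s] by (simp add: minus_bcontfun.rep_eq)
        then have wK: "w s \<in> ?K"
          using w u[of s] dist_triangle[of x0 "w s" "u s"] by (auto simp: dist_norm norm_minus_commute)
        \<comment> \<open>A convex set that contains the segment from \<open>u s\<close> to
          \<open>w s\<close> and on which the derivative of \<open>f\<close> differs by at most
          \<open>e\<close> from the one at \<open>u s\<close>.\<close>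
        let ?C = "?K \<inter> ball (u s) d"
        have "norm (f (w s) - f (u s) - frechet_derivative f (at (u s)) (w s - u s)) \<le> norm (w s - u s) * e"
        proof (rule differentiable_bound_linearization[where S = ?C and f' = "\<lambda>x. frechet_derivative f (at x)"])
          fix t :: real assume t: "t \<in> {0..1}"
          have "convex ?C" by (intro convex_Int convex_cball convex_ball)
          moreover have "u s \<in> ?C" "w s \<in> ?C" using uK wK ws w d by (auto simp: dist_norm norm_minus_commute)
          ultimately have "(1 - t) *\<^sub>R u s + t *\<^sub>R w s \<in> ?C"
            by (rule convexD_alt) (use t in auto)
          then show "u s + t *\<^sub>R (w s - u s) \<in> ?C" by (simp add: algebra_simps)
        next
          fix x assume x: "x \<in> ?C"
          show "(f has_derivative frechet_derivative f (at x)) (at x within ?C)"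
            using dif x by (auto simp: frechet_derivative_works intro: has_derivative_at_withinI)
          show "onorm (frechet_derivative f (at x) - frechet_derivative f (at (u s))) \<le> e"
            unfolding fun_diff_def
          proof (rule onorm_le)
            fix v
            have "frechet_derivative f (at x) v - frechet_derivative f (at (u s)) v
              = (\<Sum>b\<in>Basis. (v \<bullet> b) *\<^sub>R (?f' b x - ?f' b (u s)))"
              using x by (subst (1 2) frechet_derivative_basis) (auto simp: dif dif[OF uK] sum_subtractf algebra_simps)
            then have "norm (frechet_derivative f (at x) v - frechet_derivative f (at (u s)) v) \<le> norm v * G (x, u s)"
              using norm_directional_le[of v] by (simp add: G_def)
            also have "\<dots> \<le> norm v * e"
              using G[of x "u s"] x uK by (intro mult_left_mono) (auto simp: dist_commute)
            finally show "norm (frechet_derivative f (at x) v - frechet_derivative f (at (u s)) v) \<le> e * norm v"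
              by (simp add: mult.commute)
          qed
        qed (use uK d in auto)
        also have "\<dots> \<le> norm (w - u) * e"
          using ws \<open>e > 0\<close> by (intro mult_right_mono) auto
        finally show "norm ((?N w - ?N u - ?N' (w - u)) s) \<le> e * norm (w - u)"
          using frechet_derivative_basis[OF dif[OF uK[of s]], of "w s - u s"] N[OF wK] N[of u s] uK[of s]
          by (simp add: minus_bcontfun.rep_eq apply_bcontfun_sum bcf_scale_apply bcf_inner_apply Nb mult.commute)
      qed
    qed
  qed
qed

text \<open>One order more is asked of \<open>f\<close> than is obtained, since continuity of the
  superposition operator is read off from its differentiability. In the step, the partial
  derivatives of \<open>f\<close> are superposed on the same \<open>u\<close>.\<close>

lemma superpose_Ck_on:
  fixes f :: "'a::euclidean_space \<Rightarrow> 'b::real_normed_vector" and u :: "'p::euclidean_space \<Rightarrow> 'c::topological_space \<Rightarrow>\<^sub>C 'a"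
  assumes "open P" and "Ck_on (Suc k) f S" and K: "cball x0 R \<subseteq> S" and "R' < R"
    and "Ck_on k u P" and u: "\<And>y s. y \<in> P \<Longrightarrow> u y s \<in> cball x0 R'"
  shows "Ck_on k (\<lambda>y. superpose (cball x0 R) f (u y)) P"
  using assms(2,5)
proof (induction k arbitrary: f)
  case 0
  have "isCont (superpose (cball x0 R) f) (u y)" if "y \<in> P" for y
    using superpose_has_derivative[OF 0(1) K \<open>R' < R\<close> u[OF that]] has_derivative_continuous by blast
  moreover have "isCont u y" if "y \<in> P" for y
    using 0(2) \<open>open P\<close> that by (simp add: continuous_on_eq_continuous_at)
  ultimately show ?case
    by (auto simp: continuous_on_eq_continuous_at[OF \<open>open P\<close>] intro: isCont_o2)
next
  case (Suc k)
  let ?f' = "\<lambda>y v. \<Sum>b\<in>Basis. bcf_scale (bcf_inner (frechet_derivative u (at y) v) b)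
     (superpose (cball x0 R) (\<lambda>x. frechet_derivative f (at x) b) (u y))"
  show ?case
  proof (rule Ck_on_SucI[where f' = ?f'])
    have f1: "Ck_on (Suc 0) f S"
      using Suc.prems(1) Ck_on_continuous by (metis Ck_on.simps)
    fix y assume y: "y \<in> P"
    show "((\<lambda>y. superpose (cball x0 R) f (u y)) has_derivative ?f' y) (at y)"
      by (rule has_derivative_compose[OF Ck_on_has_derivative[OF Suc.prems(2) y] superpose_has_derivative[OF f1 K \<open>R' < R\<close> u[OF y]]])
  next
    fix v
    show "Ck_on k (\<lambda>y. ?f' y v) P"
      using Suc.prems \<open>open P\<close> Ck_on_SucD[OF Suc.prems(2)]
      by (intro Ck_on_sum Ck_on_bilinear[OF _ bounded_bilinear_bcf_scale]
          Ck_on_linear_compose[OF _ bounded_linear_bcf_inner] Suc.IH) auto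
  qed (use \<open>open P\<close> in auto)
qed

text \<open>The shape in which the linearised integral equation meets
  \<open>linear_fixpoint_Ck_on\<close>: one bilinear term per basis vector, where \<open>g\<close>
  is a partial derivative of the vector field along the curve, scaled by time.\<close>

lemma bounded_bilinear_volterra_inner:
  "bounded_bilinear (\<lambda>(g :: real \<Rightarrow>\<^sub>C 'b::banach) w :: real \<Rightarrow>\<^sub>C 'a::real_inner. volterra (bcf_scale (bcf_inner w b) g))"
proof
  show "\<exists>K. \<forall>(g :: real \<Rightarrow>\<^sub>C 'b) (w :: real \<Rightarrow>\<^sub>C 'a). norm (volterra (bcf_scale (bcf_inner w b) g)) \<le> norm g * norm w * K"
  proof (intro exI[of _ "norm b"] allI)
    fix g :: "real \<Rightarrow>\<^sub>C 'b" and w :: "real \<Rightarrow>\<^sub>C 'a"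
    have "norm (bcf_scale (bcf_inner w b) g) \<le> norm g * norm w * norm b"
    proof (rule norm_bound)
      fix s
      have "\<bar>w s \<bullet> b\<bar> \<le> norm w * norm b"
        by (rule order_trans[OF Cauchy_Schwarz_ineq2 mult_right_mono[OF norm_bounded norm_ge_zero]])
      then have "\<bar>w s \<bullet> b\<bar> * norm (g s) \<le> (norm w * norm b) * norm g"
        by (intro mult_mono norm_bounded) auto
      then show "norm (bcf_scale (bcf_inner w b) g s) \<le> norm g * norm w * norm b"
        by (simp add: bcf_scale_apply bcf_inner_apply ac_simps)
    qed
    then show "norm (volterra (bcf_scale (bcf_inner w b) g)) \<le> norm g * norm w * norm b"
      using norm_volterra order_trans by blast
  qed
qed (simp_all add: bounded_bilinear.add_right[OF bounded_bilinear_bcf_scale] bounded_bilinear.add_left[OF bounded_bilinear_bcf_scale]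
    bounded_bilinear.scaleR_right[OF bounded_bilinear_bcf_scale] bounded_bilinear.scaleR_left[OF bounded_bilinear_bcf_scale]
    linear_add[OF bounded_linear.linear[OF bounded_linear_volterra]] linear_scale[OF bounded_linear.linear[OF bounded_linear_volterra]]
    linear_add[OF bounded_linear.linear[OF bounded_linear_bcf_inner]] linear_scale[OF bounded_linear.linear[OF bounded_linear_bcf_inner]])

section \<open>Local flows of smooth vector fields\<close>

instance bcontfun :: (metric_space, banach) banach ..

lemma directional_derivative_bound:
  fixes X :: "'a::euclidean_space \<Rightarrow> 'b::real_normed_vector"
  assumes "Ck_on (Suc 0) X S" "compact K" "K \<subseteq> S"
  obtains l where "l > 0" "\<And>x v. x \<in> K \<Longrightarrow> norm (frechet_derivative X (at x) v) \<le> l * norm v"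
proof -
  let ?g = "\<lambda>x. \<Sum>b\<in>Basis. norm (frechet_derivative X (at x) b)"
  have "continuous_on S (\<lambda>x. frechet_derivative X (at x) b)" for b
    using assms(1) by simp
  then have "continuous_on K ?g"
    using assms(3) by (intro continuous_intros) (blast intro: continuous_on_subset)
  then have "bounded (?g ` K)"
    using assms(2) compact_continuous_image compact_imp_bounded by blast
  then obtain l where l: "l > 0" "\<And>x. x \<in> K \<Longrightarrow> \<bar>?g x\<bar> \<le> l"
    unfolding bounded_pos by auto
  have "norm (frechet_derivative X (at x) v) \<le> l * norm v" if "x \<in> K" for x v
  proof -
    have "X differentiable (at x)" using assms that by auto
    then have "norm (frechet_derivative X (at x) v) \<le> norm v * ?g x"
      by (subst frechet_derivative_basis) (auto intro: norm_directional_le)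
    also have "\<dots> \<le> norm v * l" using l(2)[OF that] by (intro mult_left_mono) auto
    finally show ?thesis by (simp add: mult.commute)
  qed
  with l(1) show ?thesis using that by blast
qed

text \<open>The Picard equation is a fixed-point equation on curves whose parameter is the pair
  \<open>(t, x)\<close>, so joint smoothness in time and initial value is smooth dependence of a
  fixed point on its parameter. The differential equation is recovered afterwards, by exhibiting the
  solution of the linearised equation for the direction \<open>(1, 0)\<close>.\<close>

lemma local_flow:
  fixes X :: "'a::euclidean_space \<Rightarrow> 'a"
  assumes S: "open S" "x0 \<in> S" and X: "\<And>k. Ck_on k X S"
  obtains \<rho> :: real and \<theta> :: "real \<times> 'a \<Rightarrow> 'a" where
    "\<rho> > 0" "\<And>k. Ck_on k \<theta> ({-\<rho><..<\<rho>} \<times> ball x0 \<rho>)"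
    "\<And>x. x \<in> ball x0 \<rho> \<Longrightarrow> \<theta> (0, x) = x"
    "\<And>t x. \<bar>t\<bar> < \<rho> \<Longrightarrow> x \<in> ball x0 \<rho> \<Longrightarrow> \<theta> (t, x) \<in> S"
    "\<And>t x. \<bar>t\<bar> < \<rho> \<Longrightarrow> x \<in> ball x0 \<rho> \<Longrightarrow> frechet_derivative \<theta> (at (t, x)) (1, 0) = X (\<theta> (t, x))"
proof -
  obtain R0 where R0: "R0 > 0" "cball x0 R0 \<subseteq> S"
    using S open_contains_cball by blast
  \<comment> \<open>Three nested balls: initial values within \<open>R\<close>, trajectories within
    \<open>3 / 2 * R\<close>, superposition on the closed ball of radius \<open>2 * R\<close> inside
    \<open>S\<close>. The last gap is what \<open>superpose_has_derivative\<close> asks for.\<close>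
  define R where "R = R0 / 2"
  have R: "R > 0" and KS: "cball x0 (2 * R) \<subseteq> S" using R0 by (auto simp: R_def)
  define K where "K = cball x0 (2 * R)"
  have K: "compact K" "convex K" "K \<noteq> {}" "K \<subseteq> S" "closed K"
    using R KS by (auto simp: K_def)
  have contX: "continuous_on K X" using X[of 0] K continuous_on_subset by auto
  have difX: "X differentiable (at x)" if "x \<in> K" for x using X[of "Suc 0"] K that by auto
  have contX': "continuous_on K (\<lambda>x. frechet_derivative X (at x) v)" for v
    using X[of "Suc 0"] by (auto intro: continuous_on_subset[OF _ K(4)])
  obtain l where l: "l > 0" "\<And>x v. x \<in> K \<Longrightarrow> norm (frechet_derivative X (at x) v) \<le> l * norm v"
    using directional_derivative_bound[OF X K(1,4)] by blast
  have "bounded (X ` K)" using contX K compact_continuous_image compact_imp_bounded by blast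
  then obtain B where B: "B > 0" "\<And>x. x \<in> K \<Longrightarrow> norm (X x) \<le> B"
    unfolding bounded_pos by auto
  have lip: "norm (X x - X y) \<le> l * norm (x - y)" if "x \<in> K" "y \<in> K" for x y
  proof (rule differentiable_bound[OF K(2), where f' = "\<lambda>x. frechet_derivative X (at x)"])
    show "(X has_derivative frechet_derivative X (at x)) (at x within K)" if "x \<in> K" for x
      using difX[OF that] by (simp add: frechet_derivative_works has_derivative_at_withinI)
    show "onorm (frechet_derivative X (at x)) \<le> l" if "x \<in> K" for x
      using l(2)[OF that] by (intro onorm_le) auto
  qed (use that in auto)
  \<comment> \<open>The first bound keeps trajectories within \<open>R / 2\<close> of their initial
    values, since \<open>X\<close> has norm at most \<open>B\<close>; the second makes the Picard
    map contract by \<open>1/2\<close>, since \<open>l\<close> is a Lipschitz constant of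
    \<open>X\<close>.\<close>
  define \<tau> where "\<tau> = min (R / (2 * B)) (1 / (2 * l))"
  have \<tau>: "\<tau> > 0" "\<tau> * B \<le> R / 2" "\<tau> * l \<le> 1 / 2"
  proof -
    have "\<tau> \<le> R / (2 * B)" "\<tau> \<le> 1 / (2 * l)"
      by (auto simp: \<tau>_def)
    then show "\<tau> * B \<le> R / 2" "\<tau> * l \<le> 1 / 2"
      using B(1) l(1) by (auto simp: field_simps)
  qed (use R B l in \<open>auto simp: \<tau>_def\<close>)
  define P where "P = {-\<tau><..<\<tau>} \<times> ball x0 R"
  have "open P" by (auto simp: P_def intro!: open_Times)
  let ?N = "superpose K X :: (real \<Rightarrow>\<^sub>C 'a) \<Rightarrow> _"
  let ?N' = "\<lambda>b. superpose K (\<lambda>x. frechet_derivative X (at x) b) :: (real \<Rightarrow>\<^sub>C 'a) \<Rightarrow> _"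
  have N: "?N w s = X (closest_point K (w s))" for w s
    using superpose_apply[OF K(1,2,3) contX] .
  have N': "?N' b w s = frechet_derivative X (at (closest_point K (w s))) b" for b w s
    using superpose_apply[OF K(1,2,3) contX'] .
  have cpK: "closest_point K x \<in> K" for x using closest_point_in_set[OF K(5,3)] .
  have N_lip: "norm (?N w - ?N w') \<le> l * norm (w - w')" for w w'
  proof (rule norm_bound)
    fix s
    have "norm (X (closest_point K (w s)) - X (closest_point K (w' s))) \<le> l * norm (closest_point K (w s) - closest_point K (w' s))"
      by (intro lip cpK)
    also have "\<dots> \<le> l * norm (w s - w' s)"
      using closest_point_lipschitz[OF K(2,5,3), of "w s" "w' s"] l(1) by (simp add: dist_norm)
    also have "\<dots> \<le> l * norm (w - w')"
      using norm_bounded[of "w - w'" s] l(1) by (simp add: minus_bcontfun.rep_eq)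
    finally show "norm ((?N w - ?N w') s) \<le> l * norm (w - w')"
      by (simp add: minus_bcontfun.rep_eq N)
  qed
  have volt_diff: "volterra (v - w) = volterra v - volterra w" for v w :: "real \<Rightarrow>\<^sub>C 'a"
    using bounded_linear_volterra by (rule linear_diff[OF bounded_linear.linear])
  have smallt: "norm (t *\<^sub>R volterra z) \<le> d / 2" if "\<bar>t\<bar> < \<tau>" "norm z \<le> l * d" for t d and z :: "real \<Rightarrow>\<^sub>C 'a"
  proof -
    have "d \<ge> 0" using that(2) l(1) norm_ge_zero[of z] by (smt (verit) mult_pos_neg)
    have "norm (t *\<^sub>R volterra z) \<le> \<tau> * (l * d)"
      using that norm_volterra[of z] \<tau>(1) by (auto intro!: mult_mono)
    also have "\<dots> \<le> d / 2"
      using mult_right_mono[OF \<tau>(3) \<open>d \<ge> 0\<close>] by (simp add: mult.assoc)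
    finally show ?thesis .
  qed
  \<comment> \<open>Time is rescaled to \<open>[0, 1]\<close>: the fixed point for \<open>y = (t, x)\<close> is \<open>s \<mapsto> \<theta>(t s, x)\<close>.\<close>
  define T where "T y w = const_bcontfun (snd y) + fst y *\<^sub>R volterra (?N w)" for y and w :: "real \<Rightarrow>\<^sub>C 'a"
  have T_contr: "norm (T y w - T y w') \<le> norm (w - w') / 2" if "y \<in> P" for y w w'
  proof -
    have "T y w - T y w' = fst y *\<^sub>R volterra (?N w - ?N w')"
      by (simp add: T_def volt_diff algebra_simps)
    then show ?thesis
      using smallt[of "fst y" "?N w - ?N w'" "norm (w - w')"] N_lip that by (auto simp: P_def)
  qed
  have "\<exists>w. w = T y w" if "y \<in> P" for y
  proof -
    have "\<exists>!w. T y w = w"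
      by (rule banach_fix_type[of "1/2"]) (use T_contr[OF that] in \<open>auto simp: dist_norm\<close>)
    then show ?thesis by metis
  qed
  then have "\<exists>u. \<forall>y\<in>P. u y = T y (u y)" by (intro bchoice ballI)
  then obtain u where u: "\<And>y. y \<in> P \<Longrightarrow> u y = T y (u y)" by blast
  have u_apply0: "u y s = snd y + fst y *\<^sub>R volterra (?N (u y)) s" if "y \<in> P" for y s
    by (subst u[OF that]) (simp add: T_def plus_bcontfun.rep_eq scaleR_bcontfun.rep_eq const_bcontfun.rep_eq)
  define R' where "R' = 3 / 2 * R"
  have R': "R' < 2 * R" using R by (simp add: R'_def)
  have uR: "u y s \<in> cball x0 R'" if "y \<in> P" for y s
  proof -
    have "norm (volterra (?N (u y)) s) \<le> B"
      using norm_bounded[of "volterra (?N (u y))" s] norm_volterra[of "?N (u y)"]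
        norm_bound[of "?N (u y)" B] B(2)[OF cpK] by (force simp: N)
    then have "norm (fst y *\<^sub>R volterra (?N (u y)) s) \<le> \<tau> * B"
      using that \<tau> B by (auto simp: P_def intro!: mult_mono)
    then have "norm (u y s - snd y) \<le> R / 2"
      using \<tau>(2) u_apply0[OF that, of s] by simp
    then show ?thesis
      using that norm_triangle_ineq[of "snd y - x0" "u y s - snd y"]
      by (auto simp: P_def R'_def dist_norm norm_minus_commute)
  qed
  have uK: "u y s \<in> K" if "y \<in> P" for y s using uR[OF that, of s] R' by (auto simp: K_def)
  have cpu: "closest_point K (u y s) = u y s" if "y \<in> P" for y s
    using uK[OF that] by (rule closest_point_self)
  \<comment> \<open>\<open>G y\<close> is multiplication by the derivative of \<open>X\<close> along
    the curve \<open>u y\<close>, and \<open>A y\<close> is the derivative of the Picard map in its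
    curve argument.\<close>
  define G where "G y w = (\<Sum>b\<in>Basis. bcf_scale (bcf_inner w b) (?N' b (u y)))" for y and w :: "real \<Rightarrow>\<^sub>C 'a"
  define A where "A y w = fst y *\<^sub>R volterra (G y w)" for y and w :: "real \<Rightarrow>\<^sub>C 'a"
  have G_apply: "G y w s = frechet_derivative X (at (u y s)) (w s)" if "y \<in> P" for y w s
    using frechet_derivative_basis[OF difX[OF uK[OF that, of s]], of "w s"]
    by (simp add: G_def apply_bcontfun_sum bcf_scale_apply bcf_inner_apply N' cpu[OF that])
  have A_contr: "norm (A y w) \<le> norm w / 2" if "y \<in> P" for y w
    unfolding A_def
  proof (rule smallt)
    show "norm (G y w) \<le> l * norm w"
    proof (rule norm_bound)
      fix s
      have "norm (G y w s) \<le> l * norm (w s)"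
        unfolding G_apply[OF that] by (rule l(2)[OF uK[OF that]])
      also have "\<dots> \<le> l * norm w" using l(1) norm_bounded[of w s] by simp
      finally show "norm (G y w s) \<le> l * norm w" .
    qed
  qed (use that in \<open>auto simp: P_def\<close>)
  have A_sum: "A y w = (\<Sum>b\<in>Basis. volterra (bcf_scale (bcf_inner w b) (fst y *\<^sub>R ?N' b (u y))))" for y w
    unfolding A_def G_def
    by (simp add: linear_sum[OF bounded_linear.linear[OF bounded_linear_volterra]] scaleR_sum_right
        bounded_bilinear.scaleR_right[OF bounded_bilinear_bcf_scale]
        linear_scale[OF bounded_linear.linear[OF bounded_linear_volterra]])
  have "\<exists>w. (u has_derivative w) (at y) \<and>
      (\<forall>h. w h = const_bcontfun (snd h) + fst h *\<^sub>R volterra (?N (u y)) + A y (w h))" if y: "y \<in> P" for y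
  proof -
    let ?T' = "\<lambda>z. const_bcontfun (snd (fst z)) + fst (fst z) *\<^sub>R volterra (?N (u y)) + A y (snd z)"
    have dN: "((\<lambda>w. volterra (?N w)) has_derivative (\<lambda>w. volterra (G y w))) (at (u y))"
      using superpose_has_derivative[OF X _ R' uR[OF y]] K(4)
      unfolding K_def[symmetric] G_def
      by (intro bounded_linear.has_derivative[OF bounded_linear_volterra]) auto
    have "((\<lambda>z. T (fst z) (snd z)) has_derivative
        (\<lambda>h. const_bcontfun (snd (fst h)) + (fst (fst (y, u y)) *\<^sub>R volterra (G y (snd h)) + fst (fst h) *\<^sub>R volterra (?N (snd (y, u y)))))) (at (y, u y))"
      unfolding T_def
    proof (intro has_derivative_add has_derivative_scaleR)
      show "((\<lambda>x. const_bcontfun (snd (fst x))) has_derivative (\<lambda>x. const_bcontfun (snd (fst x)))) (at (y, u y))"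
        by (intro bounded_linear.has_derivative[OF bounded_linear_const_bcontfun] has_derivative_snd has_derivative_fst has_derivative_ident)
      show "((\<lambda>x. fst (fst x)) has_derivative (\<lambda>x. fst (fst x))) (at (y, u y))"
        by (intro has_derivative_fst has_derivative_ident)
      show "((\<lambda>z. volterra (?N (snd z))) has_derivative (\<lambda>h. volterra (G y (snd h)))) (at (y, u y))"
        by (rule has_derivative_compose[OF has_derivative_snd[OF has_derivative_ident]]) (simp add: dN)
    qed
    then have dT: "((\<lambda>z. T (fst z) (snd z)) has_derivative ?T') (at (y, u y))"
      by (rule has_derivative_eq_rhs) (auto simp: A_def)
    obtain d where d: "d > 0" "ball y d \<subseteq> P" using \<open>open P\<close> y open_contains_ball by blast
    then have dP: "z \<in> P" if "norm (z - y) < d" for z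
      using that by (auto simp: dist_norm norm_minus_commute)
    have "\<exists>w. (u has_derivative w) (at y) \<and> (\<forall>v. w v = ?T' (v, w v))"
    proof (rule fixpoint_has_derivative[where T = T and T' = ?T' and u = u and ?y0.0 = y, OF dT _ d(1)])
      show "norm (?T' (0, w)) \<le> norm w / 2" for w
        using A_contr[OF y, of w] by simp
      show "norm (T z (u z) - T z (u y)) \<le> norm (u z - u y) / 2" if "norm (z - y) < d" for z
        by (rule T_contr[OF dP[OF that]])
    qed (rule u[OF dP])
    then show ?thesis by simp
  qed
  then have "\<exists>w. \<forall>y\<in>P. (u has_derivative w y) (at y) \<and>
      (\<forall>h. w y h = const_bcontfun (snd h) + fst h *\<^sub>R volterra (?N (u y)) + A y (w y h))"
    by (intro bchoice ballI)
  then obtain w where w: "\<And>y. y \<in> P \<Longrightarrow> (u has_derivative w y) (at y)"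
    "\<And>y h. y \<in> P \<Longrightarrow> w y h = const_bcontfun (snd h) + fst h *\<^sub>R volterra (?N (u y)) + A y (w y h)" by blast
  \<comment> \<open>The derivative of \<open>u\<close> solves a linear equation whose coefficients
    are superpositions along \<open>u\<close>, hence of the class already known for
    \<open>u\<close>; each round gains one order.\<close>
  have uCk: "Ck_on k u P" for k
  proof (induction k)
    case 0
    show ?case
      unfolding Ck_on.simps
      by (intro continuous_at_imp_continuous_on ballI has_derivative_continuous[OF w(1)])
  next
    case (Suc k)
    have fstC: "Ck_on k (\<lambda>y. fst y) P"
      using Ck_on_bounded_linear[OF \<open>open P\<close> bounded_linear_fst] .
    have sup: "Ck_on k (\<lambda>y. superpose K f (u y)) P" if "\<And>k. Ck_on k f S" for f :: "'a \<Rightarrow> 'a"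
      unfolding K_def by (rule superpose_Ck_on[OF \<open>open P\<close> that KS R' Suc uR])
    have X'Ck: "Ck_on k (\<lambda>x. frechet_derivative X (at x) b) S" for k b
      using X[of "Suc k"] by simp
    show ?case
    proof (rule Ck_on_SucI[OF \<open>open P\<close> w(1)])
      fix h
      show "Ck_on k (\<lambda>y. w y h) P"
      proof (rule linear_fixpoint_Ck_on[where I = Basis and a = "\<lambda>b y. fst y *\<^sub>R ?N' b (u y)"
            and b = "\<lambda>y. const_bcontfun (snd h) + fst h *\<^sub>R volterra (?N (u y))"
            and B = "\<lambda>b g w. volterra (bcf_scale (bcf_inner w b) g)"])
        show "Ck_on k (\<lambda>y. const_bcontfun (snd h) + fst h *\<^sub>R volterra (?N (u y))) P"
          by (intro Ck_on_add Ck_on_const \<open>open P\<close> Ck_on_linear_compose[OF \<open>open P\<close> bounded_linear_scaleR_right]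
              Ck_on_linear_compose[OF \<open>open P\<close> bounded_linear_volterra] sup X)
        show "Ck_on k (\<lambda>y. fst y *\<^sub>R ?N' b (u y)) P" for b
          by (intro Ck_on_bilinear[OF \<open>open P\<close> bounded_bilinear_scaleR] fstC sup X'Ck)
        show "w y h = const_bcontfun (snd h) + fst h *\<^sub>R volterra (?N (u y)) +
          (\<Sum>b\<in>Basis. volterra (bcf_scale (bcf_inner (w y h) b) (fst y *\<^sub>R ?N' b (u y))))" if "y \<in> P" for y
          unfolding A_sum[symmetric] by (rule w(2)[OF that])
        show "norm (\<Sum>b\<in>Basis. volterra (bcf_scale (bcf_inner v b) (fst y *\<^sub>R ?N' b (u y)))) \<le> norm v / 2"
          if "y \<in> P" for y v
          unfolding A_sum[symmetric] by (rule A_contr[OF that])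
      qed (rule \<open>open P\<close> bounded_bilinear_volterra_inner)+
    qed
  qed
  define \<theta> where "\<theta> y = u y 1" for y
  have d\<theta>: "frechet_derivative \<theta> (at y) h = w y h 1" if "y \<in> P" for y h
  proof -
    have "(\<theta> has_derivative (\<lambda>h. w y h 1)) (at y)"
      unfolding \<theta>_def by (rule bounded_linear.has_derivative[OF bounded_linear_apply_bcontfun w(1)[OF that]])
    then show ?thesis by (metis frechet_derivative_at)
  qed
  have u_apply: "u y s = snd y + fst y *\<^sub>R integral {0..unit_clamp s} (\<lambda>s. X (u y s))" if "y \<in> P" for y s
    using u_apply0[OF that, of s] by (simp add: volterra_apply N[abs_def] cpu[OF that])
  have time: "w y (1, 0) 1 = X (u y 1)" if y: "y \<in> P" for y
  proof -
    define cl where "cl = Bcontfun unit_clamp"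
    have "unit_clamp \<in> bcontfun"
      by (rule bcontfun_normI[where b = 1]) (use unit_clamp(1) continuous_unit_clamp in auto)
    then have cl: "cl s = unit_clamp s" for s by (simp add: cl_def Bcontfun_inverse)
    \<comment> \<open>\<open>s X(u(s))\<close> solves the linear equation that characterises the derivative in \<open>t\<close>.\<close>
    define z where "z = bcf_scale cl (?N (u y))"
    have z_apply: "z s = unit_clamp s *\<^sub>R X (u y s)" for s
      by (simp add: z_def bcf_scale_apply cl N cpu[OF y])
    have "z = volterra (?N (u y)) + A y z"
    proof (rule bcontfun_eqI)
      fix s
      let ?c = "unit_clamp s" and ?t = "fst y"
      have c: "?c \<in> {0..1}" by (rule unit_clamp(1))
      have Xu: "continuous_on A (\<lambda>r. X (u y r))" for A
      proof -
        have "continuous_on A (?N (u y))" by simp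
        then show ?thesis by (simp add: N[abs_def] cpu[OF y])
      qed
      have ueq: "u y r = snd y + ?t *\<^sub>R integral {0..r} (\<lambda>s. X (u y s))" if "r \<in> {0..1}" for r
        using u_apply[OF y, of r] unfolding unit_clamp(2)[OF that] .
      have ucl: "u y ?c = u y s"
        using u_apply[OF y, of s] ueq[OF c] by (rule trans[OF _ sym, rotated])
      have du: "(u y has_vector_derivative ?t *\<^sub>R X (u y r)) (at r within {0..?c})" if r: "r \<in> {0..?c}" for r
      proof -
        have "((\<lambda>s. integral {0..s} (\<lambda>s. X (u y s))) has_vector_derivative X (u y r)) (at r within {0..?c})"
          by (rule integral_has_vector_derivative[OF Xu r])
        then have "((\<lambda>s. snd y + ?t *\<^sub>R integral {0..s} (\<lambda>s. X (u y s))) has_vector_derivative 0 + ?t *\<^sub>R X (u y r)) (at r within {0..?c})"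
          by (intro has_vector_derivative_add has_vector_derivative_const
              bounded_linear.has_vector_derivative[OF bounded_linear_scaleR_right])
        then show ?thesis
          using has_vector_derivative_transform[OF r, of "u y"] ueq c by simp
      qed
      have dXu: "((\<lambda>r. X (u y r)) has_vector_derivative frechet_derivative X (at (u y r)) (?t *\<^sub>R X (u y r))) (at r within {0..?c})"
        if r: "r \<in> {0..?c}" for r
        using vector_derivative_diff_chain_within[OF du[OF r], of X "frechet_derivative X (at (u y r))"] difX[OF uK[OF y]]
        by (auto simp: frechet_derivative_works o_def has_derivative_at_withinI)
      \<comment> \<open>Integrating the product rule for \<open>r\<close> times
        \<open>X (u y r)\<close> from 0 to \<open>?c\<close> yields the linear equation at
        \<open>s\<close>; the boundary term at 0 vanishes.\<close>
      have "((\<lambda>r. r *\<^sub>R X (u y r)) has_vector_derivative ?N (u y) r + ?t *\<^sub>R G y z r) (at r within {0..?c})"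
        if r: "r \<in> {0..?c}" for r
      proof -
        have lin: "linear (frechet_derivative X (at (u y r)))"
          using difX[OF uK[OF y]] linear_frechet_derivative by blast
        have "((\<lambda>r. r *\<^sub>R X (u y r)) has_vector_derivative
          r *\<^sub>R frechet_derivative X (at (u y r)) (?t *\<^sub>R X (u y r)) + 1 *\<^sub>R X (u y r)) (at r within {0..?c})"
          by (intro has_vector_derivative_scaleR dXu r DERIV_ident)
        then show ?thesis
          using r c by (simp add: G_apply[OF y] z_apply N cpu[OF y] unit_clamp(2) linear_scale[OF lin] algebra_simps)
      qed
      then have "((\<lambda>r. ?N (u y) r + ?t *\<^sub>R G y z r) has_integral (?c *\<^sub>R X (u y ?c) - 0 *\<^sub>R X (u y 0))) {0..?c}"
        using c by (intro fundamental_theorem_of_calculus) auto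
      then have "?c *\<^sub>R X (u y ?c) = integral {0..?c} (\<lambda>r. ?N (u y) r + ?t *\<^sub>R G y z r)"
        by (simp add: integral_unique)
      also have "\<dots> = integral {0..?c} (?N (u y)) + ?t *\<^sub>R integral {0..?c} (G y z)"
        by (subst integral_add) (auto intro!: integrable_continuous_real continuous_intros)
      finally show "z s = (volterra (?N (u y)) + A y z) s"
        using c by (simp add: z_apply plus_bcontfun.rep_eq A_def scaleR_bcontfun.rep_eq volterra_apply ucl)
    qed
    moreover have w10: "w y (1, 0) = volterra (?N (u y)) + A y (w y (1, 0))"
      by (subst w(2)[OF y]) simp
    \<comment> \<open>Two solutions of the same equation differ by a fixed vector of
      \<open>A y\<close>, which contracts by \<open>1/2\<close>; so they agree.\<close>
    ultimately have "z - w y (1, 0) = A y z - A y (w y (1, 0))"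
      by (metis add_diff_cancel_left)
    also have "\<dots> = A y (z - w y (1, 0))"
      unfolding A_sum by (simp add: sum_subtractf[symmetric] bounded_bilinear.diff_right[OF bounded_bilinear_volterra_inner])
    finally have "norm (z - w y (1, 0)) \<le> norm (z - w y (1, 0)) / 2"
      using A_contr[OF y] by metis
    then have "z = w y (1, 0)" by simp
    then show ?thesis using z_apply[of 1] by (simp add: unit_clamp_def)
  qed
  define \<rho> where "\<rho> = min \<tau> R"
  have \<rho>: "\<rho> > 0" "(t, x) \<in> P" if "\<bar>t\<bar> < \<rho>" "x \<in> ball x0 \<rho>" for t x
    using \<tau> R that by (auto simp: \<rho>_def P_def)
  show thesis
  proof (rule that[of \<rho> \<theta>])
    show "\<rho> > 0" using \<tau> R by (simp add: \<rho>_def)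
    have "Ck_on k \<theta> P" for k
      unfolding \<theta>_def by (rule Ck_on_linear_compose[OF \<open>open P\<close> bounded_linear_apply_bcontfun uCk])
    then show "Ck_on k \<theta> ({-\<rho><..<\<rho>} \<times> ball x0 \<rho>)" for k
      by (rule Ck_on_subset) (auto simp: P_def \<rho>_def)
    show "\<theta> (0, x) = x" if "x \<in> ball x0 \<rho>" for x
      using u_apply[OF \<rho>(2)[of 0 x]] that \<open>\<rho> > 0\<close> by (simp add: \<theta>_def)
    show "\<theta> (t, x) \<in> S" if "\<bar>t\<bar> < \<rho>" "x \<in> ball x0 \<rho>" for t x
      unfolding \<theta>_def using uK[OF \<rho>(2)[OF that]] K(4) by blast
    show "frechet_derivative \<theta> (at (t, x)) (1, 0) = X (\<theta> (t, x))" if "\<bar>t\<bar> < \<rho>" "x \<in> ball x0 \<rho>" for t x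
      using d\<theta>[OF \<rho>(2)[OF that]] time[OF \<rho>(2)[OF that]] by (simp add: \<theta>_def)
  qed
qed

section \<open>Smooth functions on subspaces and flow boxes\<close>

text \<open>Self-adjointness singles out the orthogonal projection among the linear retractions onto
  \<open>E\<close>. It extends functions from \<open>E\<close> to the whole space, constantly along
  the orthogonal complement, and it can be moved across inner products.\<close>

definition orth_proj :: "'e::euclidean_space set \<Rightarrow> 'e \<Rightarrow> 'e" where
  "orth_proj E = (SOME p. linear p \<and> (\<forall>x. p x \<in> E) \<and> (\<forall>x\<in>E. p x = x) \<and> (\<forall>x y. p x \<bullet> y = x \<bullet> p y))"

lemma orth_proj:
  assumes "subspace E"
  shows linear_orth_proj: "linear (orth_proj E)"
    and orth_proj_in: "orth_proj E x \<in> E"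
    and orth_proj_id: "x \<in> E \<Longrightarrow> orth_proj E x = x"
    and orth_proj_adjoint: "orth_proj E x \<bullet> y = x \<bullet> orth_proj E y"
proof -
  obtain B where B: "B \<subseteq> E" "pairwise orthogonal B" "\<And>x. x \<in> B \<Longrightarrow> norm x = 1"
    "independent B" "card B = dim E" "span B = E"
    using orthonormal_basis_subspace[OF assms] by metis
  have fin: "finite B" using B(4) independent_imp_finite by blast
  define p where "p x = (\<Sum>b\<in>B. (x \<bullet> b) *\<^sub>R b)" for x
  have lin: "linear p"
    unfolding p_def by (intro linearI) (auto simp: algebra_simps sum.distrib scaleR_sum_right)
  have "p x \<in> E" for x
    unfolding p_def using B(1) by (intro subspace_sum[OF assms] subspace_scale[OF assms]) auto
  moreover have "p x = x" if "x \<in> E" for x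
  proof (rule linear_eq_on_span[OF lin, of "\<lambda>x. x" B])
    fix b assume b: "b \<in> B"
    have "(b \<bullet> c) *\<^sub>R c = (if c = b then c else 0)" if "c \<in> B" for c
      using B(2,3) that b by (auto simp: pairwise_def orthogonal_def norm_eq_1)
    then show "p b = b" using b fin by (simp add: p_def)
  qed (use B that in \<open>auto intro: linear_ident\<close>)
  moreover have "p x \<bullet> y = x \<bullet> p y" for x y
    by (simp add: p_def inner_sum_left inner_sum_right ac_simps inner_commute)
  ultimately have "\<exists>p. linear p \<and> (\<forall>x. p x \<in> E) \<and> (\<forall>x\<in>E. p x = x) \<and> (\<forall>x y. p x \<bullet> y = x \<bullet> p y)"
    using lin by blast
  from someI_ex[OF this] show "linear (orth_proj E)" "orth_proj E x \<in> E" "x \<in> E \<Longrightarrow> orth_proj E x = x"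
    "orth_proj E x \<bullet> y = x \<bullet> orth_proj E y"
    unfolding orth_proj_def[symmetric] by blast+
qed

lemma bounded_linear_orth_proj: "subspace E \<Longrightarrow> bounded_linear (orth_proj E)"
  using linear_orth_proj linear_conv_bounded_linear by blast

lemma orth_proj_idem: "subspace E \<Longrightarrow> orth_proj E (orth_proj E x) = orth_proj E x"
  using orth_proj_id orth_proj_in by blast

lemma norm_orth_proj_le: assumes "subspace E" shows "norm (orth_proj E x) \<le> norm x"
proof -
  have "(norm (orth_proj E x))\<^sup>2 = x \<bullet> orth_proj E x"
    using orth_proj_adjoint[OF assms, of x "orth_proj E x"] orth_proj_idem[OF assms]
    by (simp add: power2_norm_eq_inner)
  also have "\<dots> \<le> norm x * norm (orth_proj E x)" by (rule norm_cauchy_schwarz)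
  finally show ?thesis
    by (cases "norm (orth_proj E x) = 0") (auto simp: power2_eq_square)
qed

lemma open_vimage_orth_proj:
  assumes "subspace E" "openin (top_of_set E) S"
  shows "open (orth_proj E -` S)"
proof -
  obtain T where T: "open T" "S = E \<inter> T" using assms(2) by (auto simp: openin_open)
  have "orth_proj E -` S = orth_proj E -` T" using T orth_proj_in[OF assms(1)] by auto
  then show ?thesis
    using T(1) bounded_linear_orth_proj[OF assms(1)] by (simp add: linear_continuous_on open_vimage)
qed

lemma vimage_orth_proj_superset:
  assumes "subspace E" "openin (top_of_set E) S"
  shows "S \<subseteq> orth_proj E -` S"
  using openin_imp_subset[OF assms(2)] orth_proj_id[OF assms(1)] by auto

section \<open>Calculus of smooth maps on subsets of Euclidean space\<close>

lemma smooth_on_set_CkI: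
  "open W \<Longrightarrow> S \<subseteq> W \<Longrightarrow> (\<And>k. Ck_on k f W) \<Longrightarrow> smooth_on_set S f"
  unfolding smooth_on_set_def by blast

lemma smooth_on_setE:
  assumes "smooth_on_set S f" "x \<in> S"
  obtains W g where "open W" "x \<in> W" "\<And>k. Ck_on k g W" "\<forall>y\<in>W \<inter> S. g y = f y"
  using assms(1)[unfolded smooth_on_set_def, rule_format, OF assms(2)] by (elim exE conjE) (rule that, auto)

lemma smooth_on_set_subset:
  assumes f: "smooth_on_set S f" and "T \<subseteq> S"
  shows "smooth_on_set T f"
  unfolding smooth_on_set_def
proof
  fix x assume "x \<in> T"
  then have "x \<in> S" using \<open>T \<subseteq> S\<close> by blast
  with f obtain W g where "open W" "x \<in> W" "\<And>k. Ck_on k g W" "\<forall>y\<in>W \<inter> S. g y = f y"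
    by (rule smooth_on_setE) (rule that)
  then show "\<exists>W g. open W \<and> x \<in> W \<and> (\<forall>k. Ck_on k g W) \<and> (\<forall>y\<in>W \<inter> T. g y = f y)"
    using \<open>T \<subseteq> S\<close> by (intro exI[of _ W] exI[of _ g]) auto
qed

lemma smooth_on_set_cong:
  assumes "\<And>x. x \<in> S \<Longrightarrow> f x = g x"
  shows "smooth_on_set S f \<longleftrightarrow> smooth_on_set S g"
  using assms unfolding smooth_on_set_def by simp

lemma smooth_on_set_open:
  assumes "open S"
  shows "smooth_on_set S f \<longleftrightarrow> (\<forall>k. Ck_on k f S)"
proof
  assume f: "smooth_on_set S f"
  show "\<forall>k. Ck_on k f S"
  proof (intro allI Ck_on_local)
    fix k x assume "x \<in> S"
    then obtain W g where W: "open W" "x \<in> W" "\<And>k. Ck_on k g W" "\<forall>y\<in>W \<inter> S. g y = f y"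
      using smooth_on_setE[OF f] by blast
    have "Ck_on k f (W \<inter> S)"
      by (rule Ck_on_cong[of _ g]) (use W assms in \<open>auto intro: Ck_on_subset\<close>)
    then show "\<exists>W. open W \<and> x \<in> W \<and> Ck_on k f W" using W \<open>x \<in> S\<close> assms by blast
  qed
qed (intro smooth_on_set_CkI[OF assms order_refl], blast)

lemma smooth_on_set_linear: "bounded_linear L \<Longrightarrow> smooth_on_set S L"
  by (rule smooth_on_set_CkI[of UNIV]) (auto intro: Ck_on_bounded_linear)

lemma smooth_on_set_const: "smooth_on_set S (\<lambda>x. c)"
  by (rule smooth_on_set_CkI[of UNIV]) (auto intro: Ck_on_const)

lemma smooth_on_set_compose:
  fixes f :: "'f::euclidean_space \<Rightarrow> 'g::real_normed_vector"
  assumes f: "smooth_on_set T f" and g: "smooth_on_set S g" and "g ` S \<subseteq> T"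
  shows "smooth_on_set S (\<lambda>x. f (g x))"
  unfolding smooth_on_set_def
proof
  fix x assume x: "x \<in> S"
  obtain W g' where W: "open W" "x \<in> W" "\<And>k. Ck_on k g' W" "\<forall>y\<in>W \<inter> S. g' y = g y"
    using g x by (rule smooth_on_setE) (rule that)
  have "g x \<in> T" using x assms(3) by blast
  then obtain V f' where V: "open V" "g x \<in> V" "\<And>k. Ck_on k f' V" "\<forall>y\<in>V \<inter> T. f' y = f y"
    using smooth_on_setE[OF f] by blast
  have o: "open (W \<inter> g' -` V)"
    using W(1) V(1) Ck_on_continuous[OF W(3)[of 0]] by (simp add: continuous_open_preimage)
  have "Ck_on k (\<lambda>x. f' (g' x)) (W \<inter> g' -` V)" for k
    by (rule Ck_on_compose[OF o V(1) V(3)]) (use W in \<open>auto intro: Ck_on_subset\<close>)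
  then show "\<exists>W h. open W \<and> x \<in> W \<and> (\<forall>k. Ck_on k h W) \<and> (\<forall>y\<in>W \<inter> S. h y = f (g y))"
    using W V x o assms(3) by (intro exI[of _ "W \<inter> g' -` V"] exI[of _ "\<lambda>x. f' (g' x)"]) auto
qed

lemma smooth_on_set_bilinear:
  assumes B: "bounded_bilinear B" and f: "smooth_on_set S f" and g: "smooth_on_set S g"
  shows "smooth_on_set S (\<lambda>x. B (f x) (g x))"
  unfolding smooth_on_set_def
proof
  fix x assume x: "x \<in> S"
  obtain W f' where W: "open W" "x \<in> W" "\<And>k. Ck_on k f' W" "\<forall>y\<in>W \<inter> S. f' y = f y"
    using f x by (rule smooth_on_setE) (rule that)
  obtain V g' where V: "open V" "x \<in> V" "\<And>k. Ck_on k g' V" "\<forall>y\<in>V \<inter> S. g' y = g y"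
    using g x by (rule smooth_on_setE) (rule that)
  have "Ck_on k (\<lambda>x. B (f' x) (g' x)) (W \<inter> V)" for k
    by (rule Ck_on_bilinear[OF _ B]) (use W V in \<open>auto intro: Ck_on_subset\<close>)
  then show "\<exists>W h. open W \<and> x \<in> W \<and> (\<forall>k. Ck_on k h W) \<and> (\<forall>y\<in>W \<inter> S. h y = B (f y) (g y))"
    using W V by (intro exI[of _ "W \<inter> V"] exI[of _ "\<lambda>x. B (f' x) (g' x)"]) auto
qed

lemma smooth_on_set_add:
  assumes f: "smooth_on_set S f" and g: "smooth_on_set S g"
  shows "smooth_on_set S (\<lambda>x. f x + g x)"
  unfolding smooth_on_set_def
proof
  fix x assume x: "x \<in> S"
  obtain W f' where W: "open W" "x \<in> W" "\<And>k. Ck_on k f' W" "\<forall>y\<in>W \<inter> S. f' y = f y"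
    using f x by (rule smooth_on_setE) (rule that)
  obtain V g' where V: "open V" "x \<in> V" "\<And>k. Ck_on k g' V" "\<forall>y\<in>V \<inter> S. g' y = g y"
    using g x by (rule smooth_on_setE) (rule that)
  have "Ck_on k (\<lambda>x. f' x + g' x) (W \<inter> V)" for k
    by (rule Ck_on_add) (use W V in \<open>auto intro: Ck_on_subset\<close>)
  then show "\<exists>W h. open W \<and> x \<in> W \<and> (\<forall>k. Ck_on k h W) \<and> (\<forall>y\<in>W \<inter> S. h y = f y + g y)"
    using W V by (intro exI[of _ "W \<inter> V"] exI[of _ "\<lambda>x. f' x + g' x"]) auto
qed

lemma smooth_on_set_sum:
  "(\<And>i. i \<in> I \<Longrightarrow> smooth_on_set S (f i)) \<Longrightarrow> smooth_on_set S (\<lambda>x. \<Sum>i\<in>I. f i x)"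
  by (induction I rule: infinite_finite_induct) (simp_all add: smooth_on_set_const smooth_on_set_add)

lemma smooth_on_set_linear_compose:
  assumes L: "bounded_linear L" and f: "smooth_on_set S f"
  shows "smooth_on_set S (\<lambda>x. L (f x))"
  unfolding smooth_on_set_def
proof
  fix x assume "x \<in> S"
  then obtain W g where W: "open W" "x \<in> W" "\<And>k. Ck_on k g W" "\<forall>y\<in>W \<inter> S. g y = f y"
    using smooth_on_setE[OF f] by blast
  then show "\<exists>W h. open W \<and> x \<in> W \<and> (\<forall>k. Ck_on k h W) \<and> (\<forall>y\<in>W \<inter> S. h y = L (f y))"
    using Ck_on_linear_compose[OF W(1) L W(3)] by (intro exI[of _ W] exI[of _ "\<lambda>x. L (g x)"]) auto
qed

text \<open>On a relatively open subset of \<open>E\<close> the various local extensions can be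
  replaced by one canonical extension, namely \<open>f\<close> composed with the projection.\<close>

lemma smooth_on_set_orth_proj:
  assumes "subspace E" "openin (top_of_set E) S"
  shows "smooth_on_set S f \<longleftrightarrow> (\<forall>k. Ck_on k (\<lambda>x. f (orth_proj E x)) (orth_proj E -` S))"
proof
  assume "smooth_on_set S f"
  then have "smooth_on_set (orth_proj E -` S) (\<lambda>x. f (orth_proj E x))"
    by (rule smooth_on_set_compose) (auto intro: smooth_on_set_linear bounded_linear_orth_proj assms)
  then show "\<forall>k. Ck_on k (\<lambda>x. f (orth_proj E x)) (orth_proj E -` S)"
    by (simp add: smooth_on_set_open open_vimage_orth_proj assms)
next
  assume "\<forall>k. Ck_on k (\<lambda>x. f (orth_proj E x)) (orth_proj E -` S)"
  then have "smooth_on_set S (\<lambda>x. f (orth_proj E x))"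
    by (intro smooth_on_set_CkI[OF open_vimage_orth_proj[OF assms] vimage_orth_proj_superset[OF assms]]) auto
  moreover have "f (orth_proj E x) = f x" if "x \<in> S" for x
    using that openin_imp_subset[OF assms(2)] by (auto simp: orth_proj_id[OF assms(1)])
  ultimately show "smooth_on_set S f" by (simp cong: smooth_on_set_cong)
qed

text \<open>Composing with the projection gives a derivative to functions that are only relevant on a
  relatively open subset of the linear subspace \<open>E\<close>.\<close>

definition dirder :: "'e::euclidean_space set \<Rightarrow> ('e \<Rightarrow> 'f::real_normed_vector) \<Rightarrow> 'e \<Rightarrow> 'e \<Rightarrow> 'f" where
  "dirder E f x w = frechet_derivative (\<lambda>y. f (orth_proj E y)) (at x) w"

lemma dirder_eqI: "((\<lambda>y. f (orth_proj E y)) has_derivative f') (at x) \<Longrightarrow> dirder E f x w = f' w"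
  unfolding dirder_def using frechet_derivative_at by metis

context
  fixes E S :: "'e::euclidean_space set"
  assumes E: "subspace E" and S: "openin (top_of_set E) S"
begin

lemma has_derivative_dirder:
  assumes "smooth_on_set S f" "x \<in> S"
  shows "((\<lambda>y. f (orth_proj E y)) has_derivative dirder E f x) (at x)"
proof -
  have "Ck_on (Suc 0) (\<lambda>x. f (orth_proj E x)) (orth_proj E -` S)"
    using assms(1) smooth_on_set_orth_proj[OF E S] by blast
  from Ck_on_has_derivative[OF this] show ?thesis
    using assms(2) vimage_orth_proj_superset[OF E S] unfolding dirder_def by blast
qed

lemma linear_dirder: "smooth_on_set S f \<Longrightarrow> x \<in> S \<Longrightarrow> linear (dirder E f x)"
  using has_derivative_dirder has_derivative_linear by blast

lemma smooth_on_set_dirder: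
  assumes "smooth_on_set S f"
  shows "smooth_on_set S (\<lambda>x. dirder E f x w)"
proof (rule smooth_on_set_CkI[OF open_vimage_orth_proj[OF E S] vimage_orth_proj_superset[OF E S]])
  fix k
  have "Ck_on (Suc k) (\<lambda>x. f (orth_proj E x)) (orth_proj E -` S)"
    using assms smooth_on_set_orth_proj[OF E S] by blast
  then show "Ck_on k (\<lambda>x. dirder E f x w) (orth_proj E -` S)"
    by (simp add: dirder_def)
qed

text \<open>The direction varies with the point, hence the expansion over
  \<open>Basis\<close>.\<close>

lemma smooth_on_set_dirder_apply:
  assumes f: "smooth_on_set S f" and g: "smooth_on_set S g"
  shows "smooth_on_set S (\<lambda>x. dirder E f x (g x))"
proof -
  have "dirder E f x (g x) = (\<Sum>b\<in>Basis. (g x \<bullet> b) *\<^sub>R dirder E f x b)" if "x \<in> S" for x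
    using frechet_derivative_basis[of "\<lambda>y. f (orth_proj E y)" x "g x"] has_derivative_dirder[OF f that]
    unfolding dirder_def by (auto simp: differentiable_def)
  moreover have "smooth_on_set S (\<lambda>x. \<Sum>b\<in>Basis. (g x \<bullet> b) *\<^sub>R dirder E f x b)"
    by (intro smooth_on_set_sum smooth_on_set_bilinear[OF bounded_bilinear_scaleR]
        smooth_on_set_dirder f smooth_on_set_linear_compose[OF bounded_linear_inner_left g])
  ultimately show ?thesis by (simp cong: smooth_on_set_cong)
qed

lemma dirder_cong:
  assumes "\<And>y. y \<in> S \<Longrightarrow> f y = g y" "smooth_on_set S f" "x \<in> S"
  shows "dirder E f x w = dirder E g x w"
proof -
  have "((\<lambda>y. g (orth_proj E y)) has_derivative dirder E f x) (at x)"
    by (rule has_derivative_transform_within_open[OF has_derivative_dirder[OF assms(2,3)] open_vimage_orth_proj[OF E S]])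
      (use assms vimage_orth_proj_superset[OF E S] in auto)
  then show ?thesis by (simp add: dirder_eqI)
qed

lemma dirder_compose:
  assumes f: "smooth_on_set T f" and E': "subspace E'" and T: "openin (top_of_set E') T"
    and g: "smooth_on_set S g" and gST: "\<And>x. x \<in> S \<Longrightarrow> g x \<in> T" and x: "x \<in> S"
  shows "dirder E (\<lambda>x. f (g x)) x w = dirder E' f (g x) (dirder E g x w)"
proof (rule dirder_eqI[where f' = "\<lambda>w. dirder E' f (g x) (dirder E g x w)"])
  have f': "((\<lambda>y. f (orth_proj E' y)) has_derivative dirder E' f (g x)) (at (g x))"
  proof -
    have "Ck_on (Suc 0) (\<lambda>x. f (orth_proj E' x)) (orth_proj E' -` T)"
      using f smooth_on_set_orth_proj[OF E' T] by blast
    from Ck_on_has_derivative[OF this] show ?thesis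
      using gST[OF x] vimage_orth_proj_superset[OF E' T] unfolding dirder_def by blast
  qed
  have px: "orth_proj E x = x" using x openin_imp_subset[OF S] orth_proj_id[OF E] by auto
  \<comment> \<open>The projection onto \<open>E'\<close> is inserted so that the chain rule
    concerns functions on open sets; near \<open>x\<close> it changes nothing, because
    \<open>g\<close> maps \<open>S\<close> into \<open>T\<close>, which lies in
    \<open>E'\<close>.\<close>
  have "((\<lambda>y. f (orth_proj E' (g (orth_proj E y)))) has_derivative (\<lambda>w. dirder E' f (g x) (dirder E g x w))) (at x)"
    using f' by (intro has_derivative_compose[OF has_derivative_dirder[OF g x]]) (simp add: px)
  then show "((\<lambda>y. f (g (orth_proj E y))) has_derivative (\<lambda>w. dirder E' f (g x) (dirder E g x w))) (at x)"
    by (rule has_derivative_transform_within_open[OF _ open_vimage_orth_proj[OF E S]])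
      (use x px gST openin_imp_subset[OF T] in \<open>auto simp: orth_proj_id[OF E'] subset_iff\<close>)
qed

lemma dirder_linear:
  assumes "bounded_linear L" "w \<in> E"
  shows "dirder E L x w = L w"
proof -
  have "((\<lambda>y. L (orth_proj E y)) has_derivative (\<lambda>w. L (orth_proj E w))) (at x)"
    by (intro bounded_linear_imp_has_derivative bounded_linear_compose[OF assms(1)] bounded_linear_orth_proj E)
  from dirder_eqI[OF this] show ?thesis using assms(2) by (simp add: orth_proj_id[OF E])
qed

lemma dirder_bilinear:
  assumes B: "bounded_bilinear B" and f: "smooth_on_set S f" and g: "smooth_on_set S g" and x: "x \<in> S"
  shows "dirder E (\<lambda>x. B (f x) (g x)) x w = B (f x) (dirder E g x w) + B (dirder E f x w) (g x)"
proof -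
  have "orth_proj E x = x" using x openin_imp_subset[OF S] orth_proj_id[OF E] by auto
  then show ?thesis
    using bounded_bilinear.FDERIV[OF B has_derivative_dirder[OF f x] has_derivative_dirder[OF g x]]
    by (intro dirder_eqI[where f' = "\<lambda>w. B (f x) (dirder E g x w) + B (dirder E f x w) (g x)"]) simp
qed

lemma dirder_linear_compose:
  assumes L: "bounded_linear L" and f: "smooth_on_set S f" and x: "x \<in> S"
  shows "dirder E (\<lambda>x. L (f x)) x w = L (dirder E f x w)"
  by (rule dirder_eqI[where f' = "\<lambda>w. L (dirder E f x w)"])
    (rule bounded_linear.has_derivative[OF L has_derivative_dirder[OF f x]])

lemma dirder_add:
  assumes f: "smooth_on_set S f" and g: "smooth_on_set S g" and x: "x \<in> S"
  shows "dirder E (\<lambda>x. f x + g x) x w = dirder E f x w + dirder E g x w"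
  by (rule dirder_eqI[where f' = "\<lambda>w. dirder E f x w + dirder E g x w"])
    (intro has_derivative_add has_derivative_dirder f g x)

end

section \<open>Smooth local inverses and flow boxes\<close>

text \<open>Near a point where the derivative is the identity, \<open>f' (g y) (g' y v) = v\<close>
  rearranges to the contractive equation \<open>g' y v = v + (g' y v - f' (g y) (g' y v))\<close>.
  Its coefficients have the class already known for \<open>g\<close>, so the bootstrap raises the
  class of the inverse one order at a time.\<close>

lemma smooth_inverse:
  fixes f :: "'e::euclidean_space \<Rightarrow> 'e"
  assumes U: "open U" "x0 \<in> U" and f: "\<And>k. Ck_on k f U"
    and id: "\<And>v. frechet_derivative f (at x0) v = v"
  obtains U' V g where "open U'" "U' \<subseteq> U" "x0 \<in> U'" "open V" "f x0 \<in> V" "homeomorphism U' V f g"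
    "\<And>k. Ck_on k g V"
proof -
  let ?h = "\<lambda>x. \<Sum>b\<in>Basis. norm (b - frechet_derivative f (at x) b)"
  have "continuous_on U (\<lambda>x. frechet_derivative f (at x) b)" for b
    using f[of "Suc 0"] by simp
  then have ch: "continuous_on U ?h" by (intro continuous_intros)
  \<comment> \<open>Here the deviations of the derivative from the identity on the basis vectors sum
    to less than \<open>1/2\<close>, which by \<open>norm_directional_le\<close> is the contraction
    constant for \<open>linear_fixpoint_Ck_on\<close>.\<close>
  define U1 where "U1 = U \<inter> ?h -` {..<1/2}"
  have U1: "open U1" "x0 \<in> U1" "U1 \<subseteq> U"
    using U id continuous_open_preimage[OF ch U(1), of "{..<1/2}"] by (auto simp: U1_def)
  let ?f' = "\<lambda>x. Blinfun (frechet_derivative f (at x))"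
  have df: "(f has_derivative frechet_derivative f (at x)) (at x)" if "x \<in> U1" for x
    using Ck_on_has_derivative[OF f] that U1 by blast
  have f'_apply: "blinfun_apply (?f' x) = frechet_derivative f (at x)" if "x \<in> U1" for x
    using has_derivative_bounded_linear[OF df[OF that]] by (rule bounded_linear_Blinfun_apply)
  have df': "(f has_derivative blinfun_apply (?f' x)) (at x)" if "x \<in> U1" for x
    using df[OF that] f'_apply[OF that] by simp
  have "continuous_on U1 (\<lambda>x. blinfun_apply (?f' x) b)" for b
  proof -
    have "continuous_on U1 (\<lambda>x. frechet_derivative f (at x) b)"
      using f[of "Suc 0"] U1 by (auto intro: continuous_on_subset)
    then show ?thesis by (simp add: f'_apply cong: continuous_on_cong)
  qed
  then have cf': "continuous_on U1 ?f'" by (rule continuous_on_blinfun_componentwise)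
  have inv: "id_blinfun o\<^sub>L ?f' x0 = id_blinfun"
    by (rule blinfun_eqI) (simp add: f'_apply[OF U1(2)] id)
  obtain U' V g g' where g: "open U'" "U' \<subseteq> U1" "x0 \<in> U'" "open V" "f x0 \<in> V" "homeomorphism U' V f g"
    "\<And>y. y \<in> V \<Longrightarrow> (g has_derivative (g' y)) (at y)"
    "\<And>y. y \<in> V \<Longrightarrow> g' y = inv (blinfun_apply (?f' (g y)))"
    "\<And>y. y \<in> V \<Longrightarrow> bij (blinfun_apply (?f' (g y)))"
    by (rule inverse_function_theorem[OF U1(1) df' cf' U1(2) inv]) (assumption, rule that)
  have gV: "g y \<in> U1" if "y \<in> V" for y
    using g(2,6) that by (auto simp: homeomorphism_def)
  have gCk: "Ck_on k g V" for k
  proof (induction k)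
    case 0
    then show ?case using g(6) by (simp add: homeomorphism_def)
  next
    case (Suc k)
    show ?case
    proof (rule Ck_on_SucI[OF g(4,7)])
      fix v
      show "Ck_on k (\<lambda>y. g' y v) V"
      proof (rule linear_fixpoint_Ck_on[OF g(4), where I = Basis and b = "\<lambda>y. v"
            and a = "\<lambda>b y. b - frechet_derivative f (at (g y)) b" and B = "\<lambda>b c w. (w \<bullet> b) *\<^sub>R c"])
        show "bounded_bilinear (\<lambda>c w. (w \<bullet> b) *\<^sub>R c)" for b :: 'e
          using bounded_bilinear.flip[OF bounded_bilinear.comp1[OF bounded_bilinear_scaleR bounded_linear_inner_left[of b]]] .
        show "Ck_on k (\<lambda>y. b - frechet_derivative f (at (g y)) b) V" for b
        proof -
          have "Ck_on k (\<lambda>x. frechet_derivative f (at x) b) U"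
            using f[of "Suc k"] by simp
          then have "Ck_on k (\<lambda>y. frechet_derivative f (at (g y)) b) V"
            by (rule Ck_on_compose[OF g(4) U(1) _ Suc]) (use gV U1 in auto)
          then have "Ck_on k (\<lambda>y. b + (-1) *\<^sub>R frechet_derivative f (at (g y)) b) V"
            by (intro Ck_on_add Ck_on_const Ck_on_linear_compose[OF _ bounded_linear_scaleR_right] g(4))
          then show ?thesis by simp
        qed
        show "g' y v = v + (\<Sum>b\<in>Basis. (g' y v \<bullet> b) *\<^sub>R (b - frechet_derivative f (at (g y)) b))" if "y \<in> V" for y
        proof -
          have "surj (frechet_derivative f (at (g y)))"
            using g(9)[OF that] f'_apply[OF gV[OF that]] by (simp add: bij_def)
          then have "frechet_derivative f (at (g y)) (g' y v) = v"
            using g(8)[OF that] f'_apply[OF gV[OF that]] by (simp add: surj_f_inv_f)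
          moreover have "frechet_derivative f (at (g y)) (g' y v) = (\<Sum>b\<in>Basis. (g' y v \<bullet> b) *\<^sub>R frechet_derivative f (at (g y)) b)"
            using df[OF gV[OF that]] by (intro frechet_derivative_basis) (auto simp: differentiable_def)
          ultimately show ?thesis
            by (simp add: scaleR_diff_right sum_subtractf euclidean_representation)
        qed
        show "norm (\<Sum>b\<in>Basis. (w \<bullet> b) *\<^sub>R (b - frechet_derivative f (at (g y)) b)) \<le> norm w / 2" if "y \<in> V" for y w
        proof -
          have "norm (\<Sum>b\<in>Basis. (w \<bullet> b) *\<^sub>R (b - frechet_derivative f (at (g y)) b)) \<le> norm w * ?h (g y)"
            by (rule norm_directional_le)
          also have "\<dots> \<le> norm w * (1/2)"
            using gV[OF that] by (intro mult_left_mono) (auto simp: U1_def)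
          finally show ?thesis by simp
        qed
      qed (rule Ck_on_const[OF g(4)])
    qed
  qed
  show thesis
    using that[OF g(1) _ g(3,4,5,6) gCk] g(2) U1(3) by blast
qed

text \<open>On \<open>S\<close> the field \<open>Y\<close> takes values in \<open>H\<close>, and it
  depends on the \<open>H\<close>-component only, so its flow can be combined with the identity on
  the orthogonal complement of \<open>H\<close>. The resulting map carries the constant field
  \<open>e\<close> to \<open>Y\<close> and constant fields orthogonal to \<open>H\<close> to
  themselves: directions straightened earlier survive. \<open>\<Phi> z - z \<in> H\<close> ensures
  that subspaces containing \<open>H\<close> are preserved.\<close>

lemma flow_box:
  fixes Y :: "'e::euclidean_space \<Rightarrow> 'e"
  assumes H: "subspace H" and S: "open S" "0 \<in> S" and Y: "\<And>k. Ck_on k Y S"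
    and YH: "\<And>x. x \<in> S \<Longrightarrow> Y x \<in> H" and Y_proj: "\<And>x. Y (orth_proj H x) = Y x"
    and Y0: "Y 0 = e" "norm e = 1"
  obtains U V \<Phi> \<Psi> where "open U" "0 \<in> U" "open V" "0 \<in> V" "homeomorphism U V \<Phi> \<Psi>" "\<Phi> 0 = 0"
    "\<And>k. Ck_on k \<Phi> U" "\<And>k. Ck_on k \<Psi> V"
    "\<And>z. \<Phi> z - z \<in> H"
    "\<And>z. z \<in> U \<Longrightarrow> frechet_derivative \<Phi> (at z) e = Y (\<Phi> z)"
    "\<And>z f. z \<in> U \<Longrightarrow> orth_proj H f = 0 \<Longrightarrow> frechet_derivative \<Phi> (at z) f = f"
proof -
  let ?P = "orth_proj H"
  have eH: "e \<in> H" using YH[OF S(2)] Y0 by simp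
  then have Pe: "?P e = e" by (rule orth_proj_id[OF H])
  have ee: "e \<bullet> e = 1" using Y0(2) by (simp add: norm_eq_1)
  obtain \<rho> :: real and \<theta> where \<rho>: "\<rho> > 0" and \<theta>: "\<And>k. Ck_on k \<theta> ({-\<rho><..<\<rho>} \<times> ball 0 \<rho>)"
    "\<And>x. x \<in> ball 0 \<rho> \<Longrightarrow> \<theta> (0, x) = x"
    "\<And>t x. \<bar>t\<bar> < \<rho> \<Longrightarrow> x \<in> ball 0 \<rho> \<Longrightarrow> \<theta> (t, x) \<in> S"
    "\<And>t x. \<bar>t\<bar> < \<rho> \<Longrightarrow> x \<in> ball 0 \<rho> \<Longrightarrow> frechet_derivative \<theta> (at (t, x)) (1, 0) = Y (\<theta> (t, x))"
    using local_flow[OF S Y] by metis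
  \<comment> \<open>Splits the \<open>H\<close>-component of \<open>z\<close> into the flow time
    along \<open>e\<close> and a starting point in the hyperplane of \<open>H\<close> orthogonal to
    \<open>e\<close>.\<close>
  define c where "c z = (z \<bullet> e, ?P z - (z \<bullet> e) *\<^sub>R e)" for z
  have blc: "bounded_linear c"
    unfolding c_def by (intro bounded_linear_Pair bounded_linear_sub bounded_linear_inner_left
        bounded_linear_orth_proj H bounded_linear_compose[OF bounded_linear_scaleR_left])
  define Q where "Q = {-\<rho><..<\<rho>} \<times> ball (0::'e) \<rho>"
  have oQ: "open Q" by (auto simp: Q_def intro: open_Times)
  define U0 where "U0 = c -` Q"
  have oU0: "open U0"
    unfolding U0_def using oQ blc by (intro open_vimage) (auto simp: linear_continuous_on)
  have U0_0: "0 \<in> U0" using \<rho> by (simp add: U0_def Q_def linear_0[OF bounded_linear.linear[OF blc]] zero_prod_def)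
  \<comment> \<open>Flows the \<open>H\<close>-component and leaves the complementary one fixed. The
    projection after \<open>\<theta>\<close> is there because \<open>local_flow\<close> gives values
    in \<open>S\<close> and says nothing about staying in \<open>H\<close>.\<close>
  define \<Phi> where "\<Phi> z = (z - ?P z) + ?P (\<theta> (c z))" for z
  have \<theta>Q: "Ck_on k \<theta> Q" for k using \<theta>(1) by (simp add: Q_def)
  have \<Phi>Ck: "Ck_on k \<Phi> U0" for k
    unfolding \<Phi>_def
    by (intro Ck_on_add oU0 Ck_on_bounded_linear bounded_linear_sub bounded_linear_ident
        Ck_on_linear_compose[OF oU0 bounded_linear_orth_proj[OF H]] bounded_linear_orth_proj H
        Ck_on_compose[OF oU0 oQ \<theta>Q] blc) (auto simp: U0_def)
  have d\<Phi>: "frechet_derivative \<Phi> (at z) v = v - ?P v + ?P (frechet_derivative \<theta> (at (c z)) (c v))"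
    if "z \<in> U0" for z v
  proof -
    have "(\<theta> has_derivative frechet_derivative \<theta> (at (c z))) (at (c z))"
      using Ck_on_has_derivative[OF \<theta>Q] that by (auto simp: U0_def)
    then have "((\<lambda>z. \<theta> (c z)) has_derivative (\<lambda>v. frechet_derivative \<theta> (at (c z)) (c v))) (at z)"
      by (rule has_derivative_compose[OF bounded_linear_imp_has_derivative[OF blc]])
    then have "(\<Phi> has_derivative (\<lambda>v. v - ?P v + ?P (frechet_derivative \<theta> (at (c z)) (c v)))) (at z)"
      unfolding \<Phi>_def
      by (intro has_derivative_add has_derivative_diff has_derivative_ident
          bounded_linear.has_derivative[OF bounded_linear_orth_proj[OF H]])
    from frechet_derivative_at[OF this] show ?thesis by metis
  qed
  have P\<Phi>: "?P (\<Phi> z) = ?P (\<theta> (c z))" for z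
    using linear_orth_proj[OF H] by (simp add: \<Phi>_def linear_add linear_diff orth_proj_idem[OF H])
  have Y\<Phi>: "Y (\<Phi> z) = Y (\<theta> (c z))" for z using Y_proj P\<Phi> by metis
  have cQ: "c z = (fst (c z), snd (c z))" "\<bar>fst (c z)\<bar> < \<rho>" "snd (c z) \<in> ball 0 \<rho>" if "z \<in> U0" for z
    using that by (auto simp: U0_def Q_def)
  have c_e: "c e = (1, 0)" by (simp add: c_def ee Pe)
  have de: "frechet_derivative \<Phi> (at z) e = Y (\<Phi> z)" if "z \<in> U0" for z
  proof -
    have "frechet_derivative \<Phi> (at z) e = ?P (Y (\<theta> (c z)))"
      using d\<Phi>[OF that, of e] \<theta>(4)[OF cQ(2,3)[OF that]] by (simp add: c_e Pe)
    moreover have "Y (\<theta> (c z)) \<in> H"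
      using YH \<theta>(3)[OF cQ(2,3)[OF that]] by simp
    ultimately show ?thesis using Y\<Phi> orth_proj_id[OF H] by simp
  qed
  have lin\<theta>: "linear (frechet_derivative \<theta> (at (c z)))" if "z \<in> U0" for z
    using \<theta>Q[of "Suc 0"] that by (intro linear_frechet_derivative) (auto simp: U0_def)
  have df: "frechet_derivative \<Phi> (at z) f = f" if "z \<in> U0" "?P f = 0" for z f
  proof -
    have "f \<bullet> e = 0" using orth_proj_adjoint[OF H, of f e] that(2) Pe by simp
    then have "c f = 0" using that(2) by (simp add: c_def zero_prod_def)
    then show ?thesis
      using d\<Phi>[OF that(1), of f] that(2) linear_0[OF lin\<theta>[OF that(1)]] linear_0[OF linear_orth_proj[OF H]] by simp
  qed
  have c0: "c 0 = (0, 0)" using linear_0[OF bounded_linear.linear[OF blc]] by (simp add: zero_prod_def)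
  have \<Phi>0: "\<Phi> 0 = 0"
    using \<theta>(2)[of 0] \<rho> linear_0[OF linear_orth_proj[OF H]] by (simp add: \<Phi>_def c0)
  have dx: "frechet_derivative \<theta> (at (0, 0)) (0, v) = v" for v
  proof -
    have "(\<theta> has_derivative frechet_derivative \<theta> (at (0, 0))) (at (0, 0))"
      using Ck_on_has_derivative[OF \<theta>Q, of "(0, 0)"] \<rho> by (simp add: Q_def)
    then have "((\<lambda>x. \<theta> (0, x)) has_derivative (\<lambda>v. frechet_derivative \<theta> (at (0, 0)) (0, v))) (at 0)"
      by (intro has_derivative_compose[OF has_derivative_Pair[OF has_derivative_const has_derivative_ident]])
    moreover have "((\<lambda>x. \<theta> (0, x)) has_derivative (\<lambda>v. v)) (at 0)"
      by (rule has_derivative_transform_within_open[OF has_derivative_ident, of "ball 0 \<rho>"]) (use \<rho> \<theta>(2) in auto)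
    ultimately show ?thesis using has_derivative_unique by metis
  qed
  \<comment> \<open>At 0 the time derivative is \<open>Y 0 = e\<close> and the derivative in the
    starting point is the identity, so the two parts of \<open>c v\<close> add up to the
    \<open>H\<close>-component of \<open>v\<close>.\<close>
  have id: "frechet_derivative \<Phi> (at 0) v = v" for v
  proof -
    let ?t = "v \<bullet> e" and ?D = "frechet_derivative \<theta> (at (0, 0))"
    have lin: "linear ?D" using lin\<theta>[OF U0_0] by (simp add: c0)
    have "c v = ?t *\<^sub>R (1, 0) + (0, ?P v - ?t *\<^sub>R e)" by (simp add: c_def)
    then have "?D (c v) = ?t *\<^sub>R ?D (1, 0) + ?D (0, ?P v - ?t *\<^sub>R e)"
      using linear_add[OF lin] linear_scale[OF lin] by metis
    also have "?D (1, 0) = e"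
      using \<theta>(4)[of 0 0] \<theta>(2)[of 0] \<rho> Y0(1) by simp
    finally have "?D (c v) = ?P v" by (simp add: dx)
    then show ?thesis using d\<Phi>[OF U0_0, of v] orth_proj_idem[OF H] by (simp add: c0)
  qed
  obtain U V \<Psi> where UV: "open U" "U \<subseteq> U0" "0 \<in> U" "open V" "\<Phi> 0 \<in> V" "homeomorphism U V \<Phi> \<Psi>"
    "\<And>k. Ck_on k \<Psi> V"
    using smooth_inverse[OF oU0 U0_0 \<Phi>Ck id] by blast
  show thesis
  proof (rule that[of U V \<Phi> \<Psi>])
    show "Ck_on k \<Phi> U" for k using \<Phi>Ck UV(2) by (rule Ck_on_subset)
    show "\<Phi> z - z \<in> H" for z
    proof -
      have "\<Phi> z - z = ?P (\<theta> (c z) - z)"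
        using linear_diff[OF linear_orth_proj[OF H]] by (simp add: \<Phi>_def)
      then show ?thesis using orth_proj_in[OF H] by simp
    qed
    show "frechet_derivative \<Phi> (at z) e = Y (\<Phi> z)" if "z \<in> U" for z
      using de UV(2) that by blast
    show "frechet_derivative \<Phi> (at z) f = f" if "z \<in> U" "?P f = 0" for z f
      using df UV(2) that by blast
    show "0 \<in> V" using UV(5) \<Phi>0 by simp
  qed (fact UV \<Phi>0)+
qed

section \<open>Charts, tangent vectors and covectors in coordinates\<close>

text \<open>\<open>G b\<close> is the integral of the partial derivative of \<open>F\<close> in
  direction \<open>b\<close> along the segment from \<open>x0\<close> to \<open>x\<close>.
  Differentiation under the integral sign is replaced by superposition along the segment, followed
  by a bounded linear functional on curves.\<close>

lemma hadamard_lemma: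
  fixes F :: "'e::euclidean_space \<Rightarrow> real"
  assumes W: "open W" "x0 \<in> W" and F: "\<And>k. Ck_on k F W"
  obtains r G where "r > 0" "ball x0 r \<subseteq> W" "\<And>b k. Ck_on k (G b) (ball x0 r)"
    "\<And>x. x \<in> ball x0 r \<Longrightarrow> F x = F x0 + (\<Sum>b\<in>Basis. ((x - x0) \<bullet> b) * G b x)"
    "\<And>b. G b x0 = frechet_derivative F (at x0) b"
proof -
  obtain R where R: "R > 0" "cball x0 R \<subseteq> W"
    using W open_contains_cball by blast
  let ?K = "cball x0 R"
  define r where "r = R / 2"
  have r: "r > 0" "r < R" "ball x0 r \<subseteq> W" using R by (auto simp: r_def)
  define cl where "cl = Bcontfun unit_clamp"
  have "unit_clamp \<in> bcontfun"
    by (rule bcontfun_normI[where b = 1]) (use unit_clamp(1) continuous_unit_clamp in auto)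
  then have cl: "cl s = unit_clamp s" for s by (simp add: cl_def Bcontfun_inverse)
  define L where "L v = bcf_scale cl (const_bcontfun v)" for v :: 'e
  have blL: "bounded_linear L"
    unfolding L_def
    by (rule bounded_linear_compose[OF bounded_bilinear.bounded_linear_right[OF bounded_bilinear_bcf_scale] bounded_linear_const_bcontfun])
  \<comment> \<open>The segment from \<open>x0\<close> to \<open>x\<close> as a bounded continuous
    curve, written as a constant plus \<open>L x\<close> to exhibit it as affine in
    \<open>x\<close>, hence smooth.\<close>
  define u where "u x = (const_bcontfun x0 + L (- x0)) + L x" for x
  have u: "u x s = x0 + unit_clamp s *\<^sub>R (x - x0)" for x s
    by (simp add: u_def plus_bcontfun.rep_eq const_bcontfun.rep_eq L_def bcf_scale_apply cl algebra_simps)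
  have uCk: "Ck_on k u (ball x0 r)" for k
    unfolding u_def by (intro Ck_on_add Ck_on_const Ck_on_bounded_linear blL) auto
  have ur: "u x s \<in> cball x0 r" if "x \<in> ball x0 r" for x s
  proof -
    have "norm (unit_clamp s *\<^sub>R (x - x0)) \<le> 1 * norm (x - x0)"
      using unit_clamp(1)[of s] by (auto intro: mult_left_le_one_le)
    then show ?thesis using that by (simp add: u dist_norm norm_minus_commute)
  qed
  have uK: "u x s \<in> ?K" if "x \<in> ball x0 r" for x s
    using ur[OF that, of s] r by auto
  let ?F' = "\<lambda>b x. frechet_derivative F (at x) b"
  have F'Ck: "Ck_on k (?F' b) W" for k b using F[of "Suc k"] by simp
  have cF': "continuous_on ?K (?F' b)" for b
    using Ck_on_continuous[OF F'Ck] R continuous_on_subset by blast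
  have sup: "superpose ?K (?F' b) (u x) s = ?F' b (u x s)" if "x \<in> ball x0 r" for b x s
    using superpose_apply[OF compact_cball convex_cball _ cF', where u = "u x" and s = s] R
      closest_point_self[OF uK[OF that, of s]] by auto
  have sup': "apply_bcontfun (superpose ?K (?F' b) (u x)) = (\<lambda>s. ?F' b (u x s))" if "x \<in> ball x0 r" for b x
    by (rule ext) (rule sup[OF that])
  define G where "G b x = volterra (superpose ?K (?F' b) (u x)) 1" for b x
  have G: "G b x = integral {0..1} (\<lambda>s. ?F' b (u x s))" if "x \<in> ball x0 r" for b x
    by (simp add: G_def volterra_apply unit_clamp_def sup'[OF that])
  have cont: "continuous_on A (\<lambda>s. ?F' b (u x s))" if "x \<in> ball x0 r" for b x A
    using continuous_on_apply_bcontfun[of A "superpose ?K (?F' b) (u x)"] by (simp add: sup'[OF that])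
  show thesis
  proof (rule that[OF r(1) r(3)])
    show "Ck_on k (G b) (ball x0 r)" for b k
      unfolding G_def
      by (intro Ck_on_linear_compose[OF _ bounded_linear_apply_bcontfun] Ck_on_linear_compose[OF _ bounded_linear_volterra]
          superpose_Ck_on[OF _ F'Ck R(2) r(2) uCk ur]) auto
    show "G b x0 = frechet_derivative F (at x0) b" for b
      using r by (simp add: G u)
    fix x assume x: "x \<in> ball x0 r"
    have dF: "(F has_derivative frechet_derivative F (at y)) (at y)" if "y \<in> W" for y
      using Ck_on_has_derivative[OF F that] .
    have "((\<lambda>s. F (x0 + s *\<^sub>R (x - x0))) has_vector_derivative frechet_derivative F (at (x0 + s *\<^sub>R (x - x0))) (x - x0)) (at s within {0..1})"
      if "s \<in> {0..1}" for s
    proof -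
      have "x0 + s *\<^sub>R (x - x0) \<in> W"
        using uK[OF x, of s] R(2) unit_clamp(2)[OF that] by (auto simp: u)
      moreover have "((\<lambda>s. x0 + s *\<^sub>R (x - x0)) has_vector_derivative (x - x0)) (at s within {0..1})"
        by (auto intro!: derivative_eq_intros)
      ultimately show ?thesis
        using vector_derivative_diff_chain_within[of "\<lambda>s. x0 + s *\<^sub>R (x - x0)" "x - x0" s "{0..1}" F]
          has_derivative_at_withinI[OF dF] by (fastforce simp: o_def)
    qed
    then have "((\<lambda>s. frechet_derivative F (at (x0 + s *\<^sub>R (x - x0))) (x - x0)) has_integral (F x - F x0)) {0..1}"
      using fundamental_theorem_of_calculus[of 0 1 "\<lambda>s. F (x0 + s *\<^sub>R (x - x0))"] by simp
    then have "F x - F x0 = integral {0..1} (\<lambda>s. frechet_derivative F (at (x0 + s *\<^sub>R (x - x0))) (x - x0))"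
      by (simp add: integral_unique)
    also have "\<dots> = integral {0..1} (\<lambda>s. \<Sum>b\<in>Basis. ((x - x0) \<bullet> b) * ?F' b (u x s))"
    proof (rule integral_cong)
      fix s :: real assume s: "s \<in> {0..1}"
      have "F differentiable (at (u x s))" using dF uK[OF x, of s] R(2) unfolding differentiable_def by blast
      from frechet_derivative_basis[OF this, of "x - x0"]
      show "frechet_derivative F (at (x0 + s *\<^sub>R (x - x0))) (x - x0) = (\<Sum>b\<in>Basis. ((x - x0) \<bullet> b) * ?F' b (u x s))"
        using unit_clamp(2)[OF s] by (simp add: u)
    qed
    also have "\<dots> = (\<Sum>b\<in>Basis. ((x - x0) \<bullet> b) * G b x)"
      using cont[OF x] by (subst integral_sum) (auto simp: G[OF x] intro!: integrable_continuous_real continuous_intros)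
    finally show "F x = F x0 + (\<Sum>b\<in>Basis. ((x - x0) \<bullet> b) * G b x)" by simp
  qed
qed

lemma inner_ext: "(\<And>a. x \<bullet> a = y \<bullet> a) \<Longrightarrow> x = y"
  using vector_eq_rdot by blast

text \<open>A chart of the maximal atlas, characterised by the smooth functions on its domain.\<close>

locale mchart =
  fixes M :: "('a, 'e::euclidean_space) mfd" and U :: "'a set" and \<phi> :: "'a \<Rightarrow> 'e"
  assumes model_subspace: "subspace (model M)"
    and open_dom: "openin (mtop M) U"
    and open_image: "openin (top_of_set (model M)) (\<phi> ` U)"
    and homeo: "homeomorphic_map (subtopology (mtop M) U) (top_of_set (\<phi> ` U)) \<phi>"
    and smooth_fun_iff: "openin (mtop M) W \<Longrightarrow> W \<subseteq> U \<Longrightarrow>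
      smooth_fun M W f \<longleftrightarrow> smooth_on_set (\<phi> ` W) (\<lambda>z. f (inv_into U \<phi> z))"

text \<open>\<open>smooth_fun\<close> tests a function in all charts of the atlas; smoothness of the
  transition maps reduces this to the one chart.\<close>

lemma mchart_atlas:
  assumes M: "smooth_manifold M" and A: "(U, \<phi>) \<in> atlas M"
  shows "mchart M U \<phi>"
proof
  have inj: "inj_on \<psi> V" if "(V, \<psi>) \<in> atlas M" for V \<psi>
  proof -
    have "homeomorphic_map (subtopology (mtop M) V) (top_of_set (\<psi> ` V)) \<psi>" "openin (mtop M) V"
      using M that by (auto simp: smooth_manifold_def)
    then show ?thesis
      using homeomorphic_imp_injective_map openin_subset by (metis topspace_subtopology_subset)
  qed
  fix W and f :: "'a \<Rightarrow> real" assume W: "openin (mtop M) W" "W \<subseteq> U"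
  show "smooth_fun M W f \<longleftrightarrow> smooth_on_set (\<phi> ` W) (\<lambda>z. f (inv_into U \<phi> z))"
  proof
    assume "smooth_fun M W f"
    then have "smooth_on_set (\<phi> ` (U \<inter> W)) (\<lambda>z. f (inv_into U \<phi> z))"
      using A by (auto simp: smooth_fun_def)
    then show "smooth_on_set (\<phi> ` W) (\<lambda>z. f (inv_into U \<phi> z))"
      using W(2) by (simp add: Int_absorb1)
  next
    assume f: "smooth_on_set (\<phi> ` W) (\<lambda>z. f (inv_into U \<phi> z))"
    show "smooth_fun M W f"
      unfolding smooth_fun_def
    proof (intro ballI, clarify)
      fix V \<psi> assume V: "(V, \<psi>) \<in> atlas M"
      have "smooth_on_set (\<psi> ` (V \<inter> U)) (\<lambda>z. \<phi> (inv_into V \<psi> z))"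
        using M A V by (auto simp: smooth_manifold_def)
      then have "smooth_on_set (\<psi> ` (V \<inter> W)) (\<lambda>z. \<phi> (inv_into V \<psi> z))"
        by (rule smooth_on_set_subset) (use W in auto)
      then have "smooth_on_set (\<psi> ` (V \<inter> W)) (\<lambda>z. f (inv_into U \<phi> (\<phi> (inv_into V \<psi> z))))"
        by (rule smooth_on_set_compose[OF f]) (use inj[OF V] in \<open>auto simp: inv_into_f_f\<close>)
      then show "smooth_on_set (\<psi> ` (V \<inter> W)) (\<lambda>z. f (inv_into V \<psi> z))"
        by (rule smooth_on_set_cong[THEN iffD1, rotated])
          (use inj[OF V] inj[OF A] W in \<open>auto simp: inv_into_f_f subset_iff\<close>)
    qed
  qed
qed (use M A in \<open>auto simp: smooth_manifold_def\<close>)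

context mchart
begin

abbreviation "E \<equiv> model M"
abbreviation "inv\<phi> \<equiv> inv_into U \<phi>"

lemma U_sub: "U \<subseteq> topspace (mtop M)"
  using open_dom openin_subset by blast

lemma inj_chart: "inj_on \<phi> U"
  using homeomorphic_imp_injective_map[OF homeo] U_sub by (simp add: Int_absorb1)

lemma inv_chart [simp]: "q \<in> U \<Longrightarrow> inv\<phi> (\<phi> q) = q"
  using inj_chart by (rule inv_into_f_f)

lemma chart_inv: "z \<in> \<phi> ` U \<Longrightarrow> \<phi> (inv\<phi> z) = z" "z \<in> \<phi> ` U \<Longrightarrow> inv\<phi> z \<in> U"
  by (auto simp: f_inv_into_f inv_into_into)

lemma chart_in_model: "q \<in> U \<Longrightarrow> \<phi> q \<in> E"
  using openin_imp_subset[OF open_image] by auto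

lemma open_chart_image:
  assumes "openin (mtop M) W" "W \<subseteq> U"
  shows "openin (top_of_set E) (\<phi> ` W)"
proof -
  have "openin (subtopology (mtop M) U) W"
    using assms open_dom by (simp add: openin_open_subtopology)
  then have "openin (top_of_set (\<phi> ` U)) (\<phi> ` W)"
    using homeomorphic_imp_open_map[OF homeo] by (simp add: open_map_def)
  then show ?thesis using open_image openin_trans by blast
qed

lemma open_chart_preimage:
  assumes "openin (top_of_set E) S"
  shows "openin (mtop M) {q \<in> U. \<phi> q \<in> S}"
proof -
  have "continuous_map (subtopology (mtop M) U) (top_of_set (\<phi> ` U)) \<phi>"
    using homeo homeomorphic_imp_continuous_map by blast
  moreover have "openin (top_of_set (\<phi> ` U)) (\<phi> ` U \<inter> S)"
    using assms openin_imp_subset[OF open_image] by (auto simp: openin_open)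
  ultimately have "openin (subtopology (mtop M) U) {q \<in> topspace (subtopology (mtop M) U). \<phi> q \<in> \<phi> ` U \<inter> S}"
    by (rule openin_continuous_map_preimage)
  moreover have "{q \<in> topspace (subtopology (mtop M) U). \<phi> q \<in> \<phi> ` U \<inter> S} = {q \<in> U. \<phi> q \<in> S}"
    using U_sub by auto
  ultimately show ?thesis using open_dom by (simp add: openin_open_subtopology)
qed

lemma open_chart_preimage': "open T \<Longrightarrow> openin (mtop M) {q \<in> U. \<phi> q \<in> T}"
  using open_chart_preimage[of "E \<inter> T"] chart_in_model
  by (auto simp: openin_open_Int conj_commute cong: conj_cong)

section \<open>Germs of smooth functions in a chart\<close>

lemma smooth_near_iff:
  assumes "q \<in> U"
  shows "smooth_near M q f \<longleftrightarrow>
    (\<exists>W. openin (mtop M) W \<and> q \<in> W \<and> W \<subseteq> U \<and> smooth_on_set (\<phi> ` W) (\<lambda>z. f (inv\<phi> z)))"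
proof
  assume "smooth_near M q f"
  then obtain W where W: "openin (mtop M) W" "q \<in> W" "smooth_fun M W f"
    by (auto simp: smooth_near_def)
  have "smooth_fun M (W \<inter> U) f"
    using W(3) unfolding smooth_fun_def by (fastforce intro: smooth_on_set_subset)
  then show "\<exists>W. openin (mtop M) W \<and> q \<in> W \<and> W \<subseteq> U \<and> smooth_on_set (\<phi> ` W) (\<lambda>z. f (inv\<phi> z))"
    using W assms open_dom smooth_fun_iff[of "W \<inter> U" f] by (intro exI[of _ "W \<inter> U"]) auto
next
  assume "\<exists>W. openin (mtop M) W \<and> q \<in> W \<and> W \<subseteq> U \<and> smooth_on_set (\<phi> ` W) (\<lambda>z. f (inv\<phi> z))"
  then show "smooth_near M q f"
    unfolding smooth_near_def using smooth_fun_iff by blast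
qed

lemma smooth_nearE:
  assumes "q \<in> U" "smooth_near M q f"
  obtains W where "openin (mtop M) W" "q \<in> W" "W \<subseteq> U" "smooth_on_set (\<phi> ` W) (\<lambda>z. f (inv\<phi> z))"
  using assms smooth_near_iff by blast

lemma smooth_near2E:
  assumes "q \<in> U" "smooth_near M q f" "smooth_near M q g"
  obtains W where "openin (mtop M) W" "q \<in> W" "W \<subseteq> U"
    "smooth_on_set (\<phi> ` W) (\<lambda>z. f (inv\<phi> z))" "smooth_on_set (\<phi> ` W) (\<lambda>z. g (inv\<phi> z))"
proof -
  obtain V where V: "openin (mtop M) V" "q \<in> V" "V \<subseteq> U" "smooth_on_set (\<phi> ` V) (\<lambda>z. f (inv\<phi> z))"
    using smooth_nearE[OF assms(1,2)] .
  obtain W where W: "openin (mtop M) W" "q \<in> W" "W \<subseteq> U" "smooth_on_set (\<phi> ` W) (\<lambda>z. g (inv\<phi> z))"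
    using smooth_nearE[OF assms(1,3)] .
  show thesis
    by (rule that[of "V \<inter> W"]) (use V W in \<open>auto intro: smooth_on_set_subset\<close>)
qed

lemma smooth_near_add:
  assumes "q \<in> U" "smooth_near M q f" "smooth_near M q g"
  shows "smooth_near M q (\<lambda>x. f x + g x)"
proof -
  obtain W where "openin (mtop M) W" "q \<in> W" "W \<subseteq> U"
    "smooth_on_set (\<phi> ` W) (\<lambda>z. f (inv\<phi> z))" "smooth_on_set (\<phi> ` W) (\<lambda>z. g (inv\<phi> z))"
    using smooth_near2E[OF assms] .
  then show ?thesis using assms(1)
    by (subst smooth_near_iff) (auto intro!: exI[of _ W] smooth_on_set_add)
qed

lemma smooth_near_mult:
  assumes "q \<in> U" "smooth_near M q f" "smooth_near M q g"
  shows "smooth_near M q (\<lambda>x. f x * g x)"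
proof -
  obtain W where "openin (mtop M) W" "q \<in> W" "W \<subseteq> U"
    "smooth_on_set (\<phi> ` W) (\<lambda>z. f (inv\<phi> z))" "smooth_on_set (\<phi> ` W) (\<lambda>z. g (inv\<phi> z))"
    using smooth_near2E[OF assms] .
  then show ?thesis using assms(1)
    by (subst smooth_near_iff) (auto intro!: exI[of _ W] smooth_on_set_bilinear[OF bounded_bilinear_mult])
qed

lemma smooth_near_const: "q \<in> U \<Longrightarrow> smooth_near M q (\<lambda>x. c)"
  using open_dom by (auto simp: smooth_near_iff intro!: smooth_on_set_const)

lemma smooth_near_sum:
  "q \<in> U \<Longrightarrow> (\<And>i. i \<in> I \<Longrightarrow> smooth_near M q (f i)) \<Longrightarrow> smooth_near M q (\<lambda>x. \<Sum>i\<in>I. f i x)"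
  by (induction I rule: infinite_finite_induct) (simp_all add: smooth_near_const smooth_near_add)

lemma smooth_near_cong:
  assumes "q \<in> U" "smooth_near M q f" "openin (mtop M) W" "q \<in> W" "\<And>x. x \<in> W \<Longrightarrow> f x = g x"
  shows "smooth_near M q g"
proof -
  obtain V where V: "openin (mtop M) V" "q \<in> V" "V \<subseteq> U" "smooth_on_set (\<phi> ` V) (\<lambda>z. f (inv\<phi> z))"
    using smooth_nearE[OF assms(1,2)] .
  have "smooth_on_set (\<phi> ` (V \<inter> W)) (\<lambda>z. f (inv\<phi> z))"
    using V(4) by (rule smooth_on_set_subset) auto
  then have "smooth_on_set (\<phi> ` (V \<inter> W)) (\<lambda>z. g (inv\<phi> z))"
    by (rule smooth_on_set_cong[THEN iffD1, rotated]) (use V assms in \<open>auto simp: subset_iff\<close>)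
  then show ?thesis
    using V assms by (subst smooth_near_iff) (auto intro!: exI[of _ "V \<inter> W"])
qed

lemma smooth_on_chart_inner: "smooth_on_set (\<phi> ` U) (\<lambda>z. \<phi> (inv\<phi> z) \<bullet> a)"
  by (rule smooth_on_set_cong[THEN iffD1, OF _ smooth_on_set_linear[OF bounded_linear_inner_left[of a]]])
    (auto simp: chart_inv)

lemma smooth_near_chart_inner: "q \<in> U \<Longrightarrow> smooth_near M q (\<lambda>x. \<phi> x \<bullet> a)"
  using open_dom smooth_on_chart_inner by (auto simp: smooth_near_iff)

section \<open>Tangent vectors and vector fields in coordinates\<close>

definition tvec :: "'a \<Rightarrow> 'e \<Rightarrow> 'a vec" where
  "tvec q w = (\<lambda>f. if smooth_near M q f then dirder E (\<lambda>z. f (inv\<phi> z)) (\<phi> q) w else 0)"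

text \<open>The components are the values on the coordinate functions, so no base point
  enters.\<close>

definition coords :: "'a vec \<Rightarrow> 'e" where
  "coords v = (\<Sum>b\<in>Basis. v (\<lambda>x. \<phi> x \<bullet> b) *\<^sub>R b)"

lemma tvec_tangent:
  assumes q: "q \<in> U"
  shows "tvec q w \<in> tangent_space M q"
  unfolding tangent_space_def
proof (intro CollectI conjI allI impI)
  fix f g assume fg: "smooth_near M q f" "smooth_near M q g"
  obtain W where W: "openin (mtop M) W" "q \<in> W" "W \<subseteq> U"
    "smooth_on_set (\<phi> ` W) (\<lambda>z. f (inv\<phi> z))" "smooth_on_set (\<phi> ` W) (\<lambda>z. g (inv\<phi> z))"
    using smooth_near2E[OF q fg] .
  note oW = open_chart_image[OF W(1,3)]
  have qW: "\<phi> q \<in> \<phi> ` W" using W by auto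
  show "tvec q w (\<lambda>x. f x + g x) = tvec q w f + tvec q w g"
    using fg smooth_near_add[OF q fg] dirder_add[OF model_subspace oW W(4,5) qW]
    by (simp add: tvec_def)
  show "tvec q w (\<lambda>x. f x * g x) = f q * tvec q w g + g q * tvec q w f"
    using fg smooth_near_mult[OF q fg] dirder_bilinear[OF model_subspace oW bounded_bilinear_mult W(4,5) qW] q
    by (simp add: tvec_def mult.commute)
next
  fix c f assume f: "smooth_near M q f"
  obtain W where W: "openin (mtop M) W" "q \<in> W" "W \<subseteq> U" "smooth_on_set (\<phi> ` W) (\<lambda>z. f (inv\<phi> z))"
    using smooth_nearE[OF q f] .
  have "dirder E (\<lambda>z. c * f (inv\<phi> z)) (\<phi> q) w = c * dirder E (\<lambda>z. f (inv\<phi> z)) (\<phi> q) w"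
    using dirder_linear_compose[OF model_subspace open_chart_image[OF W(1,3)] bounded_linear_mult_right W(4)] W(2) by blast
  then show "tvec q w (\<lambda>x. c * f x) = c * tvec q w f"
    using f smooth_near_mult[OF q smooth_near_const[OF q] f] by (simp add: tvec_def)
next
  fix f g V assume f: "smooth_near M q f" and V: "openin (mtop M) V" "q \<in> V" "\<forall>x\<in>V. f x = g x"
  obtain W where W: "openin (mtop M) W" "q \<in> W" "W \<subseteq> U" "smooth_on_set (\<phi> ` W) (\<lambda>z. f (inv\<phi> z))"
    using smooth_nearE[OF q f] .
  have o: "openin (top_of_set E) (\<phi> ` (W \<inter> V))" using W V by (intro open_chart_image) auto
  have "dirder E (\<lambda>z. f (inv\<phi> z)) (\<phi> q) w = dirder E (\<lambda>z. g (inv\<phi> z)) (\<phi> q) w"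
    by (rule dirder_cong[OF model_subspace o _ smooth_on_set_subset[OF W(4)]])
      (use W V in \<open>auto simp: subset_iff\<close>)
  then show "tvec q w f = tvec q w g"
    using f smooth_near_cong[OF q f V(1,2)] V(3) by (simp add: tvec_def)
qed (simp add: tvec_def)

lemma
  assumes "v \<in> tangent_space M q"
  shows tangent_add: "smooth_near M q f \<Longrightarrow> smooth_near M q g \<Longrightarrow> v (\<lambda>x. f x + g x) = v f + v g"
    and tangent_mult: "smooth_near M q f \<Longrightarrow> smooth_near M q g \<Longrightarrow> v (\<lambda>x. f x * g x) = f q * v g + g q * v f"
    and tangent_scale: "smooth_near M q f \<Longrightarrow> v (\<lambda>x. c * f x) = c * v f"
    and tangent_local: "smooth_near M q f \<Longrightarrow> openin (mtop M) W \<Longrightarrow> q \<in> W \<Longrightarrow> (\<And>x. x \<in> W \<Longrightarrow> f x = g x) \<Longrightarrow> v f = v g"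
    and tangent_not_smooth: "\<not> smooth_near M q f \<Longrightarrow> v f = 0"
proof -
  note t = assms[unfolded tangent_space_def mem_Collect_eq]
  note t1 = t[THEN conjunct1, rule_format] and t2 = t[THEN conjunct2, THEN conjunct1, rule_format]
    and t3 = t[THEN conjunct2, THEN conjunct2, THEN conjunct1, rule_format]
    and t4 = t[THEN conjunct2, THEN conjunct2, THEN conjunct2, rule_format]
  show "smooth_near M q f \<Longrightarrow> smooth_near M q g \<Longrightarrow> v (\<lambda>x. f x + g x) = v f + v g"
    and "smooth_near M q f \<Longrightarrow> smooth_near M q g \<Longrightarrow> v (\<lambda>x. f x * g x) = f q * v g + g q * v f"
    using t1[of f g] by auto
  show "smooth_near M q f \<Longrightarrow> v (\<lambda>x. c * f x) = c * v f"
    by (rule t2)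
  show "smooth_near M q f \<Longrightarrow> openin (mtop M) W \<Longrightarrow> q \<in> W \<Longrightarrow> (\<And>x. x \<in> W \<Longrightarrow> f x = g x) \<Longrightarrow> v f = v g"
    by (rule t3)
  show "\<not> smooth_near M q f \<Longrightarrow> v f = 0"
    by (rule t4)
qed

lemma tangent_const:
  assumes "q \<in> U" "v \<in> tangent_space M q" shows "v (\<lambda>x. c) = 0"
proof -
  have "v (\<lambda>x. 1 * 1) = 1 * v (\<lambda>x. 1) + 1 * v (\<lambda>x. 1)"
    by (rule tangent_mult[OF assms(2)]) (use smooth_near_const assms in auto)
  then have "v (\<lambda>x. 1) = 0" by simp
  then show ?thesis using tangent_scale[OF assms(2) smooth_near_const[OF assms(1)], of c 1] by simp
qed

lemma tangent_sum:
  assumes "q \<in> U" "v \<in> tangent_space M q" "\<And>i. i \<in> I \<Longrightarrow> smooth_near M q (f i)"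
  shows "v (\<lambda>x. \<Sum>i\<in>I. f i x) = (\<Sum>i\<in>I. v (f i))"
  using assms(3)
proof (induction I rule: infinite_finite_induct)
  case (insert i I)
  then have "v (\<lambda>x. f i x + (\<Sum>i\<in>I. f i x)) = v (f i) + v (\<lambda>x. \<Sum>i\<in>I. f i x)"
    by (intro tangent_add[OF assms(2)] smooth_near_sum[OF assms(1)] insert.prems) auto
  with insert show ?case by simp
qed (use tangent_const[OF assms(1,2)] in auto)

lemma coords_inner:
  assumes "q \<in> U" "v \<in> tangent_space M q"
  shows "coords v \<bullet> a = v (\<lambda>x. \<phi> x \<bullet> a)"
proof -
  have "v (\<lambda>x. \<phi> x \<bullet> a) = v (\<lambda>x. \<Sum>b\<in>Basis. (a \<bullet> b) * (\<phi> x \<bullet> b))"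
    by (subst euclidean_inner) (simp add: mult.commute)
  also have "\<dots> = (\<Sum>b\<in>Basis. v (\<lambda>x. (a \<bullet> b) * (\<phi> x \<bullet> b)))"
    by (rule tangent_sum[OF assms])
      (intro smooth_near_mult[OF assms(1)] smooth_near_const[OF assms(1)] smooth_near_chart_inner assms)
  also have "\<dots> = (\<Sum>b\<in>Basis. (a \<bullet> b) * v (\<lambda>x. \<phi> x \<bullet> b))"
    by (simp add: tangent_scale[OF assms(2) smooth_near_chart_inner[OF assms(1)]])
  also have "\<dots> = coords v \<bullet> a"
    by (simp add: coords_def inner_sum_left inner_commute[of a] mult.commute)
  finally show ?thesis by simp
qed

text \<open>On \<open>U\<close> the functions \<open>\<phi> x \<bullet> a\<close> and
  \<open>\<phi> x \<bullet> orth_proj E a\<close> agree, and a derivation depends on germs only; by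
  self-adjointness \<open>coords v\<close> equals its own projection.\<close>

lemma coords_in_model:
  assumes "q \<in> U" "v \<in> tangent_space M q"
  shows "coords v \<in> E"
proof -
  have "orth_proj E (coords v) \<bullet> a = coords v \<bullet> a" for a
  proof -
    have "orth_proj E (coords v) \<bullet> a = v (\<lambda>x. \<phi> x \<bullet> orth_proj E a)"
      using orth_proj_adjoint[OF model_subspace] coords_inner[OF assms] by simp
    also have "\<dots> = v (\<lambda>x. \<phi> x \<bullet> a)"
    proof (rule tangent_local[OF assms(2) smooth_near_chart_inner[OF assms(1)] open_dom assms(1)])
      show "\<phi> x \<bullet> orth_proj E a = \<phi> x \<bullet> a" if "x \<in> U" for x
        using orth_proj_adjoint[OF model_subspace, of "\<phi> x" a] orth_proj_id[OF model_subspace chart_in_model[OF that]] by simp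
    qed
    finally show ?thesis using coords_inner[OF assms] by simp
  qed
  then have "orth_proj E (coords v) = coords v" by (rule inner_ext)
  then show ?thesis using orth_proj_in[OF model_subspace, of "coords v"] by simp
qed

text \<open>Derivations are directional derivatives. Hadamard's lemma, applied to the extension of
  \<open>f\<close> by the projection, writes \<open>f\<close> near \<open>q\<close> as a constant
  plus products of smooth functions with functions vanishing at \<open>q\<close>; by the Leibniz
  rule only the values of \<open>v\<close> on the coordinate functions survive.\<close>

lemma tvec_coords:
  assumes q: "q \<in> U" and v: "v \<in> tangent_space M q"
  shows "tvec q (coords v) = v"
proof
  fix f
  show "tvec q (coords v) f = v f"
  proof (cases "smooth_near M q f")
    case True
    obtain W where W: "openin (mtop M) W" "q \<in> W" "W \<subseteq> U" "smooth_on_set (\<phi> ` W) (\<lambda>z. f (inv\<phi> z))"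
      using smooth_nearE[OF q True] .
    let ?S = "orth_proj E -` (\<phi> ` W)" and ?F = "\<lambda>x. f (inv\<phi> (orth_proj E x))" and ?x0 = "\<phi> q"
    note oW = open_chart_image[OF W(1,3)]
    have x0: "?x0 \<in> ?S" using W vimage_orth_proj_superset[OF model_subspace oW] by auto
    have FCk: "Ck_on k ?F ?S" for k
      using smooth_on_set_orth_proj[OF model_subspace oW, THEN iffD1, OF W(4)] by (rule spec)
    obtain r G where r: "r > 0" "ball ?x0 r \<subseteq> ?S" and G: "\<And>b k. Ck_on k (G b) (ball ?x0 r)"
      "\<And>x. x \<in> ball ?x0 r \<Longrightarrow> ?F x = ?F ?x0 + (\<Sum>b\<in>Basis. ((x - ?x0) \<bullet> b) * G b x)"
      "\<And>b. G b ?x0 = frechet_derivative ?F (at ?x0) b"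
      using hadamard_lemma[OF open_vimage_orth_proj[OF model_subspace oW] x0 FCk] by blast
    define V where "V = {x \<in> U. \<phi> x \<in> ball ?x0 r}"
    have V: "openin (mtop M) V" "q \<in> V" "V \<subseteq> U"
      using open_chart_preimage'[of "ball ?x0 r"] q r by (auto simp: V_def)
    have pV: "orth_proj E (\<phi> x) = \<phi> x" if "x \<in> U" for x
      using orth_proj_id[OF model_subspace chart_in_model[OF that]] .
    have sG: "smooth_near M q (\<lambda>x. G b (\<phi> x))" for b
      unfolding smooth_near_iff[OF q]
    proof (intro exI[of _ V] conjI V)
      have "smooth_on_set (\<phi> ` V) (G b)"
        by (rule smooth_on_set_CkI[OF open_ball _ G(1)]) (auto simp: V_def)
      then show "smooth_on_set (\<phi> ` V) (\<lambda>z. G b (\<phi> (inv\<phi> z)))"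
        by (rule smooth_on_set_cong[THEN iffD1, rotated]) (auto simp: V_def)
    qed
    have sl: "smooth_near M q (\<lambda>x. \<phi> x \<bullet> b + (- (?x0 \<bullet> b)))" for b
      by (intro smooth_near_add smooth_near_chart_inner smooth_near_const q)
    have vl: "v (\<lambda>x. \<phi> x \<bullet> b + (- (?x0 \<bullet> b))) = coords v \<bullet> b" for b
      using tangent_add[OF v smooth_near_chart_inner[OF q, of b] smooth_near_const[OF q, of "- (?x0 \<bullet> b)"]]
      by (simp only: coords_inner[OF q v] tangent_const[OF q v] add_0_right)
    let ?g = "\<lambda>x. f q + (\<Sum>b\<in>Basis. (\<phi> x \<bullet> b + (- (?x0 \<bullet> b))) * G b (\<phi> x))"
    have "v f = v ?g"
    proof (rule tangent_local[OF v True V(1,2)])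
      show "f x = ?g x" if "x \<in> V" for x
        using G(2)[of "\<phi> x"] that q pV by (auto simp: V_def inner_diff_left)
    qed
    also have "\<dots> = v (\<lambda>x. f q) + v (\<lambda>x. \<Sum>b\<in>Basis. (\<phi> x \<bullet> b + (- (?x0 \<bullet> b))) * G b (\<phi> x))"
      by (rule tangent_add[OF v smooth_near_const[OF q] smooth_near_sum[OF q smooth_near_mult[OF q sl sG]]])
    also have "\<dots> = (\<Sum>b\<in>Basis. v (\<lambda>x. (\<phi> x \<bullet> b + (- (?x0 \<bullet> b))) * G b (\<phi> x)))"
      unfolding tangent_const[OF q v] add_0_left
      by (rule tangent_sum[OF q v smooth_near_mult[OF q sl sG]])
    also have "\<dots> = (\<Sum>b\<in>Basis. (coords v \<bullet> b) *\<^sub>R frechet_derivative ?F (at ?x0) b)"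
    proof (rule sum.cong[OF refl])
      fix b
      show "v (\<lambda>x. (\<phi> x \<bullet> b + (- (?x0 \<bullet> b))) * G b (\<phi> x)) = (coords v \<bullet> b) *\<^sub>R frechet_derivative ?F (at ?x0) b"
        unfolding tangent_mult[OF v sl sG] vl G(3) by simp
    qed
    also have "\<dots> = dirder E (\<lambda>z. f (inv\<phi> z)) ?x0 (coords v)"
      unfolding dirder_def
      using FCk[of "Suc 0"] x0 by (subst frechet_derivative_basis[of ?F]) auto
    finally show ?thesis using True by (simp add: tvec_def)
  next
    case False
    then show ?thesis using tangent_not_smooth[OF v] by (simp add: tvec_def)
  qed
qed

lemma coords_tvec:
  assumes q: "q \<in> U" and w: "w \<in> E"
  shows "coords (tvec q w) = w"
proof -
  have "coords (tvec q w) \<bullet> a = w \<bullet> a" for a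
  proof -
    have "coords (tvec q w) \<bullet> a = dirder E (\<lambda>z. \<phi> (inv\<phi> z) \<bullet> a) (\<phi> q) w"
      using coords_inner[OF q tvec_tangent[OF q]] smooth_near_chart_inner[OF q] by (simp add: tvec_def)
    also have "\<dots> = dirder E (\<lambda>z. z \<bullet> a) (\<phi> q) w"
      by (rule dirder_cong[OF model_subspace open_image _ smooth_on_chart_inner]) (use q in \<open>auto simp: chart_inv\<close>)
    also have "\<dots> = w \<bullet> a"
      by (rule dirder_linear[OF model_subspace open_image bounded_linear_inner_left w])
    finally show ?thesis .
  qed
  then show ?thesis by (rule inner_ext)
qed

lemma tvec_add:
  assumes q: "q \<in> U" shows "tvec q (v + w) = (\<lambda>f. tvec q v f + tvec q w f)"
proof
  fix f
  show "tvec q (v + w) f = tvec q v f + tvec q w f"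
  proof (cases "smooth_near M q f")
    case True
    obtain W where W: "openin (mtop M) W" "q \<in> W" "W \<subseteq> U" "smooth_on_set (\<phi> ` W) (\<lambda>z. f (inv\<phi> z))"
      using smooth_nearE[OF q True] .
    have "linear (dirder E (\<lambda>z. f (inv\<phi> z)) (\<phi> q))"
      using linear_dirder[OF model_subspace open_chart_image[OF W(1,3)] W(4)] W(2) by blast
    then show ?thesis using True by (simp add: tvec_def linear_add)
  qed (simp add: tvec_def)
qed

lemma tvec_scale:
  assumes q: "q \<in> U" shows "tvec q (c *\<^sub>R v) = (\<lambda>f. c * tvec q v f)"
proof
  fix f
  show "tvec q (c *\<^sub>R v) f = c * tvec q v f"
  proof (cases "smooth_near M q f")
    case True
    obtain W where W: "openin (mtop M) W" "q \<in> W" "W \<subseteq> U" "smooth_on_set (\<phi> ` W) (\<lambda>z. f (inv\<phi> z))"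
      using smooth_nearE[OF q True] .
    have "linear (dirder E (\<lambda>z. f (inv\<phi> z)) (\<phi> q))"
      using linear_dirder[OF model_subspace open_chart_image[OF W(1,3)] W(4)] W(2) by blast
    then show ?thesis using True by (simp add: tvec_def linear_scale)
  qed (simp add: tvec_def)
qed

lemma tangent_coords_eqI:
  "q \<in> U \<Longrightarrow> v \<in> tangent_space M q \<Longrightarrow> w \<in> tangent_space M q \<Longrightarrow> coords v = coords w \<Longrightarrow> v = w"
  by (metis tvec_coords)

lemma coords_add: "coords (\<lambda>f. u f + v f) = coords u + coords v"
  by (simp add: coords_def sum.distrib algebra_simps)

lemma coords_scale: "coords (\<lambda>f. c * v f) = c *\<^sub>R coords v"
  by (simp add: coords_def scaleR_sum_right)

lemma coords_sum: "coords (\<lambda>f. \<Sum>i\<in>I. c i * X i f) = (\<Sum>i\<in>I. c i *\<^sub>R coords (X i))"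
  by (induction I rule: infinite_finite_induct) (simp_all add: coords_add coords_scale coords_def[of "\<lambda>f. 0"])

lemma tangent_space_add:
  "q \<in> U \<Longrightarrow> v \<in> tangent_space M q \<Longrightarrow> w \<in> tangent_space M q \<Longrightarrow> (\<lambda>f. v f + w f) \<in> tangent_space M q"
  using tvec_add[of q "coords v" "coords w"] tvec_tangent[of q "coords v + coords w"] by (simp add: tvec_coords)

lemma tangent_space_scale:
  "q \<in> U \<Longrightarrow> v \<in> tangent_space M q \<Longrightarrow> (\<lambda>f. c * v f) \<in> tangent_space M q"
  using tvec_scale[of q c "coords v"] tvec_tangent[of q "c *\<^sub>R coords v"] by (simp add: tvec_coords)

text \<open>Testing against the coordinate functions gives smooth components; conversely the field
  acts on \<open>f\<close> as the derivative in the moving direction of its components.\<close>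

lemma vector_field_iff:
  assumes W: "openin (mtop M) W" "W \<subseteq> U"
  shows "vector_field M W X \<longleftrightarrow>
    (\<forall>q\<in>W. X q \<in> tangent_space M q) \<and> smooth_on_set (\<phi> ` W) (\<lambda>z. coords (X (inv\<phi> z)))"
proof
  assume X: "vector_field M W X"
  have "smooth_on_set (\<phi> ` W) (\<lambda>z. X (inv\<phi> z) (\<lambda>x. \<phi> x \<bullet> b))" for b
  proof -
    have "smooth_fun M W (\<lambda>x. \<phi> x \<bullet> b)"
      using smooth_fun_iff[OF W] smooth_on_chart_inner W(2) by (blast intro: smooth_on_set_subset)
    then have "smooth_fun M W (\<lambda>q. X q (\<lambda>x. \<phi> x \<bullet> b))"
      using X W unfolding vector_field_def by blast
    then show ?thesis using smooth_fun_iff[OF W] by simp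
  qed
  then have "smooth_on_set (\<phi> ` W) (\<lambda>z. coords (X (inv\<phi> z)))"
    unfolding coords_def
    by (intro smooth_on_set_sum smooth_on_set_bilinear[OF bounded_bilinear_scaleR] smooth_on_set_const)
  then show "(\<forall>q\<in>W. X q \<in> tangent_space M q) \<and> smooth_on_set (\<phi> ` W) (\<lambda>z. coords (X (inv\<phi> z)))"
    using X by (simp add: vector_field_def)
next
  assume X: "(\<forall>q\<in>W. X q \<in> tangent_space M q) \<and> smooth_on_set (\<phi> ` W) (\<lambda>z. coords (X (inv\<phi> z)))"
  show "vector_field M W X"
    unfolding vector_field_def
  proof (intro conjI allI impI)
    fix V f assume V: "openin (mtop M) V" "V \<subseteq> W" and "smooth_fun M V f"
    then have f: "smooth_on_set (\<phi> ` V) (\<lambda>z. f (inv\<phi> z))"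
      using smooth_fun_iff[of V f] W(2) by blast
    have oV: "openin (top_of_set E) (\<phi> ` V)" using V W by (intro open_chart_image) auto
    have "smooth_on_set (\<phi> ` V) (\<lambda>z. coords (X (inv\<phi> z)))"
      using X V by (auto intro: smooth_on_set_subset)
    then have "smooth_on_set (\<phi> ` V) (\<lambda>z. dirder E (\<lambda>z. f (inv\<phi> z)) z (coords (X (inv\<phi> z))))"
      by (rule smooth_on_set_dirder_apply[OF model_subspace oV f])
    then have "smooth_on_set (\<phi> ` V) (\<lambda>z. X (inv\<phi> z) f)"
    proof (rule smooth_on_set_cong[THEN iffD1, rotated])
      fix z assume "z \<in> \<phi> ` V"
      then obtain q where q: "q \<in> V" "q \<in> U" "z = \<phi> q" "q \<in> W" using V W by blast
      have "smooth_near M q f"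
        using smooth_near_iff[OF q(2)] f V W q(1) by blast
      then show "dirder E (\<lambda>z. f (inv\<phi> z)) z (coords (X (inv\<phi> z))) = X (inv\<phi> z) f"
        using tvec_coords[of q "X q"] X q by (simp add: tvec_def fun_eq_iff) metis
    qed
    then show "smooth_fun M V (\<lambda>p. X p f)"
      using smooth_fun_iff[of V] V W by simp
  qed (use X in auto)
qed

lemma vector_field_coords_smooth:
  "openin (mtop M) W \<Longrightarrow> W \<subseteq> U \<Longrightarrow> vector_field M W X \<Longrightarrow> smooth_on_set (\<phi> ` W) (\<lambda>z. coords (X (inv\<phi> z)))"
  using vector_field_iff by blast

lemma vector_field_tvec:
  assumes W: "openin (mtop M) W" "W \<subseteq> U" and w: "smooth_on_set (\<phi> ` W) w" "\<And>q. q \<in> W \<Longrightarrow> w (\<phi> q) \<in> E"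
  shows "vector_field M W (\<lambda>q. tvec q (w (\<phi> q)))"
  unfolding vector_field_iff[OF W]
proof
  show "\<forall>q\<in>W. tvec q (w (\<phi> q)) \<in> tangent_space M q" using W tvec_tangent by blast
  show "smooth_on_set (\<phi> ` W) (\<lambda>z. coords (tvec (inv\<phi> z) (w (\<phi> (inv\<phi> z)))))"
    by (rule smooth_on_set_cong[THEN iffD1, OF _ w(1)]) (use W w(2) in \<open>auto simp: coords_tvec subset_iff\<close>)
qed

section \<open>Covectors and one-forms in coordinates\<close>

definition cvec :: "'a \<Rightarrow> 'e \<Rightarrow> 'a covec" where
  "cvec q a = (\<lambda>v. if v \<in> tangent_space M q then a \<bullet> coords v else 0)"

text \<open>The vector of \<open>E\<close> representing a covector under the inner product. The
  basis vectors are projected first because they need not lie in the model space.\<close>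

definition ccoords :: "'a \<Rightarrow> 'a covec \<Rightarrow> 'e" where
  "ccoords q \<alpha> = (\<Sum>b\<in>Basis. \<alpha> (tvec q (orth_proj E b)) *\<^sub>R b)"

lemma cvec_cotangent: "q \<in> U \<Longrightarrow> cvec q a \<in> cotangent_space M q"
  by (auto simp: cotangent_space_def cvec_def tangent_space_add tangent_space_scale coords_add coords_scale inner_add_right)

lemma
  assumes "\<alpha> \<in> cotangent_space M q"
  shows cotangent_add: "u \<in> tangent_space M q \<Longrightarrow> v \<in> tangent_space M q \<Longrightarrow> \<alpha> (\<lambda>f. u f + v f) = \<alpha> u + \<alpha> v"
    and cotangent_scale: "v \<in> tangent_space M q \<Longrightarrow> \<alpha> (\<lambda>f. c * v f) = c * \<alpha> v"
    and cotangent_not_tangent: "v \<notin> tangent_space M q \<Longrightarrow> \<alpha> v = 0"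
proof -
  note t = assms[unfolded cotangent_space_def mem_Collect_eq]
  show "u \<in> tangent_space M q \<Longrightarrow> v \<in> tangent_space M q \<Longrightarrow> \<alpha> (\<lambda>f. u f + v f) = \<alpha> u + \<alpha> v"
    using t[THEN conjunct1] by blast
  show "v \<in> tangent_space M q \<Longrightarrow> \<alpha> (\<lambda>f. c * v f) = c * \<alpha> v"
    using t[THEN conjunct2, THEN conjunct1] by blast
  show "v \<notin> tangent_space M q \<Longrightarrow> \<alpha> v = 0"
    using t[THEN conjunct2, THEN conjunct2] by blast
qed

lemma cotangent_tvec_linear:
  assumes "q \<in> U" "\<alpha> \<in> cotangent_space M q"
  shows "linear (\<lambda>w. \<alpha> (tvec q w))"
proof (rule linearI)
  show "\<alpha> (tvec q (v + w)) = \<alpha> (tvec q v) + \<alpha> (tvec q w)" for v w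
    unfolding tvec_add[OF assms(1)] by (rule cotangent_add[OF assms(2) tvec_tangent tvec_tangent]) fact+
  show "\<alpha> (tvec q (c *\<^sub>R v)) = c *\<^sub>R \<alpha> (tvec q v)" for c v
    unfolding tvec_scale[OF assms(1)] real_scaleR_def
    by (rule cotangent_scale[OF assms(2) tvec_tangent]) fact
qed

lemma ccoords_inner_proj:
  assumes "q \<in> U" "\<alpha> \<in> cotangent_space M q"
  shows "ccoords q \<alpha> \<bullet> a = \<alpha> (tvec q (orth_proj E a))"
proof -
  have lin: "linear (\<lambda>w. \<alpha> (tvec q (orth_proj E w)))"
    using linear_compose[OF linear_orth_proj[OF model_subspace] cotangent_tvec_linear[OF assms]] by (simp add: o_def)
  have "\<alpha> (tvec q (orth_proj E (\<Sum>b\<in>Basis. (a \<bullet> b) *\<^sub>R b))) = (\<Sum>b\<in>Basis. (a \<bullet> b) * \<alpha> (tvec q (orth_proj E b)))"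
    by (simp only: linear_sum[OF lin] linear_scale[OF lin] real_scaleR_def)
  then have "\<alpha> (tvec q (orth_proj E a)) = (\<Sum>b\<in>Basis. (a \<bullet> b) * \<alpha> (tvec q (orth_proj E b)))"
    by (simp only: euclidean_representation)
  then show ?thesis
    by (simp add: ccoords_def inner_sum_left inner_commute[of a] mult.commute)
qed

lemma cotangent_apply:
  assumes "q \<in> U" "\<alpha> \<in> cotangent_space M q" "v \<in> tangent_space M q"
  shows "\<alpha> v = ccoords q \<alpha> \<bullet> coords v"
  using ccoords_inner_proj[OF assms(1,2), of "coords v"] assms
  by (simp add: orth_proj_id[OF model_subspace coords_in_model] tvec_coords)

lemma ccoords_in_model:
  assumes "q \<in> U" "\<alpha> \<in> cotangent_space M q"
  shows "ccoords q \<alpha> \<in> E"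
proof -
  have "orth_proj E (ccoords q \<alpha>) \<bullet> a = ccoords q \<alpha> \<bullet> a" for a
    using orth_proj_adjoint[OF model_subspace] ccoords_inner_proj[OF assms] orth_proj_idem[OF model_subspace] by simp
  then have "orth_proj E (ccoords q \<alpha>) = ccoords q \<alpha>" by (rule inner_ext)
  then show ?thesis using orth_proj_in[OF model_subspace, of "ccoords q \<alpha>"] by simp
qed

lemma cvec_ccoords:
  assumes "q \<in> U" "\<alpha> \<in> cotangent_space M q"
  shows "cvec q (ccoords q \<alpha>) = \<alpha>"
  using cotangent_apply[OF assms] cotangent_not_tangent[OF assms(2)] by (auto simp: cvec_def fun_eq_iff)

lemma cvec_tvec: "q \<in> U \<Longrightarrow> w \<in> E \<Longrightarrow> cvec q a (tvec q w) = a \<bullet> w"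
  by (simp add: cvec_def tvec_tangent coords_tvec)

lemma ccoords_cvec:
  assumes "q \<in> U" "a \<in> E" shows "ccoords q (cvec q a) = a"
proof -
  have "ccoords q (cvec q a) \<bullet> b = a \<bullet> b" for b
    using ccoords_inner_proj[OF assms(1) cvec_cotangent[OF assms(1)]] assms
      orth_proj_adjoint[OF model_subspace, of a b] orth_proj_id[OF model_subspace assms(2)]
    by (simp add: cvec_tvec orth_proj_in[OF model_subspace])
  then show ?thesis by (rule inner_ext)
qed

lemma ccoords_sum: "ccoords q (\<lambda>v. \<Sum>i\<in>I. c i * \<alpha> i v) = (\<Sum>i\<in>I. c i *\<^sub>R ccoords q (\<alpha> i))"
  unfolding ccoords_def
  by (simp add: scaleR_sum_right scaleR_sum_left) (rule sum.swap)

text \<open>Constant coordinate fields detect the components; evaluation on a field is the inner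
  product of the components.\<close>

lemma one_form_iff:
  assumes W: "openin (mtop M) W" "W \<subseteq> U"
  shows "one_form M W \<alpha> \<longleftrightarrow>
    (\<forall>q\<in>W. \<alpha> q \<in> cotangent_space M q) \<and> smooth_on_set (\<phi> ` W) (\<lambda>z. ccoords (inv\<phi> z) (\<alpha> (inv\<phi> z)))"
proof
  assume \<alpha>: "one_form M W \<alpha>"
  have "smooth_on_set (\<phi> ` W) (\<lambda>z. \<alpha> (inv\<phi> z) (tvec (inv\<phi> z) (orth_proj E b)))" for b
  proof -
    have "vector_field M W (\<lambda>q. tvec q (orth_proj E b))"
      by (rule vector_field_tvec[OF W smooth_on_set_const orth_proj_in[OF model_subspace]])
    then have "smooth_fun M W (\<lambda>q. \<alpha> q (tvec q (orth_proj E b)))"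
      using \<alpha> W unfolding one_form_def by blast
    then show ?thesis using smooth_fun_iff[OF W] by simp
  qed
  then have "smooth_on_set (\<phi> ` W) (\<lambda>z. ccoords (inv\<phi> z) (\<alpha> (inv\<phi> z)))"
    unfolding ccoords_def
    by (intro smooth_on_set_sum smooth_on_set_bilinear[OF bounded_bilinear_scaleR] smooth_on_set_const)
  then show "(\<forall>q\<in>W. \<alpha> q \<in> cotangent_space M q) \<and> smooth_on_set (\<phi> ` W) (\<lambda>z. ccoords (inv\<phi> z) (\<alpha> (inv\<phi> z)))"
    using \<alpha> by (simp add: one_form_def)
next
  assume \<alpha>: "(\<forall>q\<in>W. \<alpha> q \<in> cotangent_space M q) \<and> smooth_on_set (\<phi> ` W) (\<lambda>z. ccoords (inv\<phi> z) (\<alpha> (inv\<phi> z)))"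
  show "one_form M W \<alpha>"
    unfolding one_form_def
  proof (intro conjI allI impI)
    fix V X assume V: "openin (mtop M) V" "V \<subseteq> W" and X: "vector_field M V X"
    have VU: "V \<subseteq> U" using V W by blast
    have "smooth_on_set (\<phi> ` V) (\<lambda>z. ccoords (inv\<phi> z) (\<alpha> (inv\<phi> z)) \<bullet> coords (X (inv\<phi> z)))"
      using \<alpha> V by (intro smooth_on_set_bilinear[OF bounded_bilinear_inner] vector_field_coords_smooth[OF V(1) VU X])
        (auto intro: smooth_on_set_subset)
    then have "smooth_on_set (\<phi> ` V) (\<lambda>z. \<alpha> (inv\<phi> z) (X (inv\<phi> z)))"
      by (rule smooth_on_set_cong[THEN iffD1, rotated])
        (use \<alpha> V VU X in \<open>auto simp: cotangent_apply vector_field_def subset_iff\<close>)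
    then show "smooth_fun M V (\<lambda>q. \<alpha> q (X q))"
      using smooth_fun_iff[OF V(1) VU] by simp
  qed (use \<alpha> in auto)
qed

lemma one_form_cvec:
  assumes W: "openin (mtop M) W" "W \<subseteq> U" and a: "smooth_on_set (\<phi> ` W) a" "\<And>q. q \<in> W \<Longrightarrow> a (\<phi> q) \<in> E"
  shows "one_form M W (\<lambda>q. cvec q (a (\<phi> q)))"
  unfolding one_form_iff[OF W]
proof
  show "\<forall>q\<in>W. cvec q (a (\<phi> q)) \<in> cotangent_space M q" using W cvec_cotangent by blast
  show "smooth_on_set (\<phi> ` W) (\<lambda>z. ccoords (inv\<phi> z) (cvec (inv\<phi> z) (a (\<phi> (inv\<phi> z)))))"
    by (rule smooth_on_set_cong[THEN iffD1, OF _ a(1)]) (use W a(2) in \<open>auto simp: ccoords_cvec subset_iff\<close>)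
qed

end

section \<open>Sections of a Dirac structure in coordinates\<close>

text \<open>Gronwall's inequality for the sum of squares. The coefficients are merely bounded,
  because in the application they are chosen pointwise in \<open>s\<close> without regard to
  continuity.\<close>

lemma linear_ode_zero:
  fixes h :: "nat \<Rightarrow> real \<Rightarrow> real"
  assumes dh: "\<And>i s. i < r \<Longrightarrow> s \<in> {0..1} \<Longrightarrow> (h i has_real_derivative (\<Sum>j<r. c i j s * h j s)) (at s)"
    and c: "\<And>i j s. i < r \<Longrightarrow> j < r \<Longrightarrow> s \<in> {0..1} \<Longrightarrow> \<bar>c i j s\<bar> \<le> C"
    and h0: "\<And>i. i < r \<Longrightarrow> h i 0 = 0" and s: "s \<in> {0..1}" and i: "i < r"
  shows "h i s = 0"
proof -
  define H where "H s = (\<Sum>i<r. (h i s)\<^sup>2)" for s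
  define H' where "H' s = (\<Sum>i<r. 2 * h i s * (\<Sum>j<r. c i j s * h j s))" for s
  have dH: "(H has_real_derivative H' s) (at s)" if "s \<in> {0..1}" for s
    unfolding H_def H'_def
    by (rule DERIV_sum) (auto intro!: derivative_eq_intros dh that)
  \<comment> \<open>Since \<open>2 * a * b\<close> is at most the sum of the squares, the pairs
    \<open>(i, j)\<close> contribute \<open>C * ((h i s)\<^sup>2 + (h j s)\<^sup>2)\<close> each,
    and summing over \<open>r\<close> by \<open>r\<close> of them gives \<open>2 * C * r\<close>
    times \<open>H s\<close>.\<close>
  define K where "K = 2 * C * real r"
  have H': "H' s \<le> K * H s" if s: "s \<in> {0..1}" for s
  proof -
    have "2 * h i s * (c i j s * h j s) \<le> C * ((h i s)\<^sup>2 + (h j s)\<^sup>2)" if "i < r" "j < r" for i j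
    proof -
      have "C \<ge> 0" using c[OF that s] by linarith
      have "2 * h i s * (c i j s * h j s) \<le> \<bar>c i j s\<bar> * \<bar>2 * h i s * h j s\<bar>"
        by (rule order_trans[OF abs_ge_self]) (simp add: abs_mult mult.commute mult.left_commute)
      also have "\<dots> \<le> C * \<bar>2 * h i s * h j s\<bar>"
        using c[OF that s] by (intro mult_right_mono) auto
      also have "\<dots> \<le> C * ((h i s)\<^sup>2 + (h j s)\<^sup>2)"
        using \<open>C \<ge> 0\<close> sum_squares_bound[of "\<bar>h i s\<bar>" "\<bar>h j s\<bar>"]
        by (intro mult_left_mono) (auto simp: abs_mult)
      finally show ?thesis .
    qed
    then have "H' s \<le> (\<Sum>i<r. \<Sum>j<r. C * ((h i s)\<^sup>2 + (h j s)\<^sup>2))"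
      unfolding H'_def sum_distrib_left by (intro sum_mono) auto
    also have "\<dots> = K * H s"
      by (simp add: sum.distrib sum_distrib_left[symmetric] distrib_left H_def K_def algebra_simps)
    finally show ?thesis .
  qed
  have "H s * exp (- K * s) \<le> H 0 * exp (- K * 0)"
  proof (rule DERIV_nonpos_imp_nonincreasing[of 0 s "\<lambda>s. H s * exp (- K * s)"])
    fix t assume t: "0 \<le> t" "t \<le> s"
    then have t1: "t \<in> {0..1}" using s by auto
    have "((\<lambda>s. H s * exp (- K * s)) has_real_derivative (H' t - K * H t) * exp (- K * t)) (at t)"
      by (auto intro!: derivative_eq_intros dH t1 simp: algebra_simps)
    moreover have "(H' t - K * H t) * exp (- K * t) \<le> 0"
      using H'[OF t1] by (simp add: mult_nonpos_nonneg)
    ultimately show "\<exists>y. ((\<lambda>s. H s * exp (- K * s)) has_real_derivative y) (at t) \<and> y \<le> 0" by blast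
  qed (use s in auto)
  moreover have "H 0 = 0" using h0 by (simp add: H_def)
  ultimately have "H s \<le> 0" by (simp add: mult_le_0_iff)
  then have "H s = 0" using sum_nonneg[of "{..<r}" "\<lambda>i. (h i s)\<^sup>2"] by (simp add: H_def)
  then show ?thesis using i by (simp add: H_def sum_nonneg_eq_0_iff)
qed

text \<open>Linear independence at each \<open>s\<close> becomes uniform by compactness: the norm of
  the combination has a positive minimum over all \<open>s\<close> and all coefficient vectors of
  length 1.\<close>

lemma frame_lower_bound:
  fixes e :: "nat \<Rightarrow> real \<Rightarrow> 'v::euclidean_space"
  assumes cont: "\<And>i. i < r \<Longrightarrow> continuous_on {0..1} (e i)"
    and indep: "\<And>s c. s \<in> {0..1} \<Longrightarrow> (\<Sum>i<r. c i *\<^sub>R e i s) = 0 \<Longrightarrow> \<forall>i<r. c i = 0"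
  shows "\<exists>\<delta>>0. \<forall>s\<in>{0..1}. \<forall>c. \<forall>j<r. \<delta> * \<bar>c j\<bar> \<le> norm (\<Sum>i<r. c i *\<^sub>R e i s)"
proof (cases "r = 0")
  case True
  then show ?thesis by (intro exI[of _ 1]) simp
next
  case False
  have inj: "inj_on (\<lambda>i. e i 0) {..<r}"
  proof (rule inj_onI, rule ccontr)
    fix i j assume ij: "i \<in> {..<r}" "j \<in> {..<r}" "e i 0 = e j 0" "i \<noteq> j"
    let ?c = "\<lambda>k. if k = i then 1 else if k = j then -1 else (0::real)"
    have "(\<Sum>k<r. ?c k *\<^sub>R e k 0) = (\<Sum>k\<in>{i, j}. ?c k *\<^sub>R e k 0)"
      by (rule sum.mono_neutral_right) (use ij in auto)
    also have "\<dots> = 0" using ij by simp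
    finally have sum0: "(\<Sum>k<r. ?c k *\<^sub>R e k 0) = 0" .
    have "\<forall>k<r. ?c k = 0" by (rule indep[OF _ sum0]) simp
    then show False using ij by (metis lessThan_iff one_neq_zero)
  qed
  have "independent ((\<lambda>i. e i 0) ` {..<r})"
  proof
    assume "dependent ((\<lambda>i. e i 0) ` {..<r})"
    then obtain u v where u: "v \<in> (\<lambda>i. e i 0) ` {..<r}" "u v \<noteq> 0" "(\<Sum>v\<in>(\<lambda>i. e i 0) ` {..<r}. u v *\<^sub>R v) = 0"
      by (auto simp: dependent_finite)
    then have "(\<Sum>i<r. u (e i 0) *\<^sub>R e i 0) = 0" by (simp add: sum.reindex[OF inj])
    then have "\<forall>i<r. u (e i 0) = 0" by (intro indep[of 0]) auto
    then show False using u by auto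
  qed
  then have "r \<le> DIM('v)" using independent_bound[of "(\<lambda>i. e i 0) ` {..<r}"] by (simp add: card_image[OF inj])
  \<comment> \<open>Coefficient families indexed by \<open>nat\<close> do not form a Euclidean
    space, so they are encoded as vectors of type \<open>'v\<close> through an injection of the
    indices into \<open>Basis\<close>; independence at 0 guarantees enough room.\<close>
  then obtain b where b: "b ` {..<r} \<subseteq> (Basis :: 'v set)" "inj_on b {..<r}"
    using card_le_inj[of "{..<r}" "Basis :: 'v set"] by auto
  have bb: "b i \<bullet> b j = (if i = j then 1 else 0)" if "i < r" "j < r" for i j
    using b that by (auto simp: inner_Basis inj_on_def image_subset_iff)
  define T where "T s z = (\<Sum>i<r. (b i \<bullet> z) *\<^sub>R e i s)" for s z
  define K where "K = {0..1::real} \<times> (sphere 0 1 \<inter> span (b ` {..<r}))"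
  have "compact K"
    unfolding K_def by (intro compact_Times compact_Icc compact_Int_closed compact_sphere closed_subspace subspace_span)
  moreover have "(0, b 0) \<in> K" using False b by (auto simp: K_def span_base image_subset_iff)
  moreover have "continuous_on K (\<lambda>(s, z). norm (T s z))"
    unfolding T_def split_beta
    by (intro continuous_intros continuous_on_compose2[OF cont continuous_on_fst[OF continuous_on_id]]) (auto simp: K_def)
  ultimately obtain s0 z0 where m: "(s0, z0) \<in> K" "\<And>s z. (s, z) \<in> K \<Longrightarrow> norm (T s0 z0) \<le> norm (T s z)"
    using continuous_attains_inf[of K "\<lambda>(s, z). norm (T s z)"] by fastforce
  have "norm (T s0 z0) > 0"
  proof (rule ccontr)
    assume "\<not> norm (T s0 z0) > 0"
    then have "(\<Sum>i<r. (b i \<bullet> z0) *\<^sub>R e i s0) = 0" by (simp add: T_def)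
    then have "\<forall>i<r. b i \<bullet> z0 = 0" using m(1) by (intro indep[of s0]) (auto simp: K_def)
    then have "orthogonal z0 y" if "y \<in> b ` {..<r}" for y
      using that by (auto simp: orthogonal_def inner_commute[of z0])
    then have "orthogonal z0 z0"
      using m(1) by (intro orthogonal_to_span[of z0 "b ` {..<r}"]) (auto simp: K_def)
    then show False using m(1) by (simp add: K_def orthogonal_def)
  qed
  moreover have "norm (T s0 z0) * \<bar>c j\<bar> \<le> norm (\<Sum>i<r. c i *\<^sub>R e i s)" if s: "s \<in> {0..1}" and j: "j < r" for s c j
  proof -
    define z where "z = (\<Sum>i<r. c i *\<^sub>R b i)"
    have bz: "b i \<bullet> z = c i" if "i < r" for i
    proof -
      have "b i \<bullet> z = (\<Sum>k<r. if k = i then c i else 0)"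
        unfolding z_def inner_sum_right by (rule sum.cong) (use bb that in auto)
      then show ?thesis using that by simp
    qed
    have T: "T s z = (\<Sum>i<r. c i *\<^sub>R e i s)" by (simp add: T_def bz)
    have cz: "\<bar>c j\<bar> \<le> norm z"
      using Basis_le_norm[of "b j" z] b(1) j bz[OF j] by (auto simp: inner_commute)
    show ?thesis
    proof (cases "z = 0")
      case True
      then show ?thesis using cz by simp
    next
      case False
      have "z \<in> span (b ` {..<r})" unfolding z_def by (intro span_sum span_scale span_base) auto
      then have "(s, z /\<^sub>R norm z) \<in> K" using False s by (auto simp: K_def span_scale)
      then have "norm (T s0 z0) \<le> norm (T s (z /\<^sub>R norm z))" by (rule m(2))
      also have "T s (z /\<^sub>R norm z) = T s z /\<^sub>R norm z" by (simp add: T_def scaleR_sum_right)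
      finally have "norm (T s0 z0) * norm z \<le> norm (T s z)" using False by (simp add: field_simps)
      moreover have "norm (T s0 z0) * \<bar>c j\<bar> \<le> norm (T s0 z0) * norm z" using cz by (intro mult_left_mono) auto
      ultimately show ?thesis using T by simp
    qed
  qed
  ultimately show ?thesis by (intro exI[of _ "norm (T s0 z0)"]) simp
qed

text \<open>The pairings of \<open>\<eta>\<close> with the frame satisfy a linear system, since the
  derivative of each frame vector is a combination of the frame. The coefficients come from an
  arbitrary choice at every \<open>s\<close>; their bound \<open>B / \<delta>\<close> combines a
  bound on the derivatives with \<open>frame_lower_bound\<close>.\<close>

lemma annihilator_transport:
  fixes e e' :: "nat \<Rightarrow> real \<Rightarrow> 'v::euclidean_space"
  assumes de: "\<And>i s. i < r \<Longrightarrow> s \<in> {0..1} \<Longrightarrow> (e i has_vector_derivative e' i s) (at s)"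
    and ce': "\<And>i. i < r \<Longrightarrow> continuous_on {0..1} (e' i)"
    and e'_span: "\<And>i s. i < r \<Longrightarrow> s \<in> {0..1} \<Longrightarrow> \<exists>c. e' i s = (\<Sum>j<r. c j *\<^sub>R e j s)"
    and indep: "\<And>s c. s \<in> {0..1} \<Longrightarrow> (\<Sum>i<r. c i *\<^sub>R e i s) = 0 \<Longrightarrow> \<forall>i<r. c i = 0"
    and \<eta>: "\<And>i. i < r \<Longrightarrow> \<eta> \<bullet> e i 0 = 0" and "s \<in> {0..1}" "i < r"
  shows "\<eta> \<bullet> e i s = 0"
proof -
  have cont: "continuous_on {0..1} (e i)" if "i < r" for i
    using de[OF that] by (intro continuous_at_imp_continuous_on ballI has_vector_derivative_continuous)
  obtain \<delta> where \<delta>: "\<delta> > 0"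
    "\<forall>s\<in>{0..1}. \<forall>c. \<forall>j<r. \<delta> * \<bar>c j\<bar> \<le> norm (\<Sum>i<r. c i *\<^sub>R e i s)"
  proof -
    have "\<exists>\<delta>>0. \<forall>s\<in>{0..1}. \<forall>c. \<forall>j<r. \<delta> * \<bar>c j\<bar> \<le> norm (\<Sum>i<r. c i *\<^sub>R e i s)"
      by (rule frame_lower_bound) (rule cont, assumption, rule indep, assumption+)
    then show ?thesis using that by blast
  qed
  have "\<exists>c. \<forall>i s. i < r \<longrightarrow> s \<in> {0..1} \<longrightarrow> e' i s = (\<Sum>j<r. c i s j *\<^sub>R e j s)"
    using e'_span by (intro choice allI) blast
  then obtain c where c: "\<And>i s. i < r \<Longrightarrow> s \<in> {0..1} \<Longrightarrow> e' i s = (\<Sum>j<r. c i s j *\<^sub>R e j s)" by blast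
  have "bounded (\<Union>i<r. e' i ` {0..1})"
    using ce' by (intro bounded_UN) (auto intro: compact_imp_bounded compact_continuous_image)
  then obtain B where B: "\<And>i s. i < r \<Longrightarrow> s \<in> {0..1} \<Longrightarrow> norm (e' i s) \<le> B"
    unfolding bounded_iff by blast
  show ?thesis
  proof (rule linear_ode_zero[where h = "\<lambda>i s. \<eta> \<bullet> e i s" and c = "\<lambda>i j s. c i s j" and C = "B / \<delta>"])
    fix i s assume i: "i < r" and s: "s \<in> {0..1::real}"
    have "((\<lambda>s. \<eta> \<bullet> e i s) has_vector_derivative \<eta> \<bullet> e' i s) (at s)"
      by (rule bounded_linear.has_vector_derivative[OF bounded_linear_inner_right de[OF i s]])
    then show "((\<lambda>s. \<eta> \<bullet> e i s) has_real_derivative (\<Sum>j<r. c i s j * (\<eta> \<bullet> e j s))) (at s)"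
      by (simp add: has_real_derivative_iff_has_vector_derivative c[OF i s] inner_sum_right)
    fix j assume j: "j < r"
    have "\<delta> * \<bar>c i s j\<bar> \<le> B" using \<delta>(2)[rule_format, OF s j, of "c i s"] c[OF i s] B[OF i s] by simp
    then show "\<bar>c i s j\<bar> \<le> B / \<delta>" using \<delta>(1) by (simp add: field_simps)
  qed (use \<eta> assms(6,7) in auto)
qed

lemma vector_field_subset:
  "vector_field M U X \<Longrightarrow> V \<subseteq> U \<Longrightarrow> vector_field M V X"
  unfolding vector_field_def by blast

lemma one_form_subset:
  "one_form M U \<alpha> \<Longrightarrow> V \<subseteq> U \<Longrightarrow> one_form M V \<alpha>"
  unfolding one_form_def by blast

lemma bundle_section_subset:
  "bundle_section M D U X \<alpha> \<Longrightarrow> openin (mtop M) V \<Longrightarrow> V \<subseteq> U \<Longrightarrow> bundle_section M D V X \<alpha>"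
  unfolding bundle_section_def using vector_field_subset one_form_subset by (metis subsetD)

section \<open>Lie bracket and Lie derivative along a constant coordinate field\<close>

context mchart
begin

lemma smooth_near_apply_field:
  assumes "vector_field M W X" "openin (mtop M) W" "q \<in> W" "q \<in> U" "smooth_near M q f"
  shows "smooth_near M q (\<lambda>p. X p f)"
proof -
  obtain V where V: "openin (mtop M) V" "q \<in> V" "V \<subseteq> U" "smooth_on_set (\<phi> ` V) (\<lambda>z. f (inv\<phi> z))"
    using smooth_nearE[OF assms(4,5)] .
  have "smooth_fun M (V \<inter> W) f"
    using smooth_fun_iff[of "V \<inter> W" f] V assms(2) by (auto intro: smooth_on_set_subset)
  then have "smooth_fun M (V \<inter> W) (\<lambda>p. X p f)"
    using assms(1,2) V(1) unfolding vector_field_def by blast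
  then show ?thesis
    unfolding smooth_near_def using V assms by blast
qed

text \<open>On a product, both iterated derivatives contain the same mixed first-order terms, which
  cancel in the difference.\<close>

lemma lie_bracket_tangent:
  assumes X: "vector_field M W X" and Y: "vector_field M W Y" and W: "openin (mtop M) W"
    and q: "q \<in> W" "q \<in> U"
  shows "lie_bracket M X Y q \<in> tangent_space M q"
proof -
  have Xq: "X q \<in> tangent_space M q" and Yq: "Y q \<in> tangent_space M q"
    using X Y q by (auto simp: vector_field_def)
  note sX = smooth_near_apply_field[OF X W q] and sY = smooth_near_apply_field[OF Y W q]
  {
    \<comment> \<open>The rules for a tangent vector \<open>v\<close> applied to the derivative of a
      function along \<open>Z\<close> are derived once and then used for both orders of
      \<open>X\<close> and \<open>Y\<close>.\<close>
    fix Z assume Z: "vector_field M W Z"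
    have Zp: "Z p \<in> tangent_space M p" if "p \<in> W" for p
      using Z that by (auto simp: vector_field_def)
    fix v assume v: "v \<in> tangent_space M q"
    note sZ = smooth_near_apply_field[OF Z W q]
    {
      fix f g assume fg: "smooth_near M q f" "smooth_near M q g"
      obtain V where V: "openin (mtop M) V" "q \<in> V" "V \<subseteq> U"
        "smooth_on_set (\<phi> ` V) (\<lambda>z. f (inv\<phi> z))" "smooth_on_set (\<phi> ` V) (\<lambda>z. g (inv\<phi> z))"
        using smooth_near2E[OF q(2) fg] .
      have near: "smooth_near M p f" "smooth_near M p g" if "p \<in> V" for p
        using smooth_near_iff[of p f] smooth_near_iff[of p g] that V by blast+
      have o: "openin (mtop M) (V \<inter> W)" "q \<in> V \<inter> W" using V W q by auto
      have "v (\<lambda>p. Z p f + Z p g) = v (\<lambda>p. Z p (\<lambda>x. f x + g x))"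
        by (rule tangent_local[OF v smooth_near_add[OF q(2) sZ[OF fg(1)] sZ[OF fg(2)]] o])
          (use near tangent_add[OF Zp] in auto)
      then have add: "v (\<lambda>p. Z p (\<lambda>x. f x + g x)) = v (\<lambda>p. Z p f) + v (\<lambda>p. Z p g)"
        using tangent_add[OF v sZ[OF fg(1)] sZ[OF fg(2)]] by simp
      have s: "smooth_near M q (\<lambda>p. f p * Z p g)" "smooth_near M q (\<lambda>p. g p * Z p f)"
        using smooth_near_mult[OF q(2)] fg sZ by auto
      have "v (\<lambda>p. f p * Z p g + g p * Z p f) = v (\<lambda>p. Z p (\<lambda>x. f x * g x))"
        by (rule tangent_local[OF v smooth_near_add[OF q(2) s] o])
          (use near tangent_mult[OF Zp] in auto)
      then have "v (\<lambda>p. Z p (\<lambda>x. f x * g x)) = v (\<lambda>p. f p * Z p g) + v (\<lambda>p. g p * Z p f)"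
        using tangent_add[OF v s] by simp
      also have "\<dots> = f q * v (\<lambda>p. Z p g) + Z q g * v f + (g q * v (\<lambda>p. Z p f) + Z q f * v g)"
        using tangent_mult[OF v fg(1) sZ[OF fg(2)]] tangent_mult[OF v fg(2) sZ[OF fg(1)]] by simp
      finally have mult: "v (\<lambda>p. Z p (\<lambda>x. f x * g x)) =
        f q * v (\<lambda>p. Z p g) + Z q g * v f + (g q * v (\<lambda>p. Z p f) + Z q f * v g)" .
      note mult add
    } note a = this
    {
      fix c f assume f: "smooth_near M q f"
      obtain V where V: "openin (mtop M) V" "q \<in> V" "V \<subseteq> U" "smooth_on_set (\<phi> ` V) (\<lambda>z. f (inv\<phi> z))"
        using smooth_nearE[OF q(2) f] .
      have near: "smooth_near M p f" if "p \<in> V" for p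
        using smooth_near_iff[of p f] that V by blast
      have o: "openin (mtop M) (V \<inter> W)" "q \<in> V \<inter> W" using V W q by auto
      have "v (\<lambda>p. c * Z p f) = v (\<lambda>p. Z p (\<lambda>x. c * f x))"
        by (rule tangent_local[OF v smooth_near_mult[OF q(2) smooth_near_const[OF q(2)] sZ[OF f]] o])
          (use near tangent_scale[OF Zp] in auto)
      then have "v (\<lambda>p. Z p (\<lambda>x. c * f x)) = c * v (\<lambda>p. Z p f)"
        using tangent_scale[OF v sZ[OF f]] by simp
    } note b = this
    {
      fix f g V' assume f: "smooth_near M q f" and V': "openin (mtop M) V'" "q \<in> V'" "\<forall>x\<in>V'. f x = g x"
      obtain V where V: "openin (mtop M) V" "q \<in> V" "V \<subseteq> U" "smooth_on_set (\<phi> ` V) (\<lambda>z. f (inv\<phi> z))"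
        using smooth_nearE[OF q(2) f] .
      have near: "smooth_near M p f" if "p \<in> V" for p
        using smooth_near_iff[of p f] that V by blast
      have o: "openin (mtop M) (V \<inter> W \<inter> V')" "q \<in> V \<inter> W \<inter> V'" using V W q V' by auto
      have "v (\<lambda>p. Z p f) = v (\<lambda>p. Z p g)"
        by (rule tangent_local[OF v sZ[OF f] o])
          (use near V' tangent_local[OF Zp] in auto)
    } note c = this
    note a b c
  } note r = this
  show ?thesis
    unfolding tangent_space_def
  proof (intro CollectI conjI allI impI)
    fix f g assume fg: "smooth_near M q f" "smooth_near M q g"
    show "lie_bracket M X Y q (\<lambda>x. f x + g x) = lie_bracket M X Y q f + lie_bracket M X Y q g"
      using fg smooth_near_add[OF q(2) fg] r(2)[OF Y Xq fg] r(2)[OF X Yq fg] by (simp add: lie_bracket_def)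
    show "lie_bracket M X Y q (\<lambda>x. f x * g x) = f q * lie_bracket M X Y q g + g q * lie_bracket M X Y q f"
      using fg smooth_near_mult[OF q(2) fg] r(1)[OF Y Xq fg] r(1)[OF X Yq fg]
      by (simp add: lie_bracket_def algebra_simps)
  next
    fix c f assume f: "smooth_near M q f"
    show "lie_bracket M X Y q (\<lambda>x. c * f x) = c * lie_bracket M X Y q f"
      using f smooth_near_mult[OF q(2) smooth_near_const[OF q(2)] f, of c] r(3)[OF Y Xq f] r(3)[OF X Yq f]
      by (simp add: lie_bracket_def right_diff_distrib)
  next
    fix f g V assume f: "smooth_near M q f" and V: "openin (mtop M) V" "q \<in> V" "\<forall>x\<in>V. f x = g x"
    show "lie_bracket M X Y q f = lie_bracket M X Y q g"
      using f smooth_near_cong[OF q(2) f V(1,2)] V(3) r(4)[OF Y Xq f V] r(4)[OF X Yq f V]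
      by (simp add: lie_bracket_def)
  qed (simp add: lie_bracket_def)
qed

lemma vector_field_const: "w \<in> E \<Longrightarrow> vector_field M U (\<lambda>q. tvec q w)"
  by (rule vector_field_tvec[OF open_dom order_refl smooth_on_set_const])

text \<open>The constant field maps coordinate functions to constants, so the second term of the
  bracket vanishes on them and the derivative of the components of \<open>Z\<close> remains.\<close>

lemma coords_lie_bracket_const:
  assumes w: "w \<in> E" and W: "openin (mtop M) W" "W \<subseteq> U" and Z: "vector_field M W Z" and q: "q \<in> W"
  shows "coords (lie_bracket M (\<lambda>q. tvec q w) Z q) = dirder E (\<lambda>z. coords (Z (inv\<phi> z))) (\<phi> q) w"
proof (rule inner_ext)
  fix a
  have qU: "q \<in> U" using q W by auto
  let ?X = "\<lambda>q. tvec q w" and ?f = "\<lambda>x. \<phi> x \<bullet> a"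
  have X: "vector_field M W ?X" using vector_field_const[OF w] W(2) by (rule vector_field_subset)
  have Zq: "Z p \<in> tangent_space M p" if "p \<in> W" for p using Z that by (simp add: vector_field_def)
  have sf: "smooth_near M q ?f" by (rule smooth_near_chart_inner[OF qU])
  note oW = open_chart_image[OF W]
  note sZ = vector_field_coords_smooth[OF W Z]
  have "Z q (\<lambda>p. w \<bullet> a) = Z q (\<lambda>p. ?X p ?f)"
    by (rule tangent_local[OF Zq[OF q] smooth_near_const[OF qU] open_dom qU])
      (use w in \<open>simp add: coords_inner[symmetric] tvec_tangent coords_tvec\<close>)
  then have 1: "Z q (\<lambda>p. ?X p ?f) = 0" using tangent_const[OF qU Zq[OF q]] by simp
  have "dirder E (\<lambda>z. coords (Z (inv\<phi> z)) \<bullet> a) (\<phi> q) w = dirder E (\<lambda>z. Z (inv\<phi> z) ?f) (\<phi> q) w"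
    by (rule dirder_cong[OF model_subspace oW _ smooth_on_set_linear_compose[OF bounded_linear_inner_left sZ]])
      (use q W Zq in \<open>auto simp: coords_inner subset_iff\<close>)
  then have 2: "?X q (\<lambda>p. Z p ?f) = dirder E (\<lambda>z. coords (Z (inv\<phi> z))) (\<phi> q) w \<bullet> a"
    using smooth_near_apply_field[OF Z W(1) q qU sf] q
    by (simp add: tvec_def dirder_linear_compose[OF model_subspace oW bounded_linear_inner_left sZ])
  show "coords (lie_bracket M ?X Z q) \<bullet> a = dirder E (\<lambda>z. coords (Z (inv\<phi> z))) (\<phi> q) w \<bullet> a"
    unfolding coords_inner[OF qU lie_bracket_tangent[OF X Z W(1) q qU]]
    using sf 1 2 by (simp add: lie_bracket_def)
qed

text \<open>For any extension \<open>Z\<close> of \<open>v\<close> the product rule splits the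
  derivative of the pairing of \<open>\<beta>\<close> and \<open>Z\<close> in two, and the term with
  the derivative of \<open>Z\<close> is \<open>\<beta>\<close> of the bracket. What is left depends
  on \<open>v\<close> alone, so the description operator is well defined.\<close>

lemma lie_derivative_const:
  assumes w: "w \<in> E" and \<beta>: "one_form M U \<beta>" and q: "q \<in> U" and v: "v \<in> tangent_space M q"
  shows "lie_derivative M (\<lambda>q. tvec q w) \<beta> q v
    = dirder E (\<lambda>z. ccoords (inv\<phi> z) (\<beta> (inv\<phi> z))) (\<phi> q) w \<bullet> coords v" (is "_ = ?r")
proof -
  let ?X = "\<lambda>q. tvec q w" and ?b = "\<lambda>z. ccoords (inv\<phi> z) (\<beta> (inv\<phi> z))"
  have \<beta>p: "\<beta> p \<in> cotangent_space M p" if "p \<in> U" for p using \<beta> that by (simp add: one_form_def)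
  have sb: "smooth_on_set (\<phi> ` U) ?b" using \<beta> one_form_iff[OF open_dom order_refl] by blast
  have val: "?X q (\<lambda>q. \<beta> q (Z q)) - \<beta> q (lie_bracket M ?X Z q) = ?r"
    if W': "openin (mtop M) W'" "q \<in> W'" "vector_field M W' Z" "Z q = v" for W' Z
  proof -
    define W where "W = W' \<inter> U"
    have W: "openin (mtop M) W" "W \<subseteq> U" "q \<in> W" and Z: "vector_field M W Z"
      using W' open_dom q by (auto simp: W_def intro: vector_field_subset)
    have Zp: "Z p \<in> tangent_space M p" if "p \<in> W" for p using Z that by (simp add: vector_field_def)
    note oW = open_chart_image[OF W(1,2)]
    note sZ = vector_field_coords_smooth[OF W(1,2) Z]
    have sbW: "smooth_on_set (\<phi> ` W) ?b" using sb by (rule smooth_on_set_subset) (use W in auto)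
    have X: "vector_field M W ?X" using vector_field_const[OF w] W(2) by (rule vector_field_subset)
    let ?g = "\<lambda>z. ?b z \<bullet> coords (Z (inv\<phi> z))"
    have sg: "smooth_on_set (\<phi> ` W) ?g"
      by (rule smooth_on_set_bilinear[OF bounded_bilinear_inner sbW sZ])
    have eq: "?g z = \<beta> (inv\<phi> z) (Z (inv\<phi> z))" if "z \<in> \<phi> ` W" for z
      using that W Zp by (auto simp: cotangent_apply[OF _ \<beta>p] subset_iff)
    have sg': "smooth_on_set (\<phi> ` W) (\<lambda>z. \<beta> (inv\<phi> z) (Z (inv\<phi> z)))"
      by (rule smooth_on_set_cong[THEN iffD1, OF eq sg])
    have near: "smooth_near M q (\<lambda>q. \<beta> q (Z q))"
      using sg' W by (auto simp: smooth_near_iff[OF q])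
    have "?X q (\<lambda>q. \<beta> q (Z q)) = dirder E ?g (\<phi> q) w"
      using near dirder_cong[OF model_subspace oW eq sg, of "\<phi> q" w] W(3) by (simp add: tvec_def)
    also have "\<dots> = ?b (\<phi> q) \<bullet> dirder E (\<lambda>z. coords (Z (inv\<phi> z))) (\<phi> q) w + dirder E ?b (\<phi> q) w \<bullet> coords (Z (inv\<phi> (\<phi> q)))"
      by (rule dirder_bilinear[OF model_subspace oW bounded_bilinear_inner sbW sZ]) (use W in auto)
    finally show ?thesis
      using cotangent_apply[OF q \<beta>p[OF q] lie_bracket_tangent[OF X Z W(1,3) q]]
        coords_lie_bracket_const[OF w W(1,2) Z W(3)] q that(4) by simp
  qed
  have "(THE r. \<exists>W Z. openin (mtop M) W \<and> q \<in> W \<and> vector_field M W Z \<and> Z q = v \<and>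
      r = ?X q (\<lambda>q. \<beta> q (Z q)) - \<beta> q (lie_bracket M ?X Z q)) = ?r"
  proof (rule the_equality)
    have "vector_field M U (\<lambda>p. tvec p (coords v))" "tvec q (coords v) = v"
      using vector_field_const[OF coords_in_model[OF q v]] tvec_coords[OF q v] by auto
    then show "\<exists>W Z. openin (mtop M) W \<and> q \<in> W \<and> vector_field M W Z \<and> Z q = v \<and>
      ?r = ?X q (\<lambda>q. \<beta> q (Z q)) - \<beta> q (lie_bracket M ?X Z q)"
      using val[OF open_dom q, of "\<lambda>p. tvec p (coords v)"] open_dom q
      by (intro exI[of _ U] exI[of _ "\<lambda>p. tvec p (coords v)"]) auto
  qed (use val in blast)
  then show ?thesis using v by (simp add: lie_derivative_def)
qed

text \<open>The description operator has to be evaluated even for the zero form: constant coordinate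
  fields supply extensions of \<open>u\<close> and \<open>v\<close>, and derivations annihilate
  constants.\<close>

lemma exterior_derivative_zero:
  assumes q: "q \<in> U"
  shows "exterior_derivative M (\<lambda>q v. 0) q u v = 0"
proof (cases "u \<in> tangent_space M q \<and> v \<in> tangent_space M q")
  case True
  have "(THE r. \<exists>W Y Z. openin (mtop M) W \<and> q \<in> W \<and> vector_field M W Y \<and> vector_field M W Z \<and>
          Y q = u \<and> Z q = v \<and> r = Y q (\<lambda>q. 0) - Z q (\<lambda>q. 0) - (0::real)) = 0"
  proof (rule the_equality)
    have "vector_field M U (\<lambda>p. tvec p (coords u))" "tvec q (coords u) = u"
      "vector_field M U (\<lambda>p. tvec p (coords v))" "tvec q (coords v) = v"
      using vector_field_const coords_in_model[OF q] tvec_coords[OF q] True by auto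
    then show "\<exists>W Y Z. openin (mtop M) W \<and> q \<in> W \<and> vector_field M W Y \<and> vector_field M W Z \<and>
          Y q = u \<and> Z q = v \<and> (0::real) = Y q (\<lambda>q. 0) - Z q (\<lambda>q. 0) - 0"
      using open_dom q tangent_const[OF q, of u 0] tangent_const[OF q, of v 0] True
      by - (rule exI[of _ U], rule exI[of _ "\<lambda>p. tvec p (coords u)"], rule exI[of _ "\<lambda>p. tvec p (coords v)"], simp)
  qed (use tangent_const[OF q, of u 0] tangent_const[OF q, of v 0] True in auto)
  then show ?thesis using True by (simp add: exterior_derivative_def)
qed (auto simp: exterior_derivative_def)

lemma cvec_0: "cvec q 0 = (\<lambda>v. 0)"
  by (simp add: cvec_def fun_eq_iff)

lemma tvec_0: "q \<in> U \<Longrightarrow> tvec q 0 = (\<lambda>f. 0)"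
  using tvec_scale[of q 0 0] by simp

section \<open>The fibres of a Dirac structure in coordinates\<close>

definition local_fibre :: "('a \<Rightarrow> ('a vec \<times> 'a covec) set) \<Rightarrow> 'e \<Rightarrow> ('e \<times> 'e) set" where
  "local_fibre D x = {(v, a). v \<in> E \<and> a \<in> E \<and> (tvec (inv\<phi> x) v, cvec (inv\<phi> x) a) \<in> D (inv\<phi> x)}"

lemma local_section:
  assumes "bundle_section M D W X \<alpha>" "W \<subseteq> U"
  shows "smooth_on_set (\<phi> ` W) (\<lambda>z. coords (X (inv\<phi> z)))"
    and "smooth_on_set (\<phi> ` W) (\<lambda>z. ccoords (inv\<phi> z) (\<alpha> (inv\<phi> z)))"
    and "z \<in> \<phi> ` W \<Longrightarrow> (coords (X (inv\<phi> z)), ccoords (inv\<phi> z) (\<alpha> (inv\<phi> z))) \<in> local_fibre D z"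
proof -
  have W: "openin (mtop M) W" and X: "vector_field M W X" and \<alpha>: "one_form M W \<alpha>"
    and D: "\<And>p. p \<in> W \<Longrightarrow> (X p, \<alpha> p) \<in> D p"
    using assms by (auto simp: bundle_section_def)
  show "smooth_on_set (\<phi> ` W) (\<lambda>z. coords (X (inv\<phi> z)))"
    using vector_field_iff[OF W assms(2)] X by blast
  show "smooth_on_set (\<phi> ` W) (\<lambda>z. ccoords (inv\<phi> z) (\<alpha> (inv\<phi> z)))"
    using one_form_iff[OF W assms(2)] \<alpha> by blast
  assume "z \<in> \<phi> ` W"
  then obtain p where p: "p \<in> W" "p \<in> U" "z = \<phi> p" using assms(2) by auto
  have "X p \<in> tangent_space M p" "\<alpha> p \<in> cotangent_space M p"
    using X \<alpha> p by (auto simp: vector_field_def one_form_def)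
  then show "(coords (X (inv\<phi> z)), ccoords (inv\<phi> z) (\<alpha> (inv\<phi> z))) \<in> local_fibre D z"
    using D[OF p(1)] p by (simp add: local_fibre_def coords_in_model ccoords_in_model tvec_coords cvec_ccoords)
qed

lemma section_of_local:
  assumes W: "openin (mtop M) W" "W \<subseteq> U"
    and w: "smooth_on_set (\<phi> ` W) w" and a: "smooth_on_set (\<phi> ` W) a"
    and D: "\<And>z. z \<in> \<phi> ` W \<Longrightarrow> (w z, a z) \<in> local_fibre D z"
  shows "bundle_section M D W (\<lambda>q. tvec q (w (\<phi> q))) (\<lambda>q. cvec q (a (\<phi> q)))"
  unfolding bundle_section_def
proof (intro conjI W ballI)
  show "vector_field M W (\<lambda>q. tvec q (w (\<phi> q)))"
    by (rule vector_field_tvec[OF W w]) (use D in \<open>auto simp: local_fibre_def\<close>)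
  show "one_form M W (\<lambda>q. cvec q (a (\<phi> q)))"
    by (rule one_form_cvec[OF W a]) (use D in \<open>auto simp: local_fibre_def\<close>)
  show "(tvec p (w (\<phi> p)), cvec p (a (\<phi> p))) \<in> D p" if "p \<in> W" for p
    using D[of "\<phi> p"] that W(2) by (auto simp: local_fibre_def subset_iff)
qed

text \<open>Coordinates turn the pairing into inner products, so membership in a fibre becomes a
  system of linear equations, which is what transport along a line can propagate.\<close>

lemma local_fibre_orthogonal:
  assumes D: "dirac_structure M D" and x: "x \<in> \<phi> ` U" and v: "v \<in> E" "a \<in> E"
  shows "(v, a) \<in> local_fibre D x \<longleftrightarrow> (\<forall>(v', a')\<in>local_fibre D x. a' \<bullet> v + a \<bullet> v' = 0)"
proof -
  define q where "q = inv\<phi> x"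
  have q: "q \<in> U" "x = \<phi> q" using x by (auto simp: q_def)
  have Dq: "D q = orthogonal_fibre M q (D q)"
    using D q U_sub by (auto simp: dirac_structure_def)
  have "(v, a) \<in> local_fibre D x \<longleftrightarrow> (tvec q v, cvec q a) \<in> orthogonal_fibre M q (D q)"
    using v q Dq by (simp add: local_fibre_def q_def[symmetric])
  also have "\<dots> \<longleftrightarrow> (\<forall>(X, \<beta>)\<in>D q. \<beta> (tvec q v) + cvec q a X = 0)"
    using tvec_tangent[OF q(1)] cvec_cotangent[OF q(1)] by (simp add: orthogonal_fibre_def)
  also have "\<dots> \<longleftrightarrow> (\<forall>(v', a')\<in>local_fibre D x. a' \<bullet> v + a \<bullet> v' = 0)"
  proof (intro iffI ballI; clarify)
    fix v' a' assume h: "\<forall>(X, \<beta>)\<in>D q. \<beta> (tvec q v) + cvec q a X = 0" and "(v', a') \<in> local_fibre D x"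
    then have "(tvec q v', cvec q a') \<in> D q" "v' \<in> E" "a' \<in> E"
      by (auto simp: local_fibre_def q_def[symmetric])
    then show "a' \<bullet> v + a \<bullet> v' = 0"
      using h v q by (auto simp: cvec_tvec)
  next
    fix X \<beta> assume h: "\<forall>(v', a')\<in>local_fibre D x. a' \<bullet> v + a \<bullet> v' = 0" and X: "(X, \<beta>) \<in> D q"
    then have t: "X \<in> tangent_space M q" "\<beta> \<in> cotangent_space M q"
      using Dq by (auto simp: orthogonal_fibre_def)
    then have "(coords X, ccoords q \<beta>) \<in> local_fibre D x"
      using X q by (simp add: local_fibre_def q_def[symmetric] coords_in_model ccoords_in_model tvec_coords cvec_ccoords)
    then show "\<beta> (tvec q v) + cvec q a X = 0"
      using h t q v cotangent_apply[OF q(1) t(2) tvec_tangent[OF q(1)], of v]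
      by (auto simp: cvec_def coords_tvec)
  qed
  finally show ?thesis .
qed

lemma local_fibre_model: "(v, a) \<in> local_fibre D x \<Longrightarrow> v \<in> E \<and> a \<in> E"
  by (simp add: local_fibre_def)

text \<open>Linear combinations preserve the orthogonality equations that characterise the
  fibre.\<close>

lemma subspace_local_fibre:
  assumes D: "dirac_structure M D" and x: "x \<in> \<phi> ` U"
  shows "subspace (local_fibre D x)"
  unfolding subspace_def
proof (intro conjI ballI allI)
  show "0 \<in> local_fibre D x"
    using local_fibre_orthogonal[OF assms, of 0 0] subspace_0[OF model_subspace] by (simp add: zero_prod_def)
next
  note o = local_fibre_orthogonal[OF assms]
  fix y z assume y: "y \<in> local_fibre D x" and z: "z \<in> local_fibre D x"
  obtain v a v' a' where yz: "y = (v, a)" "z = (v', a')" by fastforce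
  have m: "v \<in> E" "a \<in> E" "v' \<in> E" "a' \<in> E" using y z yz local_fibre_model by blast+
  have "(v + v', a + a') \<in> local_fibre D x"
  proof (rule o[OF subspace_add[OF model_subspace m(1,3)] subspace_add[OF model_subspace m(2,4)], THEN iffD2], clarify)
    fix u b assume u: "(u, b) \<in> local_fibre D x"
    have "b \<bullet> v + a \<bullet> u = 0" "b \<bullet> v' + a' \<bullet> u = 0"
      using y z u unfolding yz o[OF m(1,2)] o[OF m(3,4)] by blast+
    then show "b \<bullet> (v + v') + (a + a') \<bullet> u = 0"
      by (simp add: inner_add_left inner_add_right)
  qed
  then show "y + z \<in> local_fibre D x" by (simp add: yz)
next
  note o = local_fibre_orthogonal[OF assms]
  fix c :: real and y assume y: "y \<in> local_fibre D x"
  obtain v a where yz: "y = (v, a)" by fastforce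
  have m: "v \<in> E" "a \<in> E" using y yz local_fibre_model by blast+
  have "(c *\<^sub>R v, c *\<^sub>R a) \<in> local_fibre D x"
  proof (rule o[OF subspace_scale[OF model_subspace m(1)] subspace_scale[OF model_subspace m(2)], THEN iffD2], clarify)
    fix u b assume u: "(u, b) \<in> local_fibre D x"
    have "b \<bullet> v + a \<bullet> u = 0"
      using y u unfolding yz o[OF m] by blast
    then show "b \<bullet> (c *\<^sub>R v) + (c *\<^sub>R a) \<bullet> u = 0"
      by (simp flip: distrib_left)
  qed
  then show "c *\<^sub>R y \<in> local_fibre D x" by (simp add: yz)
qed

text \<open>Closedness makes the Lie derivative along a constant section of \<open>D\<close> preserve \<open>\<Gamma>(D)\<close>, and
  in coordinates this Lie derivative is componentwise differentiation.\<close>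

lemma local_fibre_derivative:
  assumes D: "closed_dirac M D" and w: "\<And>z. z \<in> \<phi> ` U \<Longrightarrow> (w, 0) \<in> local_fibre D z"
    and Y: "bundle_section M D U Y \<beta>" and x: "x \<in> \<phi> ` U"
  shows "(dirder E (\<lambda>z. coords (Y (inv\<phi> z))) x w,
      dirder E (\<lambda>z. ccoords (inv\<phi> z) (\<beta> (inv\<phi> z))) x w) \<in> local_fibre D x" (is "(?v, ?a) \<in> _")
proof -
  define q where "q = inv\<phi> x"
  have q: "q \<in> U" "x = \<phi> q" using x by (auto simp: q_def)
  have wE: "w \<in> E" using w[OF x] local_fibre_model by blast
  have vY: "vector_field M U Y" and \<beta>: "one_form M U \<beta>" using Y by (auto simp: bundle_section_def)
  have "bundle_section M D U (\<lambda>q. tvec q w) (\<lambda>q. cvec q 0)"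
    by (rule section_of_local[OF open_dom order_refl smooth_on_set_const smooth_on_set_const w])
  then have "bundle_section M D U (\<lambda>q. tvec q w) (\<lambda>q v. 0)" by (simp add: cvec_0)
  then have "bundle_section M D U (lie_bracket M (\<lambda>q. tvec q w) Y)
      (\<lambda>p v. lie_derivative M (\<lambda>q. tvec q w) \<beta> p v - exterior_derivative M (\<lambda>q v. 0) p (Y p) v)"
    using D[unfolded closed_dirac_def, THEN conjunct2, rule_format, OF _ Y] by simp
  from local_section(3)[OF this order_refl x]
  have in_fibre: "(coords (lie_bracket M (\<lambda>q. tvec q w) Y q),
      ccoords q (\<lambda>v. lie_derivative M (\<lambda>q. tvec q w) \<beta> q v - exterior_derivative M (\<lambda>q v. 0) q (Y q) v)) \<in> local_fibre D x"
    by (simp add: q_def)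
  \<comment> \<open>\<open>ccoords\<close> evaluates on projected basis vectors and so returns the
    projection of \<open>?a\<close>; this is \<open>?a\<close> itself because the components of
    \<open>\<beta>\<close> take values in \<open>E\<close>.\<close>
  have "ccoords q (\<lambda>v. lie_derivative M (\<lambda>q. tvec q w) \<beta> q v - exterior_derivative M (\<lambda>q v. 0) q (Y q) v)
    = (\<Sum>b\<in>Basis. (?a \<bullet> orth_proj E b) *\<^sub>R b)"
    by (subst ccoords_def) (simp add: exterior_derivative_zero[OF q(1)] lie_derivative_const[OF wE \<beta> q(1) tvec_tangent[OF q(1)]]
        coords_tvec[OF q(1) orth_proj_in[OF model_subspace]] q(2)[symmetric])
  also have "\<dots> = orth_proj E ?a"
    by (subst orth_proj_adjoint[OF model_subspace, symmetric]) (rule euclidean_representation)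
  also have "\<dots> = ?a"
  proof -
    let ?b = "\<lambda>z. ccoords (inv\<phi> z) (\<beta> (inv\<phi> z))"
    have sb: "smooth_on_set (\<phi> ` U) ?b" using local_section(2)[OF Y] by simp
    have "orth_proj E ?a = dirder E (\<lambda>z. orth_proj E (?b z)) x w"
      using dirder_linear_compose[OF model_subspace open_image bounded_linear_orth_proj[OF model_subspace] sb x] by simp
    also have "\<dots> = ?a"
    proof (rule dirder_cong[OF model_subspace open_image _ sb x, symmetric])
      show "?b z = orth_proj E (?b z)" if "z \<in> \<phi> ` U" for z
        using local_section(3)[OF Y order_refl that] local_fibre_model orth_proj_id[OF model_subspace] by metis
    qed
    finally show ?thesis .
  qed
  finally show ?thesis
    using in_fibre coords_lie_bracket_const[OF wE open_dom order_refl vY q(1)] q(2) by simp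
qed

end

section \<open>Straightening sections of the form \<open>(X, 0)\<close>\<close>

text \<open>The frame condition of \<open>subbundle\<close> on a given set. It passes to smaller
  open sets, so one frame around \<open>p\<close> serves every chart constructed inside its
  domain.\<close>

definition frame_on :: "('a, 'e::euclidean_space) mfd \<Rightarrow> 'a pontryagin_family \<Rightarrow> 'a set \<Rightarrow> bool" where
  "frame_on M D U \<longleftrightarrow> (\<exists>(r::nat) X \<alpha>. (\<forall>i<r. bundle_section M D U (X i) (\<alpha> i)) \<and>
     (\<forall>q\<in>U.
        D q = {(\<lambda>f. \<Sum>i<r. c i * X i q f, \<lambda>v. \<Sum>i<r. c i * \<alpha> i q v) | c :: nat \<Rightarrow> real. True} \<and>
        (\<forall>c :: nat \<Rightarrow> real.
           (\<lambda>f. \<Sum>i<r. c i * X i q f) = (\<lambda>f. 0) \<and>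
           (\<lambda>v. \<Sum>i<r. c i * \<alpha> i q v) = (\<lambda>v. 0) \<longrightarrow> (\<forall>i<r. c i = 0))))"

lemma frame_on_subset:
  assumes "frame_on M D U" "openin (mtop M) V" "V \<subseteq> U"
  shows "frame_on M D V"
proof -
  obtain r X \<alpha> where 1: "\<forall>i<(r::nat). bundle_section M D U (X i) (\<alpha> i)"
    and 2: "\<forall>q\<in>U. D q = {(\<lambda>f. \<Sum>i<r. c i * X i q f, \<lambda>v. \<Sum>i<r. c i * \<alpha> i q v) | c :: nat \<Rightarrow> real. True} \<and>
        (\<forall>c :: nat \<Rightarrow> real. (\<lambda>f. \<Sum>i<r. c i * X i q f) = (\<lambda>f. 0) \<and>
           (\<lambda>v. \<Sum>i<r. c i * \<alpha> i q v) = (\<lambda>v. 0) \<longrightarrow> (\<forall>i<r. c i = 0))"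
    using assms(1) unfolding frame_on_def by (elim exE conjE) (rule that)
  have 3: "\<forall>i<r. bundle_section M D V (X i) (\<alpha> i)"
    using 1 bundle_section_subset[OF _ assms(2,3)] by simp
  show ?thesis
    unfolding frame_on_def
    by (rule exI[of _ r], rule exI[of _ X], rule exI[of _ \<alpha>], rule conjI[OF 3])
      (rule ballI, rule 2[rule_format], rule subsetD[OF assms(3)])
qed

lemma smooth_on_set_continuous:
  assumes "smooth_on_set S f" shows "continuous_on S f"
  unfolding continuous_on_eq_continuous_within
proof
  fix x assume x: "x \<in> S"
  obtain W g where W: "open W" "x \<in> W" "\<And>k. Ck_on k g W" "\<forall>y\<in>W \<inter> S. g y = f y"
    using assms x by (rule smooth_on_setE) (rule that)
  have "continuous_on (W \<inter> S) g"
    using Ck_on_continuous[OF W(3)] by (rule continuous_on_subset) auto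
  then have "continuous_on (W \<inter> S) f" by (rule continuous_on_eq) (use W(4) in auto)
  then have "continuous (at x within W \<inter> S) f"
    using W(2) x by (simp add: continuous_on_eq_continuous_within)
  moreover have "at x within W \<inter> S = at x within S"
    by (rule at_within_nhd[OF W(2,1)]) auto
  ultimately show "continuous (at x within S) f" by simp
qed

context mchart
begin

lemma tvec_sum:
  assumes "q \<in> U"
  shows "tvec q (\<Sum>i\<in>I. c i *\<^sub>R w i) = (\<lambda>f. \<Sum>i\<in>I. c i * tvec q (w i) f)"
  by (induction I rule: infinite_finite_induct) (simp_all add: tvec_0 tvec_add tvec_scale assms)

lemma cvec_sum: "cvec q (\<Sum>i\<in>I. c i *\<^sub>R a i) = (\<lambda>v. \<Sum>i\<in>I. c i * cvec q (a i) v)"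
  by (auto simp: cvec_def fun_eq_iff inner_sum_left)

lemma local_frame:
  assumes sec: "\<forall>i<r. bundle_section M D U (X i) (\<alpha> i)"
    and frame: "\<forall>q\<in>U. D q = {(\<lambda>f. \<Sum>i<r. c i * X i q f, \<lambda>v. \<Sum>i<r. c i * \<alpha> i q v) | c :: nat \<Rightarrow> real. True} \<and>
        (\<forall>c :: nat \<Rightarrow> real. (\<lambda>f. \<Sum>i<r. c i * X i q f) = (\<lambda>f. 0) \<and>
           (\<lambda>v. \<Sum>i<r. c i * \<alpha> i q v) = (\<lambda>v. 0) \<longrightarrow> (\<forall>i<r. c i = 0))"
    and x: "x \<in> \<phi> ` U"
  shows "(v, a) \<in> local_fibre D x \<Longrightarrow>
      \<exists>c. v = (\<Sum>i<r. c i *\<^sub>R coords (X i (inv\<phi> x))) \<and> a = (\<Sum>i<r. c i *\<^sub>R ccoords (inv\<phi> x) (\<alpha> i (inv\<phi> x)))"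
    and "(\<Sum>i<r. c i *\<^sub>R coords (X i (inv\<phi> x))) = 0 \<Longrightarrow>
      (\<Sum>i<r. c i *\<^sub>R ccoords (inv\<phi> x) (\<alpha> i (inv\<phi> x))) = 0 \<Longrightarrow> \<forall>i<r. c i = 0"
proof -
  define q where "q = inv\<phi> x"
  have q: "q \<in> U" "x = \<phi> q" using x by (auto simp: q_def)
  note fr = frame[rule_format, OF q(1)]
  assume "(v, a) \<in> local_fibre D x"
  then have va: "v \<in> E" "a \<in> E" and "(tvec q v, cvec q a) \<in> D q" by (auto simp: local_fibre_def q_def[symmetric])
  then obtain c where c: "tvec q v = (\<lambda>f. \<Sum>i<r. c i * X i q f)" "cvec q a = (\<lambda>v. \<Sum>i<r. c i * \<alpha> i q v)"
    using fr[THEN conjunct1] by auto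
  have "v = (\<Sum>i<r. c i *\<^sub>R coords (X i q))" "a = (\<Sum>i<r. c i *\<^sub>R ccoords q (\<alpha> i q))"
    using coords_tvec[OF q(1) va(1)] ccoords_cvec[OF q(1) va(2)] by (simp_all add: c coords_sum ccoords_sum)
  then show "\<exists>c. v = (\<Sum>i<r. c i *\<^sub>R coords (X i (inv\<phi> x))) \<and> a = (\<Sum>i<r. c i *\<^sub>R ccoords (inv\<phi> x) (\<alpha> i (inv\<phi> x)))"
    by (auto simp: q_def)
next
  define q where "q = inv\<phi> x"
  have q: "q \<in> U" "x = \<phi> q" using x by (auto simp: q_def)
  note fr = frame[rule_format, OF q(1)]
  have t: "X i q \<in> tangent_space M q" "\<alpha> i q \<in> cotangent_space M q" if "i < r" for i
    using sec[rule_format, OF that] q by (auto simp: bundle_section_def vector_field_def one_form_def)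
  assume 0: "(\<Sum>i<r. c i *\<^sub>R coords (X i (inv\<phi> x))) = 0"
    "(\<Sum>i<r. c i *\<^sub>R ccoords (inv\<phi> x) (\<alpha> i (inv\<phi> x))) = 0"
  have "(\<lambda>f. \<Sum>i<r. c i * X i q f) = (\<lambda>f. \<Sum>i<r. c i * tvec q (coords (X i q)) f)"
    by (rule ext, rule sum.cong) (auto simp: tvec_coords[OF q(1) t(1)])
  also have "\<dots> = tvec q 0" using 0 by (simp add: tvec_sum[OF q(1), symmetric] q_def[symmetric])
  finally have 1: "(\<lambda>f. \<Sum>i<r. c i * X i q f) = (\<lambda>f. 0)" by (simp add: tvec_0[OF q(1)])
  have "(\<lambda>v. \<Sum>i<r. c i * \<alpha> i q v) = (\<lambda>v. \<Sum>i<r. c i * cvec q (ccoords q (\<alpha> i q)) v)"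
    by (rule ext, rule sum.cong) (auto simp: cvec_ccoords[OF q(1) t(2)])
  also have "\<dots> = cvec q 0" using 0 by (simp add: cvec_sum[symmetric] q_def[symmetric])
  finally have 2: "(\<lambda>v. \<Sum>i<r. c i * \<alpha> i q v) = (\<lambda>v. 0)" by (simp add: cvec_0)
  show "\<forall>i<r. c i = 0" using fr[THEN conjunct2] 1 2 by blast
qed

text \<open>\<open>w\<close> is a constant section on the whole chart, so the derivatives of a frame
  along \<open>w\<close> stay in the fibres; convexity keeps the segment from \<open>x\<close> to
  \<open>x + w\<close> in the image.\<close>

lemma local_fibre_translate_subset:
  assumes D: "closed_dirac M D" and "frame_on M D U" and conv: "convex (\<phi> ` U)"
    and w: "\<And>z. z \<in> \<phi> ` U \<Longrightarrow> (w, 0) \<in> local_fibre D z"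
    and x: "x \<in> \<phi> ` U" "x + w \<in> \<phi> ` U"
  shows "local_fibre D x \<subseteq> local_fibre D (x + w)"
proof
  fix \<eta> assume "\<eta> \<in> local_fibre D x"
  then obtain v a where \<eta>: "\<eta> = (v, a)" "(v, a) \<in> local_fibre D x" by (metis surj_pair)
  have va: "v \<in> E" "a \<in> E" using local_fibre_model[OF \<eta>(2)] by auto
  have wE: "w \<in> E" using w[OF x(1)] local_fibre_model by blast
  have dir: "dirac_structure M D" using D by (simp add: closed_dirac_def)
  obtain r X \<alpha> where sec: "\<forall>i<(r::nat). bundle_section M D U (X i) (\<alpha> i)"
    and frame: "\<forall>q\<in>U. D q = {(\<lambda>f. \<Sum>i<r. c i * X i q f, \<lambda>v. \<Sum>i<r. c i * \<alpha> i q v) | c :: nat \<Rightarrow> real. True} \<and>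
        (\<forall>c :: nat \<Rightarrow> real. (\<lambda>f. \<Sum>i<r. c i * X i q f) = (\<lambda>f. 0) \<and>
           (\<lambda>v. \<Sum>i<r. c i * \<alpha> i q v) = (\<lambda>v. 0) \<longrightarrow> (\<forall>i<r. c i = 0))"
    using assms(2) unfolding frame_on_def by (elim exE conjE) (rule that)
  note sec' = sec[rule_format]
  let ?Y = "\<lambda>i z. coords (X i (inv\<phi> z))" and ?b = "\<lambda>i z. ccoords (inv\<phi> z) (\<alpha> i (inv\<phi> z))"
  have sY: "smooth_on_set (\<phi> ` U) (?Y i)" and sb: "smooth_on_set (\<phi> ` U) (?b i)" if "i < r" for i
    using local_section(1,2)[OF sec'[OF that]] by auto
  have seg: "x + s *\<^sub>R w \<in> \<phi> ` U" if "s \<in> {0..1}" for s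
  proof -
    have "(1 - s) *\<^sub>R x + s *\<^sub>R (x + w) \<in> \<phi> ` U"
      by (rule convexD_alt[OF conv x]) (use that in auto)
    then show ?thesis by (simp add: algebra_simps)
  qed
  have xE: "x \<in> E" using x chart_in_model by auto
  have d: "((\<lambda>s. f (x + s *\<^sub>R w)) has_vector_derivative dirder E f (x + s *\<^sub>R w) w) (at s)"
    if f: "smooth_on_set (\<phi> ` U) f" and s: "s \<in> {0..1}" for f :: "'e \<Rightarrow> 'e" and s
  proof -
    have "((\<lambda>s. x + s *\<^sub>R w) has_vector_derivative w) (at s)"
      by (auto intro!: derivative_eq_intros)
    then have "(((\<lambda>y. f (orth_proj E y)) \<circ> (\<lambda>s. x + s *\<^sub>R w)) has_vector_derivative dirder E f (x + s *\<^sub>R w) w) (at s)"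
      by (rule vector_derivative_diff_chain_within)
        (rule has_derivative_at_withinI, rule has_derivative_dirder[OF model_subspace open_image f seg[OF s]])
    moreover have "orth_proj E (x + s *\<^sub>R w) = x + s *\<^sub>R w" for s
      by (intro orth_proj_id model_subspace subspace_add subspace_scale xE wE)
    ultimately show ?thesis by (simp add: o_def)
  qed
  have cseg: "continuous_on {0..1} (\<lambda>s. dirder E f (x + s *\<^sub>R w) w)"
    if f: "smooth_on_set (\<phi> ` U) f" for f :: "'e \<Rightarrow> 'e"
    by (rule continuous_on_compose2[OF smooth_on_set_continuous[OF smooth_on_set_dirder[OF model_subspace open_image f]]])
      (use seg in \<open>auto intro!: continuous_intros\<close>)
  \<comment> \<open>Covector components come first, so that the Euclidean inner product of
    \<open>(v, a)\<close> with a frame element is the pairing of \<open>D\<close>.\<close>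
  let ?e = "\<lambda>i s. (?b i (x + s *\<^sub>R w), ?Y i (x + s *\<^sub>R w))"
  let ?e' = "\<lambda>i s. (dirder E (?b i) (x + s *\<^sub>R w) w, dirder E (?Y i) (x + s *\<^sub>R w) w)"
  have van: "\<eta> \<bullet> ?e i 1 = 0" if "i < r" for i
  proof (rule annihilator_transport[where e = ?e and e' = ?e' and r = r])
    fix i s assume i: "i < r" and s: "s \<in> {0..1::real}"
    show "(?e i has_vector_derivative ?e' i s) (at s)"
      by (intro has_vector_derivative_Pair d sY sb i s)
    have "(dirder E (?Y i) (x + s *\<^sub>R w) w, dirder E (?b i) (x + s *\<^sub>R w) w) \<in> local_fibre D (x + s *\<^sub>R w)"
      by (rule local_fibre_derivative[OF D w sec'[OF i] seg[OF s]])
    then obtain c where "dirder E (?Y i) (x + s *\<^sub>R w) w = (\<Sum>j<r. c j *\<^sub>R ?Y j (x + s *\<^sub>R w))"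
      "dirder E (?b i) (x + s *\<^sub>R w) w = (\<Sum>j<r. c j *\<^sub>R ?b j (x + s *\<^sub>R w))"
      using local_frame(1)[OF sec frame seg[OF s]] by blast
    then show "\<exists>c. ?e' i s = (\<Sum>j<r. c j *\<^sub>R ?e j s)"
      by (intro exI[of _ c]) (simp add: prod_eq_iff fst_sum snd_sum)
  next
    fix i assume i: "i < r"
    show "continuous_on {0..1} (?e' i)"
      by (intro continuous_on_Pair cseg sY sb i)
    have "(?Y i x, ?b i x) \<in> local_fibre D x"
      using local_section(3)[OF sec'[OF i] order_refl x(1)] .
    then show "\<eta> \<bullet> ?e i 0 = 0"
      using local_fibre_orthogonal[OF dir x(1) va] \<eta>
      by (auto simp: inner_commute[of v])
  next
    fix s :: real and c assume s: "s \<in> {0..1}" and "(\<Sum>i<r. c i *\<^sub>R ?e i s) = 0"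
    then have "(\<Sum>j<r. c j *\<^sub>R ?Y j (x + s *\<^sub>R w)) = 0" "(\<Sum>j<r. c j *\<^sub>R ?b j (x + s *\<^sub>R w)) = 0"
      by (simp_all add: prod_eq_iff fst_sum snd_sum)
    then show "\<forall>i<r. c i = 0" by (rule local_frame(2)[OF sec frame seg[OF s]])
  qed (use that in auto)
  show "\<eta> \<in> local_fibre D (x + w)"
    unfolding \<eta>(1)
  proof (rule local_fibre_orthogonal[OF dir x(2) va, THEN iffD2], clarify)
    fix v' a' assume "(v', a') \<in> local_fibre D (x + w)"
    then obtain c where c: "v' = (\<Sum>j<r. c j *\<^sub>R ?Y j (x + w))" "a' = (\<Sum>j<r. c j *\<^sub>R ?b j (x + w))"
      using local_frame(1)[OF sec frame x(2)] by blast
    have "a' \<bullet> v + a \<bullet> v' = (\<Sum>j<r. c j * (\<eta> \<bullet> ?e j 1))"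
      unfolding c \<eta>(1) by (simp add: inner_sum_left inner_sum_right inner_commute[of v] distrib_left sum.distrib)
    then show "a' \<bullet> v + a \<bullet> v' = 0" using van by simp
  qed
qed

lemma local_fibre_translate:
  assumes D: "closed_dirac M D" and fr: "frame_on M D U" and conv: "convex (\<phi> ` U)"
    and w: "\<And>z. z \<in> \<phi> ` U \<Longrightarrow> (w, 0) \<in> local_fibre D z"
    and x: "x \<in> \<phi> ` U" "x + w \<in> \<phi> ` U"
  shows "local_fibre D (x + w) = local_fibre D x"
proof
  have dir: "dirac_structure M D" using D by (simp add: closed_dirac_def)
  \<comment> \<open>The reverse inclusion is translation by \<open>- w\<close>, which is a constant
    section as well because the fibres are subspaces.\<close>
  have "(- w, 0) \<in> local_fibre D z" if "z \<in> \<phi> ` U" for z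
    using subspace_neg[OF subspace_local_fibre[OF dir that] w[OF that]] by simp
  from local_fibre_translate_subset[OF D fr conv this x(2)] x(1)
  show "local_fibre D (x + w) \<subseteq> local_fibre D x" by simp
qed (rule local_fibre_translate_subset[OF D fr conv w x])

section \<open>Changing and restricting charts\<close>

lemma homeo_restrict:
  assumes "S \<subseteq> U"
  shows "homeomorphic_map (subtopology (mtop M) S) (top_of_set (\<phi> ` S)) \<phi>"
proof -
  have "homeomorphic_map (subtopology (subtopology (mtop M) U) S) (subtopology (top_of_set (\<phi> ` U)) (\<phi> ` S)) \<phi>"
    by (rule homeomorphic_map_subtopologies[OF homeo]) (use assms U_sub in auto)
  moreover have "U \<inter> S = S" "\<phi> ` U \<inter> \<phi> ` S = \<phi> ` S" using assms by auto
  ultimately show ?thesis by (simp add: subtopology_subtopology)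
qed

text \<open>\<open>E_pres\<close> makes \<open>\<Phi>\<close> preserve and reflect membership in the
  model space, so composing with \<open>\<Psi>\<close> gives a chart with the same model;
  \<open>VE\<close> makes its image all of \<open>R \<inter> E\<close>.\<close>

lemma mchart_change:
  assumes R: "open R" and V: "open V" and h: "homeomorphism R V \<Phi> \<Psi>"
    and \<Phi>: "\<And>k. Ck_on k \<Phi> R" and \<Psi>: "\<And>k. Ck_on k \<Psi> V"
    and E_pres: "\<And>z. \<Phi> z - z \<in> E" and VE: "V \<inter> E \<subseteq> \<phi> ` U"
  defines "U1 \<equiv> {q \<in> U. \<phi> q \<in> V}" and "\<psi> \<equiv> (\<lambda>q. \<Psi> (\<phi> q))"
  shows "mchart M U1 \<psi>" and "\<psi> ` U1 = R \<inter> E" and "\<And>q. q \<in> U1 \<Longrightarrow> \<phi> q = \<Phi> (\<psi> q)"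
proof -
  have inE: "\<Phi> z \<in> E \<longleftrightarrow> z \<in> E" for z
    using subspace_add[OF model_subspace E_pres[of z], of z] subspace_diff[OF model_subspace _ E_pres[of z], of "\<Phi> z"] by auto
  have hs: "\<Phi> ` R = V" "\<Psi> ` V = R" "\<And>z. z \<in> R \<Longrightarrow> \<Psi> (\<Phi> z) = z" "\<And>z. z \<in> V \<Longrightarrow> \<Phi> (\<Psi> z) = z"
    "continuous_on R \<Phi>" "continuous_on V \<Psi>"
    using h by (auto simp: homeomorphism_def)
  have U1: "openin (mtop M) U1" "U1 \<subseteq> U" using open_chart_preimage'[OF V] by (auto simp: U1_def)
  show \<Phi>\<psi>: "\<phi> q = \<Phi> (\<psi> q)" if "q \<in> U1" for q
    using that hs(4) by (auto simp: U1_def \<psi>_def)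
  show im: "\<psi> ` U1 = R \<inter> E"
  proof (intro equalityI subsetI)
    fix z assume "z \<in> \<psi> ` U1"
    then obtain q where q: "q \<in> U1" "z = \<psi> q" by auto
    then have "q \<in> U" "\<phi> q \<in> V" by (auto simp: U1_def)
    then have "\<Phi> z \<in> E" using \<Phi>\<psi>[OF q(1)] q(2) chart_in_model[of q] by simp
    moreover have "z \<in> \<Psi> ` V" unfolding q(2) \<psi>_def by (rule imageI) fact
    ultimately have "z \<in> R" "\<Phi> z \<in> E" using hs(2) by simp_all
    then show "z \<in> R \<inter> E" using inE by simp
  next
    fix z assume z: "z \<in> R \<inter> E"
    then have "\<Phi> z \<in> V \<inter> E" using hs(1) inE by auto
    then have "\<Phi> z \<in> \<phi> ` U" "\<Phi> z \<in> V" using VE by auto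
    then have "inv\<phi> (\<Phi> z) \<in> U1" "\<psi> (inv\<phi> (\<Phi> z)) = z"
      using z hs(3) by (auto simp: U1_def \<psi>_def chart_inv)
    then show "z \<in> \<psi> ` U1" by force
  qed
  have inj: "inj_on \<psi> U1"
    using \<Phi>\<psi> inj_chart U1(2) by (metis inj_on_def subsetD)
  have inv\<psi>: "inv_into U1 \<psi> z = inv\<phi> (\<Phi> z)" if "z \<in> \<psi> ` U1" for z
  proof -
    obtain q where q: "q \<in> U1" "z = \<psi> q" using \<open>z \<in> \<psi> ` U1\<close> by auto
    then have "inv_into U1 \<psi> z = q" using inj by (simp add: inv_into_f_f)
    moreover have "inv\<phi> (\<Phi> z) = q" using q \<Phi>\<psi>[OF q(1)] U1(2) by (metis inv_chart subsetD)
    ultimately show ?thesis by simp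
  qed
  show "mchart M U1 \<psi>"
  proof
    show "openin (top_of_set E) (\<psi> ` U1)" unfolding im using openin_open_Int[OF R, of E] by (simp add: Int_commute)
    have "homeomorphic_maps (top_of_set (\<phi> ` U1)) (top_of_set (\<psi> ` U1)) \<Psi> \<Phi>"
      unfolding homeomorphic_maps_def
    proof (intro conjI)
      show "continuous_map (top_of_set (\<phi> ` U1)) (top_of_set (\<psi> ` U1)) \<Psi>"
        using hs(6) by (auto simp: \<psi>_def U1_def intro: continuous_on_subset)
      show "continuous_map (top_of_set (\<psi> ` U1)) (top_of_set (\<phi> ` U1)) \<Phi>"
      proof -
        have "continuous_on (\<psi> ` U1) \<Phi>" by (rule continuous_on_subset[OF hs(5)]) (simp add: im)
        moreover have "\<Phi> (\<psi> q) \<in> \<phi> ` U1" if "q \<in> U1" for q using \<Phi>\<psi>[OF that] that by force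
        ultimately show ?thesis by auto
      qed
    qed (use hs(4) \<Phi>\<psi> in \<open>auto simp: \<psi>_def U1_def\<close>)
    then have "homeomorphic_map (top_of_set (\<phi> ` U1)) (top_of_set (\<psi> ` U1)) \<Psi>"
      by (auto simp: homeomorphic_map_maps)
    from homeomorphic_map_compose[OF homeo_restrict[OF U1(2)] this]
    show "homeomorphic_map (subtopology (mtop M) U1) (top_of_set (\<psi> ` U1)) \<psi>"
      by (simp add: o_def \<psi>_def)
    fix W and f :: "'a \<Rightarrow> real" assume W: "openin (mtop M) W" "W \<subseteq> U1"
    have WU: "W \<subseteq> U" using W U1 by blast
    have s\<Phi>: "smooth_on_set (\<psi> ` W) \<Phi>"
      by (rule smooth_on_set_CkI[OF R _ \<Phi>]) (use W im in auto)
    have s\<Psi>: "smooth_on_set (\<phi> ` W) \<Psi>"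
      by (rule smooth_on_set_CkI[OF V _ \<Psi>]) (use W in \<open>auto simp: U1_def\<close>)
    show "smooth_fun M W f \<longleftrightarrow> smooth_on_set (\<psi> ` W) (\<lambda>z. f (inv_into U1 \<psi> z))"
      unfolding smooth_fun_iff[OF W(1) WU]
    proof
      assume f: "smooth_on_set (\<phi> ` W) (\<lambda>z. f (inv\<phi> z))"
      have "smooth_on_set (\<psi> ` W) (\<lambda>z. f (inv\<phi> (\<Phi> z)))"
        by (rule smooth_on_set_compose[OF f s\<Phi>]) (use \<Phi>\<psi> W in force)
      then show "smooth_on_set (\<psi> ` W) (\<lambda>z. f (inv_into U1 \<psi> z))"
        by (rule smooth_on_set_cong[THEN iffD1, rotated]) (use inv\<psi> W in auto)
    next
      assume f: "smooth_on_set (\<psi> ` W) (\<lambda>z. f (inv_into U1 \<psi> z))"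
      have "smooth_on_set (\<phi> ` W) (\<lambda>z. f (inv_into U1 \<psi> (\<Psi> z)))"
        by (rule smooth_on_set_compose[OF f s\<Psi>]) (use W in \<open>auto simp: \<psi>_def\<close>)
      moreover have "inv_into U1 \<psi> (\<Psi> (\<phi> q)) = q" if "q \<in> W" for q
        using inv_into_f_f[OF inj, of q] that W(2) by (auto simp: \<psi>_def)
      ultimately show "smooth_on_set (\<phi> ` W) (\<lambda>z. f (inv\<phi> z))"
        by (elim smooth_on_set_cong[THEN iffD1, rotated]) (use WU in \<open>auto simp: subset_iff\<close>)
    qed
  qed (use model_subspace U1 in auto)
qed

lemma mchart_restrict:
  assumes V: "openin (mtop M) V" "V \<subseteq> U"
  shows "mchart M V \<phi>"
proof
  have inj: "inj_on \<phi> V" using inj_chart V(2) by (rule inj_on_subset)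
  fix W and f :: "'a \<Rightarrow> real" assume W: "openin (mtop M) W" "W \<subseteq> V"
  have "smooth_on_set (\<phi> ` W) (\<lambda>z. f (inv\<phi> z)) \<longleftrightarrow> smooth_on_set (\<phi> ` W) (\<lambda>z. f (inv_into V \<phi> z))"
    by (rule smooth_on_set_cong) (use inj W V in \<open>auto simp: inv_into_f_f subset_iff\<close>)
  then show "smooth_fun M W f \<longleftrightarrow> smooth_on_set (\<phi> ` W) (\<lambda>z. f (inv_into V \<phi> z))"
    using smooth_fun_iff[OF W(1)] W V by simp
qed (use V model_subspace open_chart_image[OF V] homeo_restrict[OF V(2)] in auto)

lemma tvec_change:
  assumes B: "mchart M U1 \<psi>" and "U1 \<subseteq> U" and \<Phi>: "smooth_on_set (\<psi> ` U1) \<Phi>"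
    and \<Phi>\<psi>: "\<And>q. q \<in> U1 \<Longrightarrow> \<phi> q = \<Phi> (\<psi> q)" and q: "q \<in> U1"
  shows "mchart.tvec M U1 \<psi> q w = tvec q (dirder E \<Phi> (\<psi> q) w)"
proof
  interpret B: mchart M U1 \<psi> by fact
  fix f
  show "B.tvec q w f = tvec q (dirder E \<Phi> (\<psi> q) w) f"
  proof (cases "smooth_near M q f")
    case True
    obtain W where W: "openin (mtop M) W" "q \<in> W" "W \<subseteq> U1" "smooth_on_set (\<psi> ` W) (\<lambda>z. f (B.inv\<phi> z))"
      using B.smooth_nearE[OF q True] .
    have WU: "W \<subseteq> U" using W assms(2) by blast
    have sf: "smooth_on_set (\<phi> ` W) (\<lambda>z. f (inv\<phi> z))"
      using smooth_fun_iff[OF W(1) WU] B.smooth_fun_iff[OF W(1,3)] W(4) by blast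
    have sW: "smooth_on_set (\<psi> ` W) \<Phi>" using \<Phi> by (rule smooth_on_set_subset) (use W in auto)
    have "dirder E (\<lambda>z. f (B.inv\<phi> z)) (\<psi> q) w = dirder E (\<lambda>z. f (inv\<phi> (\<Phi> z))) (\<psi> q) w"
      by (rule dirder_cong[OF model_subspace B.open_chart_image[OF W(1,3)] _ W(4)])
        (use W WU \<Phi>\<psi>[symmetric] in \<open>auto simp: subset_iff\<close>)
    also have "\<dots> = dirder E (\<lambda>z. f (inv\<phi> z)) (\<Phi> (\<psi> q)) (dirder E \<Phi> (\<psi> q) w)"
      by (rule dirder_compose[OF model_subspace B.open_chart_image[OF W(1,3)] sf model_subspace open_chart_image[OF W(1) WU] sW])
        (use W \<Phi>\<psi>[symmetric] in auto)
    finally show ?thesis using True \<Phi>\<psi>[OF q] by (simp add: B.tvec_def tvec_def)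
  qed (simp add: B.tvec_def tvec_def)
qed

end

section \<open>Charts in which a space of sections is constant\<close>

text \<open>\<open>F\<close> collects the directions straightened so far. The image is a ball in the
  model space so that segments used for translation stay inside and the slice along \<open>F\<close>
  is connected.\<close>

definition flat_chart ::
  "('a, 'e::euclidean_space) mfd \<Rightarrow> 'a pontryagin_family \<Rightarrow> 'a \<Rightarrow> 'a set \<Rightarrow> ('a \<Rightarrow> 'e) \<Rightarrow> 'e set \<Rightarrow> real \<Rightarrow> bool" where
  "flat_chart M D p U \<phi> F r \<longleftrightarrow> mchart M U \<phi> \<and> p \<in> U \<and> \<phi> p = 0 \<and> r > 0 \<and> \<phi> ` U = ball 0 r \<inter> model M \<and>
     subspace F \<and> F \<subseteq> model M \<and> (\<forall>w\<in>F. \<forall>x\<in>\<phi> ` U. (w, 0) \<in> mchart.local_fibre M U \<phi> D x)"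

text \<open>With \<open>F = {0}\<close> only the shape of the chart is at stake: \<open>p\<close> is
  translated to the origin and the domain shrunk to a ball.\<close>

lemma flat_chart_exists:
  assumes M: "smooth_manifold M" and D: "dirac_structure M D" and p: "p \<in> U0" "openin (mtop M) U0"
  obtains U \<phi> r where "U \<subseteq> U0" "flat_chart M D p U \<phi> {0} r"
proof -
  have "p \<in> topspace (mtop M)" using p openin_subset by blast
  moreover have "(\<Union>(U, \<phi>)\<in>atlas M. U) = topspace (mtop M)"
    using M by (simp only: smooth_manifold_def)
  ultimately have "p \<in> (\<Union>(U, \<phi>)\<in>atlas M. U)" by simp
  then obtain V \<theta> where V: "(V, \<theta>) \<in> atlas M" "p \<in> V" by auto
  interpret V: mchart M V \<theta> by (rule mchart_atlas[OF M V(1)])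
  define V' where "V' = V \<inter> U0"
  have V': "openin (mtop M) V'" "V' \<subseteq> V" "p \<in> V'" using V.open_dom p V by (auto simp: V'_def)
  interpret A: mchart M V' \<theta> by (rule V.mchart_restrict[OF V'(1,2)])
  obtain r where r: "r > 0" "ball (\<theta> p) r \<inter> model M \<subseteq> \<theta> ` V'"
    using A.open_image V'(3) by (metis imageI openin_contains_ball)
  let ?\<Phi> = "\<lambda>z. z + \<theta> p" and ?\<Psi> = "\<lambda>z. z - \<theta> p"
  have h: "homeomorphism (ball 0 r) (ball (\<theta> p) r) ?\<Phi> ?\<Psi>"
  proof (rule homeomorphismI)
    show "?\<Phi> ` ball 0 r \<subseteq> ball (\<theta> p) r" by (auto simp: dist_norm)
    show "?\<Psi> ` ball (\<theta> p) r \<subseteq> ball 0 r" by (auto simp: dist_norm norm_minus_commute)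
  qed (auto intro!: continuous_intros)
  have "Ck_on k ?\<Phi> (ball 0 r)" for k
    by (intro Ck_on_add Ck_on_const Ck_on_bounded_linear bounded_linear_ident open_ball)
  moreover have "Ck_on k (\<lambda>z. z + (- \<theta> p)) (ball (\<theta> p) r)" for k
    by (intro Ck_on_add Ck_on_const Ck_on_bounded_linear bounded_linear_ident open_ball)
  ultimately have ch: "mchart M {q \<in> V'. \<theta> q \<in> ball (\<theta> p) r} (\<lambda>q. ?\<Psi> (\<theta> q))"
    "(\<lambda>q. ?\<Psi> (\<theta> q)) ` {q \<in> V'. \<theta> q \<in> ball (\<theta> p) r} = ball 0 r \<inter> model M"
    using A.mchart_change[OF open_ball open_ball h] A.chart_in_model[OF V'(3)] r(2) by simp_all
  let ?U = "{q \<in> V'. \<theta> q \<in> ball (\<theta> p) r}" and ?\<phi> = "\<lambda>q. ?\<Psi> (\<theta> q)"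
  interpret B: mchart M ?U ?\<phi> by (rule ch)
  have "(0, 0) \<in> B.local_fibre D x" if "x \<in> ?\<phi> ` ?U" for x
    using subspace_0[OF B.subspace_local_fibre[OF D that]] by (simp add: zero_prod_def)
  then have "flat_chart M D p ?U ?\<phi> {0} r"
    unfolding flat_chart_def using ch r V' B.model_subspace by (auto simp: subspace_0 subspace_single_0)
  moreover have "?U \<subseteq> U0" by (auto simp: V'_def)
  ultimately show thesis by (rule that[rotated])
qed

lemma orth_proj_complement:
  fixes E F :: "'e::euclidean_space set"
  assumes E: "subspace E" and F: "subspace F" "F \<subseteq> E"
  defines "H \<equiv> {x \<in> E. \<forall>f\<in>F. f \<bullet> x = 0}"
  shows "subspace H" and "f \<in> F \<Longrightarrow> orth_proj H f = 0"
    and "x \<in> E \<Longrightarrow> orth_proj H x = x - orth_proj F x"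
proof -
  show H: "subspace H"
    using E unfolding H_def subspace_def by (auto simp: inner_add_right)
  show *: "orth_proj H f = 0" if "f \<in> F" for f
  proof (rule inner_ext)
    show "orth_proj H f \<bullet> a = 0 \<bullet> a" for a
      using orth_proj_adjoint[OF H, of f a] orth_proj_in[OF H, of a] that by (simp add: H_def)
  qed
  assume x: "x \<in> E"
  have xF: "x - orth_proj F x \<in> H"
    unfolding H_def
  proof (intro CollectI conjI ballI)
    show "x - orth_proj F x \<in> E"
      using x F orth_proj_in[OF F(1)] by (intro subspace_diff E) auto
    show "f \<bullet> (x - orth_proj F x) = 0" if "f \<in> F" for f
      using orth_proj_adjoint[OF F(1), of f x] orth_proj_id[OF F(1) that] by (simp add: inner_diff_right)
  qed
  have "orth_proj H x = orth_proj H (x - orth_proj F x) + orth_proj H (orth_proj F x)"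
    using linear_add[OF linear_orth_proj[OF H], of "x - orth_proj F x" "orth_proj F x"] by simp
  then show "orth_proj H x = x - orth_proj F x"
    using *[OF orth_proj_in[OF F(1)]] orth_proj_id[OF H xF] by simp
qed

lemma dirder_eq_frechet_derivative:
  assumes "subspace E" "\<Phi> differentiable (at x)" "x \<in> E" "w \<in> E"
  shows "dirder E \<Phi> x w = frechet_derivative \<Phi> (at x) w"
proof -
  have "(\<Phi> has_derivative frechet_derivative \<Phi> (at x)) (at (orth_proj E x))"
    using assms by (simp add: orth_proj_id frechet_derivative_works)
  then have "((\<lambda>y. \<Phi> (orth_proj E y)) has_derivative (\<lambda>w. frechet_derivative \<Phi> (at x) (orth_proj E w))) (at x)"
    by (rule has_derivative_compose[OF bounded_linear_imp_has_derivative[OF bounded_linear_orth_proj[OF assms(1)]]])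
  from dirder_eqI[OF this] show ?thesis using assms by (simp add: orth_proj_id)
qed

text \<open>For the constant fields of \<open>F\<close> to stay constant, \<open>flow_box\<close>
  wants a field in the complement \<open>H\<close> of \<open>F\<close> that depends on the
  \<open>H\<close>-component only. Freezing and projecting do not leave \<open>D\<close>: the one by
  invariance under translation along \<open>F\<close>, the other because it subtracts an element of
  \<open>F\<close>.\<close>

lemma straighten:
  assumes flat: "flat_chart M D p U \<phi> F r" and D: "closed_dirac M D" and fr: "frame_on M D U"
    and sec: "bundle_section M D W X (\<lambda>q v. 0)" and W: "W \<subseteq> U" "p \<in> W"
    and ne: "mchart.coords \<phi> (X p) \<notin> F"
  obtains U1 \<psi> F1 r1 where "U1 \<subseteq> U" "flat_chart M D p U1 \<psi> F1 r1" "dim F < dim F1"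
proof -
  have A: "mchart M U \<phi>" "p \<in> U" "\<phi> p = 0" "r > 0" "\<phi> ` U = ball 0 r \<inter> model M" "subspace F" "F \<subseteq> model M"
    using flat by (auto simp: flat_chart_def)
  have const: "\<And>w x. w \<in> F \<Longrightarrow> x \<in> \<phi> ` U \<Longrightarrow> (w, 0) \<in> mchart.local_fibre M U \<phi> D x"
    using flat unfolding flat_chart_def by blast
  interpret A: mchart M U \<phi> by (rule A(1))
  note E = A.model_subspace
  have dir: "dirac_structure M D" using D by (simp add: closed_dirac_def)
  have conv: "convex (\<phi> ` U)" unfolding A(5) by (intro convex_Int convex_ball subspace_imp_convex E)
  define H where "H = {x \<in> model M. \<forall>f\<in>F. f \<bullet> x = 0}"
  note Hf = orth_proj_complement[OF E A(6,7), folded H_def]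
  have H: "subspace H" and HE: "H \<subseteq> model M" using Hf(1) by (auto simp: H_def)
  let ?P = "orth_proj H"
  have PH: "?P x \<in> H" for x by (rule orth_proj_in[OF H])
  define Xh where "Xh z = A.coords (X (A.inv\<phi> z))" for z
  have Xh: "smooth_on_set (\<phi> ` W) Xh"
    unfolding Xh_def by (rule A.local_section(1)[OF sec W(1)])
  have Xh_fib: "(Xh z, 0) \<in> A.local_fibre D z" if "z \<in> \<phi> ` W" for z
    using A.local_section(3)[OF sec W(1) that] by (simp add: Xh_def A.ccoords_def)
  have oW: "openin (mtop M) W" using sec by (simp add: bundle_section_def)
  have "0 \<in> \<phi> ` W" using W(2) A(3) by force
  then obtain r' where r': "r' > 0" "ball 0 r' \<inter> model M \<subseteq> \<phi> ` W"
    using A.open_chart_image[OF oW W(1)] by (metis openin_contains_ball)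
  have P0: "?P 0 = 0" by (rule linear_0[OF linear_orth_proj[OF H]])
  define e0 where "e0 = ?P (Xh 0)"
  \<comment> \<open>The \<open>H\<close>-component of the field at \<open>p\<close> is nonzero
    because its coordinates there are not in \<open>F\<close>.\<close>
  have "e0 \<noteq> 0"
  proof
    assume "e0 = 0"
    have "(Xh 0, 0) \<in> A.local_fibre D 0" by (rule Xh_fib) fact
    then have "Xh 0 \<in> model M" using A.local_fibre_model by blast
    then have "Xh 0 = orth_proj F (Xh 0)" using Hf(3)[of "Xh 0"] \<open>e0 = 0\<close> by (simp add: e0_def)
    then have "Xh 0 \<in> F" using orth_proj_in[OF A(6)] by metis
    moreover have "A.inv\<phi> 0 = p" using A.inv_chart[OF A(2)] A(3) by simp
    ultimately show False using ne by (simp add: Xh_def)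
  qed
  \<comment> \<open>Evaluation at \<open>?P x\<close> freezes the field along \<open>F\<close>, the
    outer projection removes its \<open>F\<close>-component, and the factor makes it a unit vector
    at 0, as \<open>flow_box\<close> assumes.\<close>
  define Y where "Y x = (1 / norm e0) *\<^sub>R ?P (Xh (?P x))" for x
  define S where "S = ?P -` ball 0 r'"
  have PS: "?P x \<in> \<phi> ` W" if "x \<in> S" for x
    using that r'(2) PH[of x] HE by (auto simp: S_def)
  have oS: "open S"
    unfolding S_def using bounded_linear_orth_proj[OF H] by (simp add: linear_continuous_on open_vimage)
  have S0: "0 \<in> S" using r'(1) by (simp add: S_def P0)
  have "smooth_on_set S (\<lambda>x. Xh (?P x))"
    by (rule smooth_on_set_compose[OF Xh smooth_on_set_linear[OF bounded_linear_orth_proj[OF H]]]) (use PS in auto)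
  then have "smooth_on_set S Y"
    unfolding Y_def
    by (intro smooth_on_set_linear_compose[OF bounded_linear_scaleR_right] smooth_on_set_linear_compose[OF bounded_linear_orth_proj[OF H]])
  then have Y: "Ck_on k Y S" for k using smooth_on_set_open[OF oS] by blast
  have YH: "Y x \<in> H" for x unfolding Y_def by (intro subspace_scale[OF H] PH)
  have YP: "Y (?P x) = Y x" for x by (simp add: Y_def orth_proj_idem[OF H])
  define e where "e = Y 0"
  have e: "norm e = 1" using \<open>e0 \<noteq> 0\<close> by (simp add: e_def Y_def P0 e0_def[symmetric])
  have Y_fib: "(Y x, 0) \<in> A.local_fibre D x" if x: "x \<in> model M" "x \<in> ball 0 r'" for x
  proof -
    have "norm (?P x) \<le> norm x" by (rule norm_orth_proj_le[OF H])
    then have "?P x \<in> ball 0 r' \<inter> model M" using x PH[of x] HE by auto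
    then have Px: "?P x \<in> \<phi> ` W" "?P x \<in> \<phi> ` U" using r'(2) image_mono[OF W(1), of \<phi>] by blast+
    have xU: "x \<in> \<phi> ` U" using x r'(2) image_mono[OF W(1), of \<phi>] by blast
    \<comment> \<open>A point and its \<open>H\<close>-component differ by an element of
      \<open>F\<close>, so translation invariance identifies their fibres.\<close>
    have xs: "?P x + orth_proj F x = x" using Hf(3)[OF x(1)] by simp
    have "A.local_fibre D (?P x + orth_proj F x) = A.local_fibre D (?P x)"
      by (rule A.local_fibre_translate[OF D fr conv const[OF orth_proj_in[OF A(6)]] Px(2)]) (use xs xU in auto)
    then have 1: "(Xh (?P x), 0) \<in> A.local_fibre D x" using Xh_fib[OF Px(1)] xs by simp
    then have "Xh (?P x) \<in> model M" using A.local_fibre_model by blast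
    then have "?P (Xh (?P x)) = Xh (?P x) - orth_proj F (Xh (?P x))" by (rule Hf(3))
    then have "(Y x, 0) = (1 / norm e0) *\<^sub>R ((Xh (?P x), 0) - (orth_proj F (Xh (?P x)), 0))"
      by (simp add: Y_def)
    also have "\<dots> \<in> A.local_fibre D x"
      by (intro subspace_scale subspace_diff A.subspace_local_fibre[OF dir xU] 1 const orth_proj_in[OF A(6)] xU)
    finally show ?thesis .
  qed
  obtain R V \<Phi> \<Psi> where fb: "open R" "0 \<in> R" "open V" "0 \<in> V" "homeomorphism R V \<Phi> \<Psi>" "\<Phi> 0 = 0"
    "\<And>k. Ck_on k \<Phi> R" "\<And>k. Ck_on k \<Psi> V" "\<And>z. \<Phi> z - z \<in> H"
    "\<And>z. z \<in> R \<Longrightarrow> frechet_derivative \<Phi> (at z) e = Y (\<Phi> z)"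
    "\<And>z f. z \<in> R \<Longrightarrow> ?P f = 0 \<Longrightarrow> frechet_derivative \<Phi> (at z) f = f"
    by (rule flow_box[OF H oS S0 Y YH YP e_def[symmetric] e]) (rule that)
  have hs: "\<Phi> ` R = V" "\<Psi> ` V = R" "\<And>z. z \<in> R \<Longrightarrow> \<Psi> (\<Phi> z) = z" "\<And>z. z \<in> V \<Longrightarrow> \<Phi> (\<Psi> z) = z"
    "continuous_on R \<Phi>" "continuous_on V \<Psi>"
    using fb(5) by (auto simp: homeomorphism_def)
  \<comment> \<open>Shrinking the source to a ball restores the shape required of a flat chart and
    keeps the target inside the ball where \<open>Y\<close> is known to be a section.\<close>
  have "open (R \<inter> \<Phi> -` ball 0 r')" "0 \<in> R \<inter> \<Phi> -` ball 0 r'"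
    using continuous_open_preimage[OF hs(5) fb(1) open_ball] fb(2,6) r'(1) by auto
  then obtain \<rho> where \<rho>: "\<rho> > 0" "ball 0 \<rho> \<subseteq> R \<inter> \<Phi> -` ball 0 r'"
    using open_contains_ball by blast
  define B where "B = ball (0::'b) \<rho>"
  define V1 where "V1 = V \<inter> \<Psi> -` B"
  have BR: "B \<subseteq> R" using \<rho>(2) by (auto simp: B_def)
  have V1: "open V1" unfolding V1_def B_def by (rule continuous_open_preimage[OF hs(6) fb(3) open_ball])
  have imB: "\<Phi> ` B = V1"
  proof (intro equalityI subsetI)
    fix y assume "y \<in> \<Phi> ` B"
    then obtain z where z: "z \<in> B" "y = \<Phi> z" by blast
    then have "y \<in> V" "\<Psi> y = z" using BR hs(1,3) by auto
    then show "y \<in> V1" using z by (simp add: V1_def)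
  next
    fix y assume "y \<in> V1"
    then have "\<Psi> y \<in> B" "\<Phi> (\<Psi> y) = y" using hs(4) by (auto simp: V1_def)
    then show "y \<in> \<Phi> ` B" by force
  qed
  have hB: "homeomorphism B V1 \<Phi> \<Psi>"
    by (rule homeomorphism_of_subsets[OF fb(5) BR _ imB]) (auto simp: V1_def)
  have V1r: "V1 \<subseteq> ball 0 r'" using imB \<rho>(2) by (auto simp: B_def)
  have "V1 \<inter> model M \<subseteq> \<phi> ` U" using V1r r'(2) image_mono[OF W(1), of \<phi>] by blast
  moreover have oB: "open B" by (simp add: B_def)
  moreover have "Ck_on k \<Phi> B" "Ck_on k \<Psi> V1" for k
    using fb(7,8) BR by (auto intro: Ck_on_subset simp: V1_def)
  moreover have "\<Phi> z - z \<in> model M" for z using fb(9) HE by auto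
  ultimately have ch: "mchart M {q \<in> U. \<phi> q \<in> V1} (\<lambda>q. \<Psi> (\<phi> q))"
    "(\<lambda>q. \<Psi> (\<phi> q)) ` {q \<in> U. \<phi> q \<in> V1} = B \<inter> model M"
    "\<And>q. q \<in> {q \<in> U. \<phi> q \<in> V1} \<Longrightarrow> \<phi> q = \<Phi> (\<Psi> (\<phi> q))"
    using A.mchart_change[OF oB V1 hB] by blast+
  define U1 where "U1 = {q \<in> U. \<phi> q \<in> V1}"
  define \<psi> where "\<psi> = (\<lambda>q. \<Psi> (\<phi> q))"
  note ch = ch[folded U1_def, folded \<psi>_def]
  have ch3: "\<phi> q = \<Phi> (\<psi> q)" if "q \<in> U1" for q using ch(3)[OF that] by (simp add: \<psi>_def)
  interpret B: mchart M U1 \<psi> by (rule ch(1))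
  have U1U: "U1 \<subseteq> U" by (auto simp: U1_def)
  have \<psi>B: "\<psi> q \<in> B" "\<psi> q \<in> model M" if "q \<in> U1" for q using ch(2) that by auto
  have s\<Phi>: "smooth_on_set (\<psi> ` U1) \<Phi>"
    by (rule smooth_on_set_CkI[OF fb(1) _ fb(7)]) (use \<psi>B BR in auto)
  \<comment> \<open>A coordinate vector of the new chart corresponds to its image under the
    derivative of \<open>\<Phi>\<close> in the old one: \<open>e\<close> becomes \<open>Y\<close>
    and elements of \<open>F\<close> are unchanged, and both give sections of
    \<open>D\<close>.\<close>
  have tv: "B.tvec q w = A.tvec q (frechet_derivative \<Phi> (at (\<psi> q)) w)" if q: "q \<in> U1" and w: "w \<in> model M" for q w
  proof -
    have "\<Phi> differentiable (at (\<psi> q))"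
      using fb(7)[of "Suc 0"] \<psi>B(1)[OF q] BR by auto
    then have "dirder (model M) \<Phi> (\<psi> q) w = frechet_derivative \<Phi> (at (\<psi> q)) w"
      by (rule dirder_eq_frechet_derivative[OF E _ \<psi>B(2)[OF q] w])
    then show ?thesis using A.tvec_change[OF ch(1) U1U s\<Phi> ch3 q] by simp
  qed
  have fibB: "(w, 0) \<in> B.local_fibre D (\<psi> q)"
    if q: "q \<in> U1" and w: "w \<in> model M" and fib: "(frechet_derivative \<Phi> (at (\<psi> q)) w, 0) \<in> A.local_fibre D (\<phi> q)" for q w
  proof -
    have "q \<in> U" using q U1U by auto
    then have "(A.tvec q (frechet_derivative \<Phi> (at (\<psi> q)) w), A.cvec q 0) \<in> D q"
      using fib by (simp add: A.local_fibre_def)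
    then show ?thesis
      using q w tv[OF q w] subspace_0[OF E] by (simp add: B.local_fibre_def A.cvec_0 B.cvec_0)
  qed
  have eE: "e \<in> model M" using YH HE by (auto simp: e_def)
  define F1 where "F1 = span (insert e F)"
  have F1_fib: "(w, 0) \<in> B.local_fibre D x" if w: "w \<in> F1" and x: "x \<in> \<psi> ` U1" for w x
  proof -
    obtain q where q: "q \<in> U1" "x = \<psi> q" using x by auto
    have qU: "\<phi> q \<in> \<phi> ` U" and zR: "\<psi> q \<in> R" using q U1U \<psi>B BR by auto
    have "linear (\<lambda>w::'b. (w, 0::'b))" by (rule linearI) auto
    then have sub: "subspace ((\<lambda>w. (w, 0)) -` B.local_fibre D x)"
      using B.subspace_local_fibre[OF dir x] by (rule linear_subspace_vimage)
    have "f \<in> (\<lambda>w. (w, 0)) -` B.local_fibre D x" if "f \<in> insert e F" for f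
    proof (cases "f = e")
      case True
      have "\<phi> q \<in> ball 0 r'" "\<phi> q \<in> model M" using q V1r A.chart_in_model U1U by (auto simp: U1_def)
      then have "(frechet_derivative \<Phi> (at (\<psi> q)) e, 0) \<in> A.local_fibre D (\<phi> q)"
        using Y_fib fb(10)[OF zR] ch3[OF q(1)] by simp
      then show ?thesis using fibB[OF q(1) eE] q(2) True by simp
    next
      case False
      then have f: "f \<in> F" using that by simp
      then have "(frechet_derivative \<Phi> (at (\<psi> q)) f, 0) \<in> A.local_fibre D (\<phi> q)"
        using fb(11)[OF zR Hf(2)[OF f]] const[OF f qU] by simp
      then show ?thesis using fibB[OF q(1)] A(7) f q(2) by auto
    qed
    then have "insert e F \<subseteq> (\<lambda>w. (w, 0)) -` B.local_fibre D x" by blast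
    from span_minimal[OF this sub] show ?thesis using w by (auto simp: F1_def)
  qed
  have "e \<notin> F"
  proof
    assume "e \<in> F"
    moreover have "e \<in> H" using YH by (simp add: e_def)
    ultimately have "e \<bullet> e = 0" by (simp add: H_def)
    then show False using e by simp
  qed
  then have dim: "dim F < dim F1"
    using A(6) by (simp add: F1_def dim_insert span_eq_iff[THEN iffD2])
  have "p \<in> U1" using A(2,3) imB fb(6) \<rho>(1) by (force simp: U1_def B_def)
  moreover have "\<psi> p = 0" using hs(3)[OF fb(2)] fb(6) A(3) by (simp add: \<psi>_def)
  moreover have "F1 \<subseteq> model M" unfolding F1_def using A(7) eE by (intro span_minimal E) auto
  ultimately have "flat_chart M D p U1 \<psi> F1 \<rho>"
    unfolding flat_chart_def using ch(1,2) \<rho>(1) F1_fib by (simp add: B_def F1_def)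
  then show thesis using that[OF U1U _ dim] by blast
qed

section \<open>Integral manifolds and the induced two-form\<close>

lemma (in mchart) G0_section:
  assumes "v \<in> G0 M D q" "q \<in> U"
  obtains W X where "W \<subseteq> U" "q \<in> W" "bundle_section M D W X (\<lambda>q v. 0)" "X q = v"
proof -
  obtain W X where W: "q \<in> W" "bundle_section M D W X (\<lambda>q v. 0)" "X q = v"
    using assms(1) by (auto simp: G0_def)
  have "openin (mtop M) (W \<inter> U)" using W(2) open_dom by (auto simp: bundle_section_def)
  from bundle_section_subset[OF W(2) this] have "bundle_section M D (W \<inter> U) X (\<lambda>q v. 0)" by simp
  then show thesis using that[of "W \<inter> U" X] W assms(2) by auto
qed

lemma G0_tangent: "v \<in> G0 M D q \<Longrightarrow> v \<in> tangent_space M q"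
  by (auto simp: G0_def bundle_section_def vector_field_def)

lemma G0_fibre:
  assumes "v \<in> G0 M D q" shows "(v, \<lambda>v. 0) \<in> D q"
  using assms by (auto simp: G0_def bundle_section_def)

text \<open>Among flat charts inside the domain of one frame, the dimension of \<open>F\<close> is
  bounded by that of the Euclidean space. A chart that maximises it admits no further straightening,
  so \<open>F\<close> contains the coordinates of all of \<open>G0\<close> at
  \<open>p\<close>.\<close>

lemma maximal_flat_chart:
  assumes M: "smooth_manifold M" and D: "closed_dirac M D" and p: "p \<in> topspace (mtop M)"
  obtains U \<phi> F r where "flat_chart M D p U \<phi> F r" "frame_on M D U"
    "\<And>w. w \<in> model M \<Longrightarrow> mchart.tvec M U \<phi> p w \<in> G0 M D p \<Longrightarrow> w \<in> F"
proof -
  have dir: "dirac_structure M D" using D by (simp add: closed_dirac_def)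
  have "subbundle M D" using dir by (simp add: dirac_structure_def)
  from bspec[OF this[unfolded subbundle_def] p]
  have "\<exists>U0. p \<in> U0 \<and> openin (mtop M) U0 \<and> frame_on M D U0"
    unfolding frame_on_def
    by - (elim exE conjE, rule exI, rule conjI, assumption, rule conjI, assumption,
        rule exI, rule exI, rule exI, rule conjI, assumption, assumption)
  then obtain U0 where U0: "p \<in> U0" "openin (mtop M) U0" "frame_on M D U0" by blast
  define Q where "Q = (\<lambda>(U, \<phi>, F, r). U \<subseteq> U0 \<and> flat_chart M D p U \<phi> F r)"
  define d where "d = (\<lambda>(U :: 'a set, \<phi> :: 'a \<Rightarrow> 'b, F :: 'b set, r :: real). dim F)"
  obtain U \<phi> r where "U \<subseteq> U0" "flat_chart M D p U \<phi> {0} r"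
    using flat_chart_exists[OF M dir U0(1,2)] by blast
  then have "Q (U, \<phi>, {0}, r)" by (simp add: Q_def)
  moreover have "\<forall>y. Q y \<longrightarrow> d y < Suc DIM('b)"
    by (auto simp: d_def less_Suc_eq_le dim_subset_UNIV)
  ultimately obtain y where y: "Q y" "\<And>z. Q z \<Longrightarrow> d z \<le> d y"
    using ex_has_greatest_nat[of Q "(U, \<phi>, {0}, r)" d "Suc DIM('b)"] by blast
  obtain U \<phi> F r where yeq: "y = (U, \<phi>, F, r)" by (metis prod_cases4)
  have U: "U \<subseteq> U0" and flat: "flat_chart M D p U \<phi> F r" using y(1) by (auto simp: Q_def yeq)
  interpret A: mchart M U \<phi> using flat by (simp add: flat_chart_def)
  have pU: "p \<in> U" using flat by (simp add: flat_chart_def)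
  have fr: "frame_on M D U" by (rule frame_on_subset[OF U0(3) A.open_dom U])
  show thesis
  proof (rule that[OF flat fr], rule ccontr)
    fix w assume w: "w \<in> model M" "A.tvec p w \<in> G0 M D p" "w \<notin> F"
    obtain W X where X: "W \<subseteq> U" "p \<in> W" "bundle_section M D W X (\<lambda>q v. 0)" "X p = A.tvec p w"
      by (rule A.G0_section[OF w(2) pU])
    have "A.coords (X p) \<notin> F" using w by (simp add: X(4) A.coords_tvec[OF pU])
    then obtain U1 \<psi> F1 r1 where "U1 \<subseteq> U" "flat_chart M D p U1 \<psi> F1 r1" "dim F < dim F1"
      using straighten[OF flat D fr X(3,1,2)] by blast
    then show False using y(2)[of "(U1, \<psi>, F1, r1)"] U by (auto simp: Q_def yeq d_def)
  qed
qed

text \<open>The components of \<open>\<psi>\<close> are smooth functions, and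
  \<open>smooth_fun_iff\<close> reads them in the chart \<open>\<phi>\<close>. The charts are those
  of the maximal atlas, since flat charts are in general not members of
  \<open>atlas M\<close>.\<close>

lemma (in mchart) transition_smooth:
  assumes "mchart M V \<psi>"
  shows "smooth_on_set (\<phi> ` (U \<inter> V)) (\<lambda>z. \<psi> (inv\<phi> z))"
proof -
  interpret B: mchart M V \<psi> by fact
  have o: "openin (mtop M) (U \<inter> V)" using open_dom B.open_dom by blast
  have "smooth_on_set (\<phi> ` (U \<inter> V)) (\<lambda>z. \<psi> (inv\<phi> z) \<bullet> b)" for b
  proof -
    have "smooth_fun M (U \<inter> V) (\<lambda>x. \<psi> x \<bullet> b)"
      by (rule B.smooth_fun_iff[OF o, THEN iffD2, OF _ smooth_on_set_subset[OF B.smooth_on_chart_inner]]) auto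
    then show ?thesis using smooth_fun_iff[OF o] by simp
  qed
  then have "smooth_on_set (\<phi> ` (U \<inter> V)) (\<lambda>z. \<Sum>b\<in>Basis. (\<psi> (inv\<phi> z) \<bullet> b) *\<^sub>R b)"
    by (intro smooth_on_set_sum smooth_on_set_bilinear[OF bounded_bilinear_scaleR] smooth_on_set_const)
  then show ?thesis by (simp add: euclidean_representation)
qed

text \<open>The slice carries the subspace topology and the single chart \<open>\<phi>\<close>, with
  \<open>F\<close> as model. For the equality of its tangent spaces with \<open>G0\<close>, the
  delicate point is a vector of \<open>G0\<close> at a point of the slice other than
  \<open>p\<close>: maximality of \<open>F\<close> speaks of \<open>p\<close> alone, so a section
  through the vector is translated back to \<open>p\<close>.\<close>

lemma G0_integral_manifold:
  assumes M: "smooth_manifold M" and D: "closed_dirac M D" and p: "p \<in> topspace (mtop M)"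
  obtains L where "integral_manifold M (G0 M D) L" "p \<in> topspace (mtop L)"
proof -
  have dir: "dirac_structure M D" using D by (simp add: closed_dirac_def)
  obtain U \<phi> F r where flat: "flat_chart M D p U \<phi> F r" and fr: "frame_on M D U" and
    max: "\<And>w. w \<in> model M \<Longrightarrow> mchart.tvec M U \<phi> p w \<in> G0 M D p \<Longrightarrow> w \<in> F"
    using maximal_flat_chart[OF M D p] by blast
  have A: "mchart M U \<phi>" "p \<in> U" "\<phi> p = 0" "r > 0" "\<phi> ` U = ball 0 r \<inter> model M" "subspace F" "F \<subseteq> model M"
    using flat by (auto simp: flat_chart_def)
  have const: "\<And>w x. w \<in> F \<Longrightarrow> x \<in> \<phi> ` U \<Longrightarrow> (w, 0) \<in> mchart.local_fibre M U \<phi> D x"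
    using flat unfolding flat_chart_def by blast
  interpret A: mchart M U \<phi> by (rule A(1))
  note E = A.model_subspace
  have conv: "convex (\<phi> ` U)" unfolding A(5) by (intro convex_Int convex_ball subspace_imp_convex E)
  define S where "S = {q \<in> U. \<phi> q \<in> F}"
  have SU: "S \<subseteq> U" by (auto simp: S_def)
  have SM: "S \<subseteq> topspace (mtop M)" using SU A.U_sub by blast
  have imS: "\<phi> ` S = ball 0 r \<inter> F"
  proof (intro equalityI subsetI)
    show "z \<in> ball 0 r \<inter> F" if "z \<in> \<phi> ` S" for z
      using that A(5) by (auto simp: S_def)
    fix z assume z: "z \<in> ball 0 r \<inter> F"
    then have "z \<in> \<phi> ` U" using A(5,7) by auto
    then show "z \<in> \<phi> ` S" using z by (auto simp: S_def)
  qed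
  have inj: "inj_on \<phi> S" using A.inj_chart SU by (rule inj_on_subset)
  have invS: "inv_into S \<phi> (\<phi> q) = q" if "q \<in> S" for q using inj that by (rule inv_into_f_f)
  define L where "L = \<lparr>mtop = subtopology (mtop M) S, atlas = {(S, \<phi>)}, model = F\<rparr>"
  have L: "mtop L = subtopology (mtop M) S" "atlas L = {(S, \<phi>)}" "model L = F"
    by (simp_all add: L_def)
  have topL: "topspace (mtop L) = S" using SM by (simp add: L(1) Int_absorb1)
  have smL: "smooth_manifold L"
    unfolding smooth_manifold_def
  proof (intro conjI)
    show "Hausdorff_space (mtop L)" "second_countable (mtop L)"
      using M by (simp_all add: L(1) smooth_manifold_def Hausdorff_space_subtopology second_countable_subtopology)
    show "subspace (model L)" by (simp add: L A(6))
    show "(\<Union>(U, \<phi>)\<in>atlas L. U) = topspace (mtop L)" by (simp add: topL L(2))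
    have "openin (mtop L) S" using topL openin_topspace by metis
    moreover have "openin (top_of_set F) (\<phi> ` S)"
      unfolding imS using openin_open_Int[of "ball 0 r" F] by (simp add: Int_commute)
    moreover have "homeomorphic_map (subtopology (mtop L) S) (top_of_set (\<phi> ` S)) \<phi>"
      using A.homeo_restrict[OF SU] by (simp add: L(1) subtopology_subtopology)
    ultimately show "\<forall>(U, \<phi>)\<in>atlas L. openin (mtop L) U \<and> openin (top_of_set (model L)) (\<phi> ` U) \<and>
        homeomorphic_map (subtopology (mtop L) U) (top_of_set (\<phi> ` U)) \<phi>"
      by (simp add: L(2,3))
    have "smooth_on_set (\<phi> ` S) (\<lambda>z. \<phi> (inv_into S \<phi> z))"
      by (rule smooth_on_set_cong[THEN iffD1, OF _ smooth_on_set_linear[OF bounded_linear_ident]]) (auto simp: invS)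
    then show "\<forall>(U, \<phi>)\<in>atlas L. \<forall>(V, \<psi>)\<in>atlas L. smooth_on_set (\<phi> ` (U \<inter> V)) (\<lambda>z. \<psi> (inv_into U \<phi> z))"
      by (simp add: L(2))
  qed
  have Lch: "mchart L S \<phi>" by (rule mchart_atlas[OF smL]) (simp add: L(2))
  interpret B: mchart L S \<phi> by (rule Lch)
  have inc: "smooth_map L M (\<lambda>x. x)"
    unfolding smooth_map_def
  proof (intro conjI)
    show "continuous_map (mtop L) (mtop M) (\<lambda>x. x)" by (simp add: L(1))
    have "smooth_on_set (\<phi> ` {x \<in> S. x \<in> V}) (\<lambda>z. \<psi> (inv_into S \<phi> z))" if V: "(V, \<psi>) \<in> atlas M" for V \<psi>
    proof -
      have "smooth_on_set (\<phi> ` {x \<in> S. x \<in> V}) (\<lambda>z. \<psi> (A.inv\<phi> z))"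
        by (rule smooth_on_set_subset[OF A.transition_smooth[OF mchart_atlas[OF M V]]]) (use SU in auto)
      then show ?thesis
        by (rule smooth_on_set_cong[THEN iffD1, rotated]) (use SU in \<open>auto simp: invS subset_iff\<close>)
    qed
    then show "\<forall>(U, \<phi>)\<in>atlas L. \<forall>(V, \<psi>)\<in>atlas M.
        smooth_on_set (\<phi> ` {x \<in> U. x \<in> V}) (\<lambda>z. \<psi> (inv_into U \<phi> z))"
      by (auto simp: L(2))
  qed
  \<comment> \<open>With \<open>\<phi>\<close> as chart on both sides, the inclusion of the slice is
    the inclusion of \<open>F\<close> into the model space, so coordinate vectors keep their
    coordinates.\<close>
  have tm: "tangent_map M (\<lambda>x. x) x (B.tvec x w) = A.tvec x w" if x: "x \<in> S" and w: "w \<in> F" for x w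
  proof
    fix f
    show "tangent_map M (\<lambda>x. x) x (B.tvec x w) f = A.tvec x w f"
    proof (cases "smooth_near M x f")
      case True
      have xU: "x \<in> U" using x SU by auto
      obtain W where W: "openin (mtop M) W" "x \<in> W" "W \<subseteq> U" "smooth_on_set (\<phi> ` W) (\<lambda>z. f (A.inv\<phi> z))"
        using A.smooth_nearE[OF xU True] .
      have oW: "openin (mtop L) (W \<inter> S)" unfolding L(1) using W(1) by (auto simp: openin_subtopology)
      have s1: "smooth_on_set (\<phi> ` (W \<inter> S)) (\<lambda>z. f (A.inv\<phi> z))"
        by (rule smooth_on_set_subset[OF W(4)]) auto
      have eq: "f (A.inv\<phi> z) = f (B.inv\<phi> z)" if "z \<in> \<phi> ` (W \<inter> S)" for z
        using that SU by (auto simp: invS subset_iff)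
      have s2: "smooth_on_set (\<phi> ` (W \<inter> S)) (\<lambda>z. f (B.inv\<phi> z))"
        by (rule smooth_on_set_cong[THEN iffD1, OF eq s1])
      have near: "smooth_near L x f"
        unfolding B.smooth_near_iff[OF x] using oW W(2) x s2 by (intro exI[of _ "W \<inter> S"]) auto
      have oF: "openin (top_of_set F) (\<phi> ` (W \<inter> S))" using B.open_chart_image[OF oW] by (simp add: L(3))
      have xW: "\<phi> x \<in> \<phi> ` (W \<inter> S)" using x W(2) by auto
      have "dirder F (\<lambda>z. f (B.inv\<phi> z)) (\<phi> x) w = dirder F (\<lambda>z. f (A.inv\<phi> z)) (\<phi> x) w"
        by (rule dirder_cong[OF A(6) oF eq s1 xW, symmetric])
      also have "\<dots> = dirder (model M) (\<lambda>z. f (A.inv\<phi> z)) (\<phi> x) (dirder F (\<lambda>z. z) (\<phi> x) w)"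
        by (rule dirder_compose[OF A(6) oF W(4) E A.open_chart_image[OF W(1,3)] smooth_on_set_linear[OF bounded_linear_ident] _ xW]) auto
      also have "dirder F (\<lambda>z. z) (\<phi> x) w = w"
        by (rule dirder_linear[OF A(6) oF bounded_linear_ident w])
      finally show ?thesis
        using True near by (simp add: tangent_map_def B.tvec_def A.tvec_def L(3))
    qed (simp add: tangent_map_def A.tvec_def)
  qed
  have TL: "tangent_space L x = B.tvec x ` F" if x: "x \<in> S" for x
  proof (intro equalityI subsetI)
    fix v assume v: "v \<in> tangent_space L x"
    then have "v = B.tvec x (B.coords v)" "B.coords v \<in> F"
      using B.tvec_coords[OF x v] B.coords_in_model[OF x v] by (simp_all add: L(3))
    then show "v \<in> B.tvec x ` F" by blast
  qed (use B.tvec_tangent[OF x] in auto)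
  have inj_T: "inj_on (tangent_map M (\<lambda>x. x) x) (tangent_space L x)" if x: "x \<in> S" for x
  proof (rule inj_onI)
    fix u v assume "u \<in> tangent_space L x" "v \<in> tangent_space L x"
      and eq: "tangent_map M (\<lambda>x. x) x u = tangent_map M (\<lambda>x. x) x v"
    then obtain a b where ab: "a \<in> F" "b \<in> F" "u = B.tvec x a" "v = B.tvec x b" using TL[OF x] by auto
    then have "A.tvec x a = A.tvec x b" using eq tm[OF x] by simp
    moreover have "x \<in> U" "a \<in> model M" "b \<in> model M" using x SU ab A(7) by auto
    ultimately have "a = b" using A.coords_tvec by metis
    then show "u = v" using ab by simp
  qed
  have image_T: "tangent_map M (\<lambda>x. x) x ` tangent_space L x = G0 M D x" if x: "x \<in> S" for x
  proof -
    have xU: "x \<in> U" and \<phi>x: "\<phi> x \<in> F" using x by (auto simp: S_def)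
    have "tangent_map M (\<lambda>x. x) x ` tangent_space L x = A.tvec x ` F"
      unfolding TL[OF x] image_image by (rule image_cong) (simp_all add: tm[OF x])
    also have "\<dots> = G0 M D x"
    proof (intro equalityI subsetI)
      fix v assume "v \<in> A.tvec x ` F"
      then obtain w where w: "w \<in> F" "v = A.tvec x w" by blast
      have "bundle_section M D U (\<lambda>q. A.tvec q w) (\<lambda>q. A.cvec q 0)"
        by (rule A.section_of_local[OF A.open_dom order_refl smooth_on_set_const smooth_on_set_const const[OF w(1)]])
      then show "v \<in> G0 M D x" using w xU by (auto simp: G0_def A.cvec_0)
    next
      fix v assume v: "v \<in> G0 M D x"
      obtain W X where X: "W \<subseteq> U" "x \<in> W" "bundle_section M D W X (\<lambda>q v. 0)" "X x = v"
        by (rule A.G0_section[OF v xU])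
      have oW: "openin (mtop M) W" using X(3) by (simp add: bundle_section_def)
      define w where "w = A.coords v"
      have vw: "v = A.tvec x w" and wE: "w \<in> model M"
        using A.tvec_coords[OF xU G0_tangent[OF v]] A.coords_in_model[OF xU G0_tangent[OF v]] by (simp_all add: w_def)
      let ?Xh = "\<lambda>z. A.coords (X (A.inv\<phi> z))"
      \<comment> \<open>The points of the image that land in the domain of the section when shifted
        by \<open>\<phi> x\<close>; among them is \<open>0 = \<phi> p\<close>.\<close>
      define T where "T = \<phi> ` U \<inter> (\<lambda>z. z + \<phi> x) -` (\<phi> ` W)"
      obtain T0 where T0: "open T0" "\<phi> ` W = model M \<inter> T0"
        using A.open_chart_image[OF oW X(1)] by (auto simp: openin_open)
      have "T = (ball 0 r \<inter> (\<lambda>z. z + \<phi> x) -` T0) \<inter> model M"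
        using A(5) T0(2) subspace_add[OF E] \<phi>x A(7) by (auto simp: T_def)
      moreover have "open (ball 0 r \<inter> (\<lambda>z. z + \<phi> x) -` T0)"
        by (intro open_Int open_ball open_vimage T0(1)) (auto intro!: continuous_intros)
      ultimately have oT: "openin (top_of_set (model M)) T" by (auto simp: openin_open)
      define V where "V = {q \<in> U. \<phi> q \<in> T}"
      have oV: "openin (mtop M) V" unfolding V_def by (rule A.open_chart_preimage[OF oT])
      have VU: "V \<subseteq> U" by (auto simp: V_def)
      have pV: "p \<in> V" using A(2,3) X(2) by (force simp: V_def T_def)
      have tr: "z + \<phi> x \<in> \<phi> ` W" "z \<in> \<phi> ` U" if "z \<in> \<phi> ` V" for z using that by (auto simp: V_def T_def)
      have "smooth_on_set (\<phi> ` V) (\<lambda>z. z + \<phi> x)"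
        by (intro smooth_on_set_add smooth_on_set_const smooth_on_set_linear bounded_linear_ident)
      then have sX: "smooth_on_set (\<phi> ` V) (\<lambda>z. ?Xh (z + \<phi> x))"
        by (rule smooth_on_set_compose[OF A.local_section(1)[OF X(3,1)]]) (use tr in auto)
      \<comment> \<open>\<open>\<phi> x\<close> lies in \<open>F\<close>, so the fibres at
        \<open>z\<close> and \<open>z + \<phi> x\<close> coincide and the shifted components still
        form a section of \<open>D\<close>.\<close>
      have fib: "(?Xh (z + \<phi> x), 0) \<in> A.local_fibre D z" if "z \<in> \<phi> ` V" for z
      proof -
        have "z + \<phi> x \<in> \<phi> ` U" using tr(1)[OF that] image_mono[OF X(1), of \<phi>] by blast
        then have "A.local_fibre D (z + \<phi> x) = A.local_fibre D z"
          by (intro A.local_fibre_translate[OF D fr conv const[OF \<phi>x] tr(2)[OF that]])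
        then show ?thesis using A.local_section(3)[OF X(3,1) tr(1)[OF that]] by (simp add: A.ccoords_def)
      qed
      have "bundle_section M D V (\<lambda>q. A.tvec q (?Xh (\<phi> q + \<phi> x))) (\<lambda>q. A.cvec q 0)"
        by (rule A.section_of_local[OF oV VU sX smooth_on_set_const fib])
      moreover have "?Xh (\<phi> p + \<phi> x) = w" using A(3) xU X(4) by (simp add: w_def)
      ultimately have "A.tvec p w \<in> G0 M D p" using pV unfolding G0_def by (force simp: A.cvec_0)
      then have "w \<in> F" by (rule max[OF wE])
      then show "v \<in> A.tvec x ` F" using vw by blast
    qed
    finally show ?thesis .
  qed
  have "connected (\<phi> ` S)"
    unfolding imS by (intro convex_connected convex_Int convex_ball subspace_imp_convex A(6))
  then have "connected_space (top_of_set (\<phi> ` S))"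
    using connectedin_absolute connectedin_iff_connected connectedin_def by (metis connectedin_topspace topspace_euclidean_subtopology)
  then have "connected_space (mtop L)"
    using homeomorphic_connected_space[OF homeomorphic_map_imp_homeomorphic_space[OF A.homeo_restrict[OF SU]]] by (simp add: L(1))
  then have "integral_manifold M (G0 M D) L"
    unfolding integral_manifold_def immersed_submanifold_def
    using smL SM inc inj_T image_T by (simp add: topL)
  moreover have "p \<in> topspace (mtop L)" using A(2,3) subspace_0[OF A(6)] by (simp add: topL S_def)
  ultimately show thesis by (rule that)
qed

text \<open>A vector field tangent to an immersed submanifold restricts to a smooth vector field there:
  in charts its components solve a linear system whose matrix has a left inverse at the point.\<close>

lemma lift_tangent_field:
  fixes M N :: "('a, 'e::euclidean_space) mfd"
  assumes M: "smooth_manifold M" and N: "immersed_submanifold M N" and n: "n \<in> topspace (mtop N)" "n \<in> U"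
    and U: "openin (mtop M) U" and X: "vector_field M U X"
    and tan: "\<And>x. x \<in> U \<Longrightarrow> x \<in> topspace (mtop N) \<Longrightarrow> X x \<in> tangent_map M (\<lambda>x. x) x ` tangent_space N x"
    and TN: "\<And>x. x \<in> topspace (mtop N) \<Longrightarrow> tangent_map M (\<lambda>x. x) x ` tangent_space N x \<subseteq> tangent_space M x"
  obtains V X' where "openin (mtop N) V" "n \<in> V" "V \<subseteq> U" "vector_field N V X'" "related_by_inclusion M V X' X"
proof -
  let ?T = "tangent_map M (\<lambda>x. x)"
  have smN: "smooth_manifold N" and NM: "topspace (mtop N) \<subseteq> topspace (mtop M)" and inc: "smooth_map N M (\<lambda>x. x)"
    and injT: "\<And>x. x \<in> topspace (mtop N) \<Longrightarrow> inj_on (?T x) (tangent_space N x)"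
    using N by (auto simp: immersed_submanifold_def)
  have "(\<Union>(U, \<phi>)\<in>atlas N. U) = topspace (mtop N)" "(\<Union>(U, \<phi>)\<in>atlas M. U) = topspace (mtop M)"
    using smN M by (simp_all only: smooth_manifold_def)
  then have "n \<in> (\<Union>(U, \<phi>)\<in>atlas N. U)" "n \<in> (\<Union>(U, \<phi>)\<in>atlas M. U)" using n NM by auto
  then obtain V0 \<theta> U0 \<phi> where ch: "(V0, \<theta>) \<in> atlas N" "n \<in> V0" "(U0, \<phi>) \<in> atlas M" "n \<in> U0" by auto
  interpret A: mchart M U0 \<phi> by (rule mchart_atlas[OF M ch(3)])
  interpret B: mchart N V0 \<theta> by (rule mchart_atlas[OF smN ch(1)])
  note E = B.model_subspace
  define V1 where "V1 = V0 \<inter> (U0 \<inter> U)"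
  have "continuous_map (mtop N) (mtop M) (\<lambda>x. x)" using inc by (simp add: smooth_map_def)
  then have "openin (mtop N) {x \<in> topspace (mtop N). x \<in> U0 \<inter> U}"
    by (rule openin_continuous_map_preimage) (use A.open_dom U in blast)
  moreover have "V1 = V0 \<inter> {x \<in> topspace (mtop N). x \<in> U0 \<inter> U}" using B.U_sub by (auto simp: V1_def)
  ultimately have oV1: "openin (mtop N) V1" using B.open_dom openin_Int by metis
  have V1: "V1 \<subseteq> V0" "V1 \<subseteq> U0" "V1 \<subseteq> U" "n \<in> V1" using ch n by (auto simp: V1_def)
  have V1N: "V1 \<subseteq> topspace (mtop N)" using V1(1) B.U_sub by blast
  note oI = B.open_chart_image[OF oV1 V1(1)]
  define j where "j z = \<phi> (B.inv\<phi> z)" for z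
  have "smooth_on_set (\<theta> ` {x \<in> V0. x \<in> U0}) j"
    using inc ch(1,3) by (auto simp: smooth_map_def j_def[abs_def])
  then have sj: "smooth_on_set (\<theta> ` V1) j" by (rule smooth_on_set_subset) (use V1 in auto)
  let ?J = "\<lambda>z w. dirder (model N) j z w"
  \<comment> \<open>\<open>?J\<close> is the derivative of the inclusion \<open>j\<close> of
    \<open>N\<close> into \<open>M\<close> in the two charts.\<close>
  have coordsT: "A.coords (?T x v) = ?J (\<theta> x) (B.coords v)" if x: "x \<in> V1" and v: "v \<in> tangent_space N x" for x v
  proof -
    have xV: "x \<in> V0" "x \<in> U0" using x V1 by auto
    have "?T x v (\<lambda>y. \<phi> y \<bullet> b) = ?J (\<theta> x) (B.coords v) \<bullet> b" for b
    proof -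
      have sjb: "smooth_on_set (\<theta> ` V1) (\<lambda>z. j z \<bullet> b)"
        by (rule smooth_on_set_linear_compose[OF bounded_linear_inner_left sj])
      then have "smooth_near N x (\<lambda>y. \<phi> y \<bullet> b)"
        unfolding B.smooth_near_iff[OF xV(1)] using oV1 x V1 by (intro exI[of _ V1]) (auto simp: j_def)
      then have "B.tvec x (B.coords v) (\<lambda>y. \<phi> y \<bullet> b) = dirder (model N) (\<lambda>z. j z \<bullet> b) (\<theta> x) (B.coords v)"
        by (simp add: B.tvec_def j_def)
      also have "\<dots> = ?J (\<theta> x) (B.coords v) \<bullet> b"
        by (rule dirder_linear_compose[OF E oI bounded_linear_inner_left sj]) (use x in auto)
      finally show ?thesis
        using A.smooth_near_chart_inner[OF xV(2)] by (simp add: tangent_map_def B.tvec_coords[OF xV(1) v])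
    qed
    then show ?thesis unfolding A.coords_def by (simp add: euclidean_representation)
  qed
  let ?z0 = "\<theta> n"
  have z0: "?z0 \<in> \<theta> ` V1" using V1(4) by auto
  have linJ: "linear (?J z)" if "z \<in> \<theta> ` V1" for z by (rule linear_dirder[OF E oI sj that])
  \<comment> \<open>Injectivity of the tangent map at \<open>n\<close>, expressed in coordinates.
    Coordinates in \<open>M\<close> determine a vector only if it is tangent to \<open>M\<close>,
    which \<open>TN\<close> provides.\<close>
  have "inj_on (?J ?z0) (model N)"
  proof (rule inj_onI)
    fix u w assume uw: "u \<in> model N" "w \<in> model N" and eq: "?J ?z0 u = ?J ?z0 w"
    have nV: "n \<in> V0" "n \<in> U0" using ch by auto
    have t: "B.tvec n u \<in> tangent_space N n" "B.tvec n w \<in> tangent_space N n" using B.tvec_tangent[OF nV(1)] by auto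
    have "A.coords (?T n (B.tvec n u)) = A.coords (?T n (B.tvec n w))"
      using coordsT[OF V1(4)] t eq uw by (simp add: B.coords_tvec[OF nV(1)])
    then have "?T n (B.tvec n u) = ?T n (B.tvec n w)"
      using TN[OF n(1)] t by (intro A.tangent_coords_eqI[OF nV(2)]) auto
    then have "B.tvec n u = B.tvec n w" using injT[OF n(1)] t by (simp add: inj_on_def)
    then show "u = w" using B.coords_tvec[OF nV(1)] uw by metis
  qed
  from linear_exists_left_inverse_on[OF linJ[OF z0] E this]
  obtain K where K: "linear K" "\<And>v. v \<in> model N \<Longrightarrow> K (?J ?z0 v) = v" by auto
  have blK: "bounded_linear K" using K(1) by (simp add: linear_conv_bounded_linear)
  let ?P = "orth_proj (model N)"
  \<comment> \<open>\<open>k\<close> measures, on projected basis vectors, how far \<open>K\<close>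
    is from being a left inverse of \<open>?J z\<close>; it vanishes at \<open>?z0\<close>.\<close>
  define k where "k b z = ?P b - K (?J z (?P b))" for b z
  have sk: "smooth_on_set (\<theta> ` V1) (k b)" for b
  proof -
    have "smooth_on_set (\<theta> ` V1) (\<lambda>z. ?P b + (- 1) *\<^sub>R K (?J z (?P b)))"
      by (intro smooth_on_set_add smooth_on_set_const smooth_on_set_linear_compose[OF bounded_linear_scaleR_right]
          smooth_on_set_linear_compose[OF blK] smooth_on_set_dirder[OF E oI sj])
    then show ?thesis by (simp add: k_def[abs_def])
  qed
  define h where "h z = (\<Sum>b\<in>Basis. norm (k b z))" for z
  have ch: "continuous_on (\<theta> ` V1) h"
    unfolding h_def by (intro continuous_intros smooth_on_set_continuous sk)
  have h0: "h ?z0 = 0" by (simp add: h_def k_def K(2) orth_proj_in[OF E])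
  \<comment> \<open>The bound \<open>1/2\<close> becomes the contraction constant of the equation
    solved by the components of the lift.\<close>
  define V where "V = {x \<in> V1. h (\<theta> x) < 1/2}"
  have V: "V \<subseteq> V1" "n \<in> V" using V1(4) h0 by (auto simp: V_def)
  have oV: "openin (mtop N) V"
  proof -
    have "openin (top_of_set (\<theta> ` V1)) (\<theta> ` V1 \<inter> h -` {..<1/2})"
      using ch by (rule continuous_openin_preimage_gen) simp
    then have "openin (top_of_set (model N)) (\<theta> ` V1 \<inter> h -` {..<1/2})" using oI by (rule openin_trans)
    from B.open_chart_preimage[OF this] have "openin (mtop N) {q \<in> V0. \<theta> q \<in> \<theta> ` V1 \<inter> h -` {..<1/2}}" .
    moreover have "{q \<in> V0. \<theta> q \<in> \<theta> ` V1 \<inter> h -` {..<1/2}} = V"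
      using V1(1) B.inj_chart by (auto simp: V_def inj_on_def subset_iff)
    ultimately show ?thesis by simp
  qed
  have VV0: "V \<subseteq> V0" and VU: "V \<subseteq> U" using V V1 by auto
  \<comment> \<open>Injectivity of the tangent map leaves one candidate at each point; what has to
    be shown is its smoothness.\<close>
  define X' where "X' x = inv_into (tangent_space N x) (?T x) (X x)" for x
  have X': "X' x \<in> tangent_space N x" "?T x (X' x) = X x" if "x \<in> V" for x
  proof -
    have "X x \<in> ?T x ` tangent_space N x" by (rule tan) (use that V VU V1N in auto)
    then show "X' x \<in> tangent_space N x" "?T x (X' x) = X x"
      unfolding X'_def by (rule inv_into_into, rule f_inv_into_f)
  qed
  define a where "a z = B.coords (X' (B.inv\<phi> z))" for z
  define b where "b z = K (A.coords (X (B.inv\<phi> z)))" for z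
  have oVI: "openin (top_of_set (model N)) (\<theta> ` V)" by (rule B.open_chart_image[OF oV VV0])
  have sb: "smooth_on_set (\<theta> ` V) b"
  proof -
    have oUU: "openin (mtop M) (U0 \<inter> U)" using A.open_dom U by blast
    have "smooth_on_set (\<phi> ` (U0 \<inter> U)) (\<lambda>z. A.coords (X (A.inv\<phi> z)))"
      by (rule A.vector_field_coords_smooth[OF oUU _ vector_field_subset[OF X]]) auto
    moreover have "smooth_on_set (\<theta> ` V) j" using sj by (rule smooth_on_set_subset) (use V in auto)
    ultimately have "smooth_on_set (\<theta> ` V) (\<lambda>z. A.coords (X (A.inv\<phi> (j z))))"
      by (rule smooth_on_set_compose) (use VV0 V V1 in \<open>auto simp: j_def subset_iff\<close>)
    then have "smooth_on_set (\<theta> ` V) (\<lambda>z. K (A.coords (X (A.inv\<phi> (j z)))))"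
      by (rule smooth_on_set_linear_compose[OF blK])
    then show ?thesis
      by (rule smooth_on_set_cong[THEN iffD1, rotated]) (use VV0 V V1 in \<open>auto simp: j_def b_def subset_iff\<close>)
  qed
  \<comment> \<open>Splits \<open>a z\<close> into \<open>K (?J z (a z))\<close>, which is the
    smooth \<open>b z\<close>, and the defect of \<open>K\<close> as a left inverse, expanded over
    \<open>Basis\<close>: a linear fixed-point equation with smooth coefficients.\<close>
  have eq: "a z = b z + (\<Sum>c\<in>Basis. (a z \<bullet> c) *\<^sub>R k c z)" if z: "z \<in> \<theta> ` V" for z
  proof -
    obtain x where x: "x \<in> V" "z = \<theta> x" "x \<in> V0" "x \<in> V1" using z VV0 V by blast
    have aE: "a z \<in> model N" using B.coords_in_model[OF x(3) X'(1)[OF x(1)]] x by (simp add: a_def)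
    have "?J z (a z) = A.coords (X x)"
      using coordsT[OF x(4) X'(1)[OF x(1)]] X'(2)[OF x(1)] x by (simp add: a_def)
    then have 1: "b z = K (?J z (a z))" using x by (simp add: b_def)
    have zV1: "z \<in> \<theta> ` V1" using x by auto
    have lin: "linear (\<lambda>v. ?P v - K (?J z (?P v)))"
      by (intro linear_compose_sub linear_orth_proj[OF E] linear_compose[OF linear_compose[OF linear_orth_proj[OF E] linJ[OF zV1]] K(1), unfolded o_def])
    have "(\<Sum>c\<in>Basis. (a z \<bullet> c) *\<^sub>R k c z) = ?P (\<Sum>c\<in>Basis. (a z \<bullet> c) *\<^sub>R c) - K (?J z (?P (\<Sum>c\<in>Basis. (a z \<bullet> c) *\<^sub>R c)))"
      unfolding k_def by (simp only: linear_sum[OF lin] linear_scale[OF lin])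
    also have "\<dots> = a z - b z"
      unfolding euclidean_representation using 1 orth_proj_id[OF E aE] by simp
    finally show ?thesis by simp
  qed
  have "Ck_on m (\<lambda>y. a (?P y)) (?P -` (\<theta> ` V))" for m
  proof (rule linear_fixpoint_Ck_on[where I = Basis and a = "\<lambda>c y. k c (?P y)" and b = "\<lambda>y. b (?P y)"
        and B = "\<lambda>c g w. (w \<bullet> c) *\<^sub>R g"])
    show "open (?P -` (\<theta> ` V))" by (rule open_vimage_orth_proj[OF E oVI])
    show "bounded_bilinear (\<lambda>g w. (w \<bullet> c) *\<^sub>R g)" for c :: 'e
      using bounded_bilinear.flip[OF bounded_bilinear.comp1[OF bounded_bilinear_scaleR bounded_linear_inner_left[of c]]] .
    have "smooth_on_set (\<theta> ` V) (k c)" for c using sk by (rule smooth_on_set_subset) (use V in auto)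
    then show "Ck_on m (\<lambda>y. k c (?P y)) (?P -` (\<theta> ` V))" for c
      using smooth_on_set_orth_proj[OF E oVI] by blast
    show "Ck_on m (\<lambda>y. b (?P y)) (?P -` (\<theta> ` V))"
      using sb smooth_on_set_orth_proj[OF E oVI] by blast
    show "a (?P y) = b (?P y) + (\<Sum>c\<in>Basis. (a (?P y) \<bullet> c) *\<^sub>R k c (?P y))" if "y \<in> ?P -` (\<theta> ` V)" for y
      by (rule eq) (use that in simp)
    show "norm (\<Sum>c\<in>Basis. (w \<bullet> c) *\<^sub>R k c (?P y)) \<le> norm w / 2" if y: "y \<in> ?P -` (\<theta> ` V)" for y w
    proof -
      have "norm (\<Sum>c\<in>Basis. (w \<bullet> c) *\<^sub>R k c (?P y)) \<le> norm w * h (?P y)"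
        unfolding h_def by (rule norm_directional_le)
      also have "\<dots> \<le> norm w * (1/2)" using y by (intro mult_left_mono) (auto simp: V_def)
      finally show ?thesis by simp
    qed
  qed
  then have "smooth_on_set (\<theta> ` V) a" using smooth_on_set_orth_proj[OF E oVI] by blast
  then have "vector_field N V X'"
    unfolding B.vector_field_iff[OF oV VV0] a_def using X'(1) by blast
  moreover have "related_by_inclusion M V X' X" using X'(2) by (simp add: related_by_inclusion_def)
  ultimately show thesis using that[OF oV V(2) VU] by blast
qed

section \<open>The two-form induced on an integral manifold\<close>

text \<open>Every admissible value is \<open>- \<beta> n (X n)\<close>, where \<open>X n\<close> is
  the image of \<open>v\<close> and so lies in \<open>G0\<close>; then \<open>(X n, 0)\<close> is in
  \<open>D n\<close> and orthogonal to \<open>(Y n, \<beta> n)\<close>. The description operator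
  also needs one admissible choice, obtained by lifting sections with zero one-form to
  \<open>N\<close>.\<close>

lemma induced_two_form_G0:
  fixes M N :: "('a, 'e::euclidean_space) mfd"
  assumes M: "smooth_manifold M" and D: "dirac_structure M D" and N: "integral_manifold M (G0 M D) N"
    and n: "n \<in> topspace (mtop N)" and v: "v \<in> tangent_space N n" and w: "w \<in> tangent_space N n"
  shows "induced_two_form M D N n v w = 0"
proof -
  let ?T = "tangent_map M (\<lambda>x. x)"
  note N' = N[unfolded integral_manifold_def]
  note imm = N'[THEN conjunct1]
  note imm' = imm[unfolded immersed_submanifold_def]
  have TN: "?T x ` tangent_space N x = G0 M D x" if "x \<in> topspace (mtop N)" for x
    by (rule bspec[OF N'[THEN conjunct2, THEN conjunct2] that])
  have injT: "inj_on (?T n) (tangent_space N n)"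
    by (rule bspec[OF imm'[THEN conjunct2, THEN conjunct2, THEN conjunct2] n])
  have nM: "n \<in> topspace (mtop M)"
    by (rule subsetD[OF imm'[THEN conjunct2, THEN conjunct1] n])
  have TM: "?T x ` tangent_space N x \<subseteq> tangent_space M x" if "x \<in> topspace (mtop N)" for x
    unfolding TN[OF that] by (rule subsetI) (rule G0_tangent)
  \<comment> \<open>A section \<open>(X, 0)\<close> through the image of \<open>u\<close> is tangent
    to \<open>N\<close> at every point of \<open>N\<close> in its domain, because the tangent spaces
    of \<open>N\<close> are given by \<open>G0\<close>; so it lifts, and injectivity at
    \<open>n\<close> makes the lift pass through \<open>u\<close>.\<close>
  have lift: "\<exists>V X' U X. openin (mtop N) V \<and> n \<in> V \<and> V \<subseteq> U \<and> vector_field N V X' \<and> X' n = u \<and>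
      bundle_section M D U X (\<lambda>q v. 0) \<and> related_by_inclusion M V X' X" if u: "u \<in> tangent_space N n" for u
  proof -
    have "?T n u \<in> G0 M D n" using TN[OF n] u by blast
    then obtain U X where X: "n \<in> U" "bundle_section M D U X (\<lambda>q v. 0)" "X n = ?T n u"
      by (auto simp: G0_def)
    have U: "openin (mtop M) U" and vX: "vector_field M U X" using X(2) by (auto simp: bundle_section_def)
    have tan: "X x \<in> ?T x ` tangent_space N x" if "x \<in> U" "x \<in> topspace (mtop N)" for x
      using TN[OF that(2)] that(1) X(2) by (auto simp: G0_def)
    obtain V X' where V: "openin (mtop N) V" "n \<in> V" "V \<subseteq> U" "vector_field N V X'" "related_by_inclusion M V X' X"
      using lift_tangent_field[OF M imm n X(1) U vX tan TM] by blast
    have "X' n \<in> tangent_space N n" "?T n (X' n) = ?T n u"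
      using V X(3) by (auto simp: vector_field_def related_by_inclusion_def)
    then have "X' n = u" using injT u by (simp add: inj_on_def)
    then show ?thesis using V X(2) by blast
  qed
  obtain V X' U X where 1: "openin (mtop N) V" "n \<in> V" "V \<subseteq> U" "vector_field N V X'" "X' n = v"
    "bundle_section M D U X (\<lambda>q v. 0)" "related_by_inclusion M V X' X"
    using lift[OF v] by blast
  obtain V2 Y' U2 Y where 2: "openin (mtop N) V2" "n \<in> V2" "V2 \<subseteq> U2" "vector_field N V2 Y'" "Y' n = w"
    "bundle_section M D U2 Y (\<lambda>q v. 0)" "related_by_inclusion M V2 Y' Y"
    using lift[OF w] by blast
  \<comment> \<open>The two-form is defined with one pair of domains for both fields, hence the
    intersections.\<close>
  have oU: "openin (mtop M) (U \<inter> U2)" using 1(6) 2(6) by (auto simp: bundle_section_def)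
  have s: "bundle_section M D (U \<inter> U2) X (\<lambda>q v. 0)" "bundle_section M D (U \<inter> U2) Y (\<lambda>q v. 0)"
    using bundle_section_subset[OF 1(6) oU] bundle_section_subset[OF 2(6) oU] by auto
  have f: "vector_field N (V \<inter> V2) X'" "vector_field N (V \<inter> V2) Y'"
    using vector_field_subset[OF 1(4)] vector_field_subset[OF 2(4)] by auto
  have r: "related_by_inclusion M (V \<inter> V2) X' X" "related_by_inclusion M (V \<inter> V2) Y' Y"
    using 1(7) 2(7) by (auto simp: related_by_inclusion_def)
  have o: "openin (mtop N) (V \<inter> V2)" "n \<in> V \<inter> V2" "V \<inter> V2 \<subseteq> U \<inter> U2" using 1 2 by auto
  show ?thesis
    unfolding induced_two_form_def
  proof (rule the_equality)
    show "\<exists>V X' Y' U X \<alpha> Y \<beta>.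
        openin (mtop N) V \<and> n \<in> V \<and> vector_field N V X' \<and> vector_field N V Y' \<and>
        X' n = v \<and> Y' n = w \<and>
        V \<subseteq> U \<and> bundle_section M D U X \<alpha> \<and> bundle_section M D U Y \<beta> \<and>
        related_by_inclusion M V X' X \<and> related_by_inclusion M V Y' Y \<and>
        0 = \<alpha> n (Y n) \<and> 0 = - \<beta> n (X n)"
      by (rule exI[of _ "V \<inter> V2"], rule exI[of _ X'], rule exI[of _ Y'], rule exI[of _ "U \<inter> U2"],
          rule exI[of _ X], rule exI[of _ "\<lambda>q v. 0"], rule exI[of _ Y], rule exI[of _ "\<lambda>q v. 0"])
        (use o f r s 1(5) 2(5) in simp)
  next
    fix c
    assume "\<exists>V X' Y' U X \<alpha> Y \<beta>.
        openin (mtop N) V \<and> n \<in> V \<and> vector_field N V X' \<and> vector_field N V Y' \<and>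
        X' n = v \<and> Y' n = w \<and>
        V \<subseteq> U \<and> bundle_section M D U X \<alpha> \<and> bundle_section M D U Y \<beta> \<and>
        related_by_inclusion M V X' X \<and> related_by_inclusion M V Y' Y \<and>
        c = \<alpha> n (Y n) \<and> c = - \<beta> n (X n)"
    then obtain V X' U X Y \<beta> where h: "n \<in> V" "V \<subseteq> U" "X' n = v" "bundle_section M D U Y \<beta>"
      "related_by_inclusion M V X' X" "c = - \<beta> n (X n)" by blast
    have "X n = ?T n v" using h by (auto simp: related_by_inclusion_def)
    then have "X n \<in> G0 M D n" using TN[OF n] v by blast
    then have "(X n, \<lambda>v. 0) \<in> D n" by (rule G0_fibre)
    moreover have "(Y n, \<beta> n) \<in> orthogonal_fibre M n (D n)"
      using h(1,2,4) D nM by (auto simp: bundle_section_def dirac_structure_def)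
    ultimately have "0 + \<beta> n (X n) = 0" by (auto simp: orthogonal_fibre_def)
    then show "c = 0" using h(6) by simp
  qed
qed

theorem corollary2p3:
  fixes M :: "('a, 'e::euclidean_space) mfd" and D :: "'a pontryagin_family"
  assumes "smooth_manifold M" and "closed_dirac M D"
  shows "completely_integrable M (G0 M D) \<and>
    (\<forall>N. leaf M (G0 M D) N \<longrightarrow>
      (\<forall>n\<in>topspace (mtop N). \<forall>v\<in>tangent_space N n. \<forall>w\<in>tangent_space N n.
        induced_two_form M D N n v w = 0))"
proof
  show "completely_integrable M (G0 M D)"
    unfolding completely_integrable_def using G0_integral_manifold[OF assms] by metis
  show "\<forall>N. leaf M (G0 M D) N \<longrightarrow>
      (\<forall>n\<in>topspace (mtop N). \<forall>v\<in>tangent_space N n. \<forall>w\<in>tangent_space N n.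
        induced_two_form M D N n v w = 0)"
    using induced_two_form_G0[OF assms(1)] assms(2) by (auto simp: leaf_def closed_dirac_def)
qed

end
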